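(* Let $n=1$ and $t>0$. Then $\mathcal D_0^{t}=\mathcal R_{cl}$. That is, the unique closed $\alpha$-invariant subspace $\mathcal D_0^t$ of $\mathrm{BUC}(\mathbb C)$ such that $\mathcal R(\mathbb C,\sigma_t)=\mathcal T^{t}_{lin}(\mathcal D_0^t)$ is $$\mathcal R_{cl}=C^\ast\big(\{(\lambda-2i\sigma_t(\cdot,z))^{-1}:\lambda\in\mathbb C\setminus i\mathbb R,\ z\in\mathbb C\}\big)\subset\mathrm{BUC}(\mathbb C).$$
   Context: For $t>0$ let $\sigma_t(w,z)=\operatorname{Im}(w\overline z)/t$ on $\mathbb C$, $d\mu_t(z)=\frac{1}{\pi t}e^{-|z|^2/t}dV(z)$, and $F_t^2=L^2(\mathbb C,\mu_t)\cap\mathrm{Hol}(\mathbb C)$ the Fock-Bargmann space, with orthogonal projection $P^t:L^2(\mathbb C,\mu_t)\to F_t^2$. For measurable $\varphi$, the Toeplitz operator is $T^t_\varphi g=P^t(\varphi g)$ with domain $\{g\in F_t^2:\varphi g\in L^2(\mathbb C,\mu_t)\}$. The operators $T^t_{2\sigma_t(\cdot,z)}$ are self-adjoint. The resolvent algebra $\mathcal R(\mathbb C,\sigma_t)\subset\mathcal L(F_t^2)$ is the $C^\ast$ algebra generated by all resolvents $(i\lambda-T^t_{2\sigma_t(\cdot,z)})^{-1}$, $\lambda\in\mathbb R\setminus\{0\}$, $z\in\mathbb C$. $\mathrm{BUC}(\mathbb C)$ is the $C^\ast$ algebra of bounded uniformly continuous functions with sup norm; $C^\ast(\cdot)$ denotes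 the generated $C^\ast$ (sub)algebra. A subspace of $\mathrm{BUC}(\mathbb C)$ is $\alpha$-invariant if it is invariant under all translations $\alpha_z(f)(w)=f(w-z)$, $z\in\mathbb C$. For a subspace $\mathcal D\subset\mathrm{BUC}(\mathbb C)$, $\mathcal T^t_{lin}(\mathcal D)$ is the operator norm closure of $\{T_f^t:f\in\mathcal D\}$. Existence and uniqueness of $\mathcal D_0^t$ come from the known correspondence theorem: let $\mathcal C_1^t$ be the set of $A\in\mathcal L(F^2_t)$ for which $z\mapsto W_zAW_{-z}$ is operator norm continuous, where $W_zg(w)=e^{w\overline z/t-|z|^2/(2t)}g(w-z)$; for every closed subspace $\mathcal D_1\subset\mathcal C_1^t$ invariant under all maps $A\mapsto W_zAW_{-z}$ there is a unique closed $\alpha$-invariant subspace $\mathcal D_0\subset\mathrm{BUC}(\mathbb C)$ with $\mathcal D_1=\mathcal T^t_{lin}(\mathcal D_0)$. It applies to $\mathcal D_1=\mathcal R(\mathbb C,\sigma_t)$. *)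

theory Defs
  imports "HOL-Analysis.Analysis"
begin

definition sigma :: "real \<Rightarrow> complex \<Rightarrow> complex \<Rightarrow> real" where
  "sigma t w z = Im (w * cnj z) / t"

definition gauss_measure :: "real \<Rightarrow> complex measure" where
  "gauss_measure t = density lborel (\<lambda>z. ennreal (exp (- (cmod z)\<^sup>2 / t) / (pi * t)))"

(* Square-integrable functions, not identified almost everywhere.  On the Fock space this
   makes no difference: holomorphic functions that agree almost everywhere are equal. *)
definition L2 :: "real \<Rightarrow> (complex \<Rightarrow> complex) set" where
  "L2 t = {f \<in> borel_measurable (gauss_measure t).
             integrable (gauss_measure t) (\<lambda>z. (cmod (f z))\<^sup>2)}"

definition L2_inner :: "real \<Rightarrow> (complex \<Rightarrow> complex) \<Rightarrow> (complex \<Rightarrow> complex) \<Rightarrow> complex" where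
  "L2_inner t f g = (\<integral>z. f z * cnj (g z) \<partial>gauss_measure t)"

definition L2_norm :: "real \<Rightarrow> (complex \<Rightarrow> complex) \<Rightarrow> real" where
  "L2_norm t f = sqrt (\<integral>z. (cmod (f z))\<^sup>2 \<partial>gauss_measure t)"

definition fock :: "real \<Rightarrow> (complex \<Rightarrow> complex) set" where
  "fock t = {g \<in> L2 t. g holomorphic_on UNIV}"

definition fock_proj :: "real \<Rightarrow> (complex \<Rightarrow> complex) \<Rightarrow> (complex \<Rightarrow> complex)" where
  "fock_proj t f =
     (THE h. h \<in> fock t \<and> (\<forall>g\<in>fock t. L2_inner t (\<lambda>w. f w - h w) g = 0))"

(* Operators are total functions on the type of all functions; so that equality of operators
   is equality of functions, they take the value 0 outside their domain. *)
type_synonym fock_op = "(complex \<Rightarrow> complex) \<Rightarrow> (complex \<Rightarrow> complex)"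

definition bounded_ops :: "real \<Rightarrow> fock_op set" where
  "bounded_ops t = {A.
     (\<forall>f\<in>fock t. A f \<in> fock t) \<and>
     (\<forall>f\<in>fock t. \<forall>g\<in>fock t. A (\<lambda>w. f w + g w) = (\<lambda>w. A f w + A g w)) \<and>
     (\<forall>c. \<forall>f\<in>fock t. A (\<lambda>w. c * f w) = (\<lambda>w. c * A f w)) \<and>
     (\<exists>K. \<forall>f\<in>fock t. L2_norm t (A f) \<le> K * L2_norm t f) \<and>
     (\<forall>f. f \<notin> fock t \<longrightarrow> A f = (\<lambda>w. 0))}"

definition op_norm :: "real \<Rightarrow> fock_op \<Rightarrow> real" where
  "op_norm t A = (SUP g\<in>{g \<in> fock t. L2_norm t g \<le> 1}. L2_norm t (A g))"

definition op_closure :: "real \<Rightarrow> fock_op set \<Rightarrow> fock_op set" where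
  "op_closure t S = {A \<in> bounded_ops t.
     \<forall>e>0. \<exists>B\<in>S. op_norm t (\<lambda>g w. A g w - B g w) < e}"

definition is_op_adjoint :: "real \<Rightarrow> fock_op \<Rightarrow> fock_op \<Rightarrow> bool" where
  "is_op_adjoint t A B \<longleftrightarrow> B \<in> bounded_ops t \<and>
     (\<forall>f\<in>fock t. \<forall>g\<in>fock t. L2_inner t (A f) g = L2_inner t f (B g))"

definition op_cstar_subalgebra :: "real \<Rightarrow> fock_op set \<Rightarrow> bool" where
  "op_cstar_subalgebra t S \<longleftrightarrow> S \<subseteq> bounded_ops t \<and>
     (\<lambda>g w. 0) \<in> S \<and>
     (\<forall>A\<in>S. \<forall>B\<in>S. (\<lambda>g w. A g w + B g w) \<in> S) \<and>
     (\<forall>c. \<forall>A\<in>S. (\<lambda>g w. c * A g w) \<in> S) \<and>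
     (\<forall>A\<in>S. \<forall>B\<in>S. A \<circ> B \<in> S) \<and>
     (\<forall>A\<in>S. \<forall>B. is_op_adjoint t A B \<longrightarrow> B \<in> S) \<and>
     op_closure t S \<subseteq> S"

definition toeplitz_dom :: "real \<Rightarrow> (complex \<Rightarrow> complex) \<Rightarrow> (complex \<Rightarrow> complex) set" where
  "toeplitz_dom t \<phi> = {g \<in> fock t. (\<lambda>w. \<phi> w * g w) \<in> L2 t}"

definition toeplitz :: "real \<Rightarrow> (complex \<Rightarrow> complex) \<Rightarrow> fock_op" where
  "toeplitz t \<phi> g =
     (if g \<in> toeplitz_dom t \<phi> then fock_proj t (\<lambda>w. \<phi> w * g w) else (\<lambda>w. 0))"

(* (c - T)^{-1} for the possibly unbounded Toeplitz operator T with symbol phi *)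
definition toeplitz_resolvent :: "real \<Rightarrow> (complex \<Rightarrow> complex) \<Rightarrow> complex \<Rightarrow> fock_op" where
  "toeplitz_resolvent t \<phi> c g =
     (if g \<in> fock t
      then (THE f. f \<in> toeplitz_dom t \<phi> \<and> (\<lambda>w. c * f w - toeplitz t \<phi> f w) = g)
      else (\<lambda>w. 0))"

definition resolvent_algebra :: "real \<Rightarrow> fock_op set" where
  "resolvent_algebra t = op_cstar_subalgebra t hull
     {toeplitz_resolvent t (\<lambda>w. complex_of_real (2 * sigma t w z)) (\<i> * complex_of_real l) | l z.
        l \<noteq> 0}"

definition T_lin :: "real \<Rightarrow> (complex \<Rightarrow> complex) set \<Rightarrow> fock_op set" where
  "T_lin t D = op_closure t (toeplitz t ` D)"

definition BUC :: "(complex \<Rightarrow> complex) set" where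
  "BUC = {f. bounded (range f) \<and> uniformly_continuous_on UNIV f}"

definition BUC_closed_subspace :: "(complex \<Rightarrow> complex) set \<Rightarrow> bool" where
  "BUC_closed_subspace D \<longleftrightarrow> D \<subseteq> BUC \<and>
     (\<lambda>w. 0) \<in> D \<and>
     (\<forall>f\<in>D. \<forall>g\<in>D. (\<lambda>w. f w + g w) \<in> D) \<and>
     (\<forall>c. \<forall>f\<in>D. (\<lambda>w. c * f w) \<in> D) \<and>
     (\<forall>F f. (\<forall>n. F n \<in> D) \<and> uniform_limit UNIV F f sequentially \<longrightarrow> f \<in> D)"

definition BUC_cstar_subalgebra :: "(complex \<Rightarrow> complex) set \<Rightarrow> bool" where
  "BUC_cstar_subalgebra D \<longleftrightarrow> BUC_closed_subspace D \<and>
     (\<forall>f\<in>D. \<forall>g\<in>D. (\<lambda>w. f w * g w) \<in> D) \<and>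
     (\<forall>f\<in>D. (\<lambda>w. cnj (f w)) \<in> D)"

definition alpha :: "complex \<Rightarrow> (complex \<Rightarrow> complex) \<Rightarrow> (complex \<Rightarrow> complex)" where
  "alpha z f = (\<lambda>w. f (w - z))"

definition alpha_invariant :: "(complex \<Rightarrow> complex) set \<Rightarrow> bool" where
  "alpha_invariant D \<longleftrightarrow> (\<forall>z. \<forall>f\<in>D. alpha z f \<in> D)"

definition R_cl :: "real \<Rightarrow> (complex \<Rightarrow> complex) set" where
  "R_cl t = BUC_cstar_subalgebra hull
     {(\<lambda>w. inverse (l - 2 * \<i> * complex_of_real (sigma t w z))) | l z. Re l \<noteq> 0}"

definition corresponds_to_resolvent_algebra :: "real \<Rightarrow> (complex \<Rightarrow> complex) set \<Rightarrow> bool" where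
  "corresponds_to_resolvent_algebra t D \<longleftrightarrow>
     BUC_closed_subspace D \<and> alpha_invariant D \<and> resolvent_algebra t = T_lin t D"

definition D0 :: "real \<Rightarrow> (complex \<Rightarrow> complex) set" where
  "D0 t = (THE D. corresponds_to_resolvent_algebra t D)"

end

theory Submission
  imports Defs "HOL-Complex_Analysis.Complex_Analysis" "HOL-Probability.Probability"
begin

text \<open>
  Let \<open>W\<^sub>v\<close> be the Weyl operators on the Fock space. The resolvents are Laplace transforms of
  \<open>s \<mapsto> W\<^sub>s\<^sub>v\<close>, products of resolvents are integrals of \<open>W\<^sub>v\<close> against a density with a unimodular
  phase, and the generators of the classical algebra are the corresponding integrals of the characters
  \<open>exp (2 * \<i> * \<sigma>(\<cdot>, v))\<close>. Since the Toeplitz operator of this character is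
  \<open>exp (- |v|\<^sup>2 / (2 * t)) * W\<^sub>v\<close>, Toeplitz quantization multiplies densities by a Gaussian. By the
  Weierstrass theorem in the variable \<open>exp (- s)\<close>, both algebras contain the integrals against all
  integrable densities on a ray, and by induction on all products of rays; there the phase and the
  Gaussian factor can be put in and, after a cutoff, be taken out. This gives the equality of the
  resolvent algebra with the Toeplitz image of the classical one.

  For uniqueness, the matrix elements of a Toeplitz operator at the shifted monomials \<open>W\<^sub>z w\<^sup>k\<close> are the
  convolutions of its symbol with \<open>|w|\<^sup>2\<^sup>k exp (- |w|\<^sup>2 / t)\<close>. From all these moments one obtains the
  convolutions with narrower and narrower Gaussians, and hence the symbol itself, as a uniform limit.
\<close>

section \<open>Integration on the complex plane\<close>

text \<open>On the algebra side the obstacle is that at a sum of points on two rays neither the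
  Gaussian factor nor the Weyl phase splits into functions of the two parameters. Product densities
  are therefore not enough: every membership is proved for all integrable densities on the parameter
  space at once. This works because the L1 norm of a density bounds both the operator norm of its
  Weyl integral and the sup norm of its symbol, so one induction serves both algebras. For the
  resolvents the delicate point is the domain of an unbounded Toeplitz operator:
  \<open>sigma\<close> times a Fock function need not be square-integrable. For the candidate given
  by the Laplace integral, the product is a Fock function plus a multiple of \<open>hankel\<close>,
  an operator whose kernel passes a Schur test although the two terms of its formula may both fail
  to be square-integrable. For uniqueness, undoing the convolution with one Gaussian is not a
  bounded operation. The monomials supply the Taylor coefficients of the Gaussian in its width, so a
  narrower one is reached by a convergent series, without any division on the Fourier side.\<close>

lemma lborel_complex:
  "(lborel :: complex measure) = distr (lborel \<Otimes>\<^sub>M lborel) borel (\<lambda>(x, y). Complex x y)"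
proof (rule lborel_eqI)
  have m[measurable]: "(\<lambda>(x, y). Complex x y) \<in> borel_measurable (borel \<Otimes>\<^sub>M borel)"
    unfolding Complex_eq case_prod_beta by measurable
  fix l u :: complex
  assume le: "\<And>b. b \<in> Basis \<Longrightarrow> l \<bullet> b \<le> u \<bullet> b"
  have le': "Re l \<le> Re u" "Im l \<le> Im u"
    using le[of 1] le[of \<i>] by (auto simp: Basis_complex_def inner_complex_def)
  have "(\<lambda>(x, y). Complex x y) -` box l u = {Re l<..<Re u} \<times> {Im l<..<Im u}"
    by (auto simp: box_def Basis_complex_def inner_complex_def)
  then have "emeasure (distr (lborel \<Otimes>\<^sub>M lborel) borel (\<lambda>(x, y). Complex x y)) (box l u)
    = emeasure (lborel \<Otimes>\<^sub>M lborel) ({Re l<..<Re u} \<times> {Im l<..<Im u})"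
    by (subst emeasure_distr) (auto simp: space_pair_measure)
  also have "\<dots> = ennreal ((Re u - Re l) * (Im u - Im l))"
    using le' by (subst lborel.emeasure_pair_measure_Times) (auto simp: ennreal_mult)
  finally show "emeasure (distr (lborel \<Otimes>\<^sub>M lborel) borel (\<lambda>(x, y). Complex x y)) (box l u)
      = ennreal (\<Prod>b\<in>Basis. (u - l) \<bullet> b)"
    by (simp add: Basis_complex_def inner_complex_def)
qed simp

lemma borel_measurable_Complex[measurable (raw)]:
  assumes [measurable]: "f \<in> borel_measurable M" "g \<in> borel_measurable M"
  shows "(\<lambda>x. Complex (f x) (g x)) \<in> borel_measurable M"
  unfolding Complex_eq by measurable

lemma borel_measurable_cnj[measurable (raw)]:
  "f \<in> borel_measurable M \<Longrightarrow> (\<lambda>x. cnj (f x)) \<in> borel_measurable M"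
  by (rule borel_measurable_continuous_on[OF continuous_on_cnj[OF continuous_on_id]])

lemma nn_integral_complex:
  fixes F :: "complex \<Rightarrow> ennreal"
  assumes [measurable]: "F \<in> borel_measurable borel"
  shows "(\<integral>\<^sup>+z. F z \<partial>lborel) = (\<integral>\<^sup>+y. \<integral>\<^sup>+x. F (Complex x y) \<partial>lborel \<partial>lborel)"
proof -
  have "(\<integral>\<^sup>+z. F z \<partial>lborel) = (\<integral>\<^sup>+p. F (Complex (fst p) (snd p)) \<partial>(lborel \<Otimes>\<^sub>M lborel))"
    by (subst lborel_complex, subst nn_integral_distr) (auto simp: case_prod_beta)
  also have "\<dots> = (\<integral>\<^sup>+y. \<integral>\<^sup>+x. F (Complex x y) \<partial>lborel \<partial>lborel)"
    by (subst lborel_pair.nn_integral_snd[symmetric]) (auto)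
  finally show ?thesis .
qed

lemma nn_integral_complex':
  fixes F :: "complex \<Rightarrow> ennreal"
  assumes [measurable]: "F \<in> borel_measurable borel"
  shows "(\<integral>\<^sup>+z. F z \<partial>lborel) = (\<integral>\<^sup>+x. \<integral>\<^sup>+y. F (Complex x y) \<partial>lborel \<partial>lborel)"
  by (subst nn_integral_complex, simp, subst lborel_pair.Fubini') auto

text \<open>A rotation is done by two one-dimensional affine substitutions, one in each coordinate,
  whose Jacobians \<open>\<bar>1/a\<bar>\<close> and \<open>\<bar>a\<bar>\<close> cancel. Both need
  \<open>a = Re c\<close> to be nonzero.\<close>

lemma nn_integral_rotate_aux:
  fixes F :: "complex \<Rightarrow> ennreal"
  assumes [measurable]: "F \<in> borel_measurable borel" and c: "cmod c = 1" "Re c \<noteq> 0"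
  shows "(\<integral>\<^sup>+z. F (c * z) \<partial>lborel) = (\<integral>\<^sup>+z. F z \<partial>lborel)"
proof -
  define a b where "a = Re c" and "b = Im c"
  have ab: "a\<^sup>2 + b\<^sup>2 = 1" "a \<noteq> 0"
    using c unfolding a_def b_def by (auto simp: cmod_power2[symmetric])
  have cz: "c * Complex x y = Complex (a * x - b * y) (b * x + a * y)" for x y
    by (simp add: complex_eq_iff a_def b_def)
  have 1: "(\<integral>\<^sup>+x. F (Complex (a * x - b * y) (b * x + a * y)) \<partial>lborel)
      = (\<integral>\<^sup>+x. ennreal \<bar>1/a\<bar> * F (Complex x ((b * x + y) / a)) \<partial>lborel)" for y
  proof -
    have "(\<integral>\<^sup>+x. F (Complex (a * x - b * y) (b * x + a * y)) \<partial>lborel)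
      = \<bar>1/a\<bar> * (\<integral>\<^sup>+x. F (Complex (a * (b * y / a + 1/a * x) - b * y) (b * (b * y / a + 1/a * x) + a * y)) \<partial>lborel)"
      using ab by (intro nn_integral_real_affine) auto
    also have "\<dots> = \<bar>1/a\<bar> * (\<integral>\<^sup>+x. F (Complex x ((b * x + y) / a)) \<partial>lborel)"
    proof -
      have "a * (b * y / a + 1/a * x) - b * y = x" for x
        using ab by (simp add: field_simps)
      moreover have "b * (b * y / a + 1/a * x) + a * y = (b * x + y) / a" for x
      proof -
        have "(b * (b * y / a + 1/a * x) + a * y) * a = b * x + (a\<^sup>2 + b\<^sup>2) * y"
          using ab(2) by (simp add: field_simps power2_eq_square)
        then have "(b * (b * y / a + 1/a * x) + a * y) * a = b * x + y"
          by (simp only: ab(1) mult_1_left)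
        then show ?thesis using ab(2) by (metis nonzero_mult_div_cancel_right)
      qed
      ultimately show ?thesis by simp
    qed
    also have "\<dots> = (\<integral>\<^sup>+x. ennreal \<bar>1/a\<bar> * F (Complex x ((b * x + y) / a)) \<partial>lborel)"
      by (subst nn_integral_cmult) auto
    finally show ?thesis .
  qed
  have "(\<integral>\<^sup>+z. F (c * z) \<partial>lborel)
      = (\<integral>\<^sup>+y. \<integral>\<^sup>+x. ennreal \<bar>1/a\<bar> * F (Complex x ((b * x + y) / a)) \<partial>lborel \<partial>lborel)"
    by (subst nn_integral_complex) (auto simp: cz 1)
  also have "\<dots> = (\<integral>\<^sup>+x. \<integral>\<^sup>+y. ennreal \<bar>1/a\<bar> * F (Complex x ((b * x + y) / a)) \<partial>lborel \<partial>lborel)"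
    by (subst lborel_pair.Fubini') auto
  also have "\<dots> = (\<integral>\<^sup>+x. \<integral>\<^sup>+y. F (Complex x y) \<partial>lborel \<partial>lborel)"
  proof (rule nn_integral_cong)
    fix x :: real
    have eq: "ennreal \<bar>1/a\<bar> * ennreal \<bar>a\<bar> = 1"
      using ab by (subst ennreal_mult[symmetric]) auto
    have "(\<integral>\<^sup>+y. ennreal \<bar>1/a\<bar> * F (Complex x ((b * x + y) / a)) \<partial>lborel)
       = ennreal \<bar>1/a\<bar> * (\<bar>a\<bar> * (\<integral>\<^sup>+y. F (Complex x ((b * x + (- b * x + a * y)) / a)) \<partial>lborel))"
      using ab by (subst nn_integral_cmult, simp, subst nn_integral_real_affine[of _ a "- b * x"]) auto
    also have "\<dots> = (ennreal \<bar>1/a\<bar> * ennreal \<bar>a\<bar>) * (\<integral>\<^sup>+y. F (Complex x y) \<partial>lborel)"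
      using ab by (simp add: mult.assoc)
    finally show "(\<integral>\<^sup>+y. ennreal \<bar>1/a\<bar> * F (Complex x ((b * x + y) / a)) \<partial>lborel)
       = (\<integral>\<^sup>+y. F (Complex x y) \<partial>lborel)" unfolding eq by simp
  qed
  also have "\<dots> = (\<integral>\<^sup>+z. F z \<partial>lborel)"
    by (subst nn_integral_complex') auto
  finally show ?thesis .
qed

lemma nn_integral_rotate:
  fixes F :: "complex \<Rightarrow> ennreal"
  assumes [measurable]: "F \<in> borel_measurable borel" and c: "cmod c = 1"
  shows "(\<integral>\<^sup>+z. F (c * z) \<partial>lborel) = (\<integral>\<^sup>+z. F z \<partial>lborel)"
proof (cases "Re c = 0")
  case False
  then show ?thesis using nn_integral_rotate_aux[OF assms(1) c] by simp
next
  case True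
  \<comment> \<open>Here \<open>c\<close> is \<open>\<i>\<close> or \<open>- \<i>\<close>. Splitting
    off an eighth of a turn writes it as a product of two rotations whose real parts do not
    vanish.\<close>
  define d where "d = c * cis (pi/4)"
  define e where "e = cis (-pi/4)"
  have "Im c \<noteq> 0" using c True by (auto simp: cmod_def)
  then have d: "cmod d = 1" "Re d \<noteq> 0"
    using c True by (auto simp: d_def norm_mult cos_45 sin_45)
  have e: "cmod e = 1" "Re e \<noteq> 0"
    by (auto simp: e_def cos_45 sin_45)
  have de: "d * e = c"
    by (simp add: d_def e_def mult.assoc cis_mult)
  have "c * z = d * (e * z)" for z
    by (simp only: de mult.assoc[symmetric])
  then have "(\<integral>\<^sup>+z. F (c * z) \<partial>lborel) = (\<integral>\<^sup>+z. F (d * (e * z)) \<partial>lborel)"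
    by (intro nn_integral_cong arg_cong[where f=F]) auto
  then show ?thesis
    using nn_integral_rotate_aux[OF _ d, of F] nn_integral_rotate_aux[OF _ e, of "\<lambda>z. F (d * z)"] by simp
qed

lemma lborel_distr_rotate:
  assumes "cmod c = 1"
  shows "distr lborel borel (\<lambda>z. c * z) = (lborel :: complex measure)"
proof (rule measure_eqI)
  fix A :: "complex set" assume "A \<in> sets (distr lborel borel (\<lambda>z. c * z))"
  then have [measurable]: "A \<in> sets borel" by simp
  have "emeasure (distr lborel borel (\<lambda>z. c * z)) A = (\<integral>\<^sup>+z. indicator A z \<partial>distr lborel borel (\<lambda>z. c * z))"
    by simp
  also have "\<dots> = (\<integral>\<^sup>+z. indicator A (c * z) \<partial>lborel)"
    by (subst nn_integral_distr) auto
  also have "\<dots> = emeasure lborel A"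
    using nn_integral_rotate[OF _ assms, of "indicator A"] by simp
  finally show "emeasure (distr lborel borel (\<lambda>z. c * z)) A = emeasure lborel A" .
qed simp

lemma lborel_distr_reflect:
  "distr lborel borel (\<lambda>w. z - w) = (lborel :: complex measure)"
proof -
  have "distr lborel borel (\<lambda>w. z - w) = distr (distr lborel borel (\<lambda>w. (-1) * w)) borel ((+) z)"
    by (subst distr_distr) (auto simp: o_def)
  then show ?thesis
    by (simp only: lborel_distr_rotate[of "-1"] lborel_distr_plus norm_minus_cancel norm_one)
qed

section \<open>Gaussian integrals and moments\<close>

lemma nn_integral_gauss_real:
  assumes "c > 0"
  shows "(\<integral>\<^sup>+x. ennreal (exp (- (c * x\<^sup>2))) \<partial>lborel) = ennreal (sqrt (pi / c))"
proof -
  have "ennreal (exp (- (c * x\<^sup>2))) = ennreal (sqrt (pi / c)) * ennreal (normal_density 0 (sqrt (1 / (2 * c))) x)" for x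
    using assms by (subst ennreal_mult[symmetric]) (auto simp: normal_density_def real_sqrt_mult real_sqrt_divide field_simps)
  then have "(\<integral>\<^sup>+x. ennreal (exp (- (c * x\<^sup>2))) \<partial>lborel)
     = ennreal (sqrt (pi / c)) * (\<integral>\<^sup>+x. ennreal (normal_density 0 (sqrt (1 / (2 * c))) x) \<partial>lborel)"
    by (simp add: nn_integral_cmult)
  also have "(\<integral>\<^sup>+x. ennreal (normal_density 0 (sqrt (1 / (2 * c))) x) \<partial>lborel) = 1"
    using assms by (subst nn_integral_eq_integral) auto
  finally show ?thesis by simp
qed

lemma nn_integral_gauss:
  assumes "c > 0"
  shows "(\<integral>\<^sup>+z. ennreal (exp (- (c * (cmod z)\<^sup>2))) \<partial>lborel) = ennreal (pi / c)"
proof -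
  have "ennreal (exp (- (c * (cmod (Complex x y))\<^sup>2))) = ennreal (exp (- (c * y\<^sup>2))) * ennreal (exp (- (c * x\<^sup>2)))" for x y
    by (subst ennreal_mult[symmetric]) (auto simp: cmod_power2 algebra_simps simp flip: exp_add)
  then have "(\<integral>\<^sup>+z. ennreal (exp (- (c * (cmod z)\<^sup>2))) \<partial>lborel) =
     (\<integral>\<^sup>+y. ennreal (exp (- (c * y\<^sup>2))) * ennreal (sqrt (pi / c)) \<partial>lborel)"
    using assms by (subst nn_integral_complex) (simp_all add: nn_integral_cmult nn_integral_gauss_real del: mult_minus_left)
  also have "\<dots> = ennreal (sqrt (pi / c)) * ennreal (sqrt (pi / c))"
    using assms by (simp add: nn_integral_multc nn_integral_gauss_real del: mult_minus_left)
  also have "\<dots> = ennreal (pi / c)"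
    using assms by (subst ennreal_mult[symmetric]) auto
  finally show ?thesis .
qed

lemma has_bochner_integral_gauss:
  assumes "c > 0"
  shows "has_bochner_integral lborel (\<lambda>z::complex. exp (- (c * (cmod z)\<^sup>2))) (pi / c)"
  using assms nn_integral_gauss[OF assms]
  by (intro has_bochner_integral_nn_integral) auto

lemma power_div_fact_le_exp:
  fixes y :: real
  assumes "y \<ge> 0"
  shows "y ^ k / fact k \<le> exp y"
proof -
  have "(\<Sum>n\<in>{k}. y ^ n /\<^sub>R fact n) \<le> (\<Sum>n. y ^ n /\<^sub>R fact n)"
    using assms by (intro sum_le_suminf summable_exp_generic) auto
  then show ?thesis
    by (simp add: exp_def divide_inverse mult.commute)
qed

text \<open>Half of the exponent pays for the power: \<open>(c/2 * x) ^ k / fact k\<close> is at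
  most \<open>exp (c/2 * x)\<close>, and \<open>x \<le> 1 + x\<^sup>2\<close> turns this into
  \<open>exp (c/2) * exp (c/2 * x\<^sup>2)\<close>. The other half of the Gaussian remains as an
  integrable majorant.\<close>

lemma integrable_gauss_moment:
  assumes "c > 0"
  shows "integrable lborel (\<lambda>z::complex. cmod z ^ k * exp (- (c * (cmod z)\<^sup>2)))"
proof -
  have b: "cmod z ^ k * exp (- (c * (cmod z)\<^sup>2)) \<le> fact k / (c/2)^k * exp (c/2) * exp (- (c/2 * (cmod z)\<^sup>2))" for z
  proof -
    let ?x = "cmod z"
    have "(c/2 * ?x) ^ k / fact k \<le> exp (c/2 * ?x)"
      using assms by (intro power_div_fact_le_exp) auto
    also have "c/2 * ?x \<le> c/2 * (1 + ?x\<^sup>2)"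
    proof (intro mult_left_mono)
      have "0 \<le> (?x - 1)\<^sup>2" by simp
      then have "2 * ?x \<le> 1 + ?x\<^sup>2" by (simp add: power2_eq_square algebra_simps)
      then show "?x \<le> 1 + ?x\<^sup>2" using norm_ge_zero[of z] by linarith
    qed (use assms in auto)
    finally have "(c/2 * ?x) ^ k / fact k \<le> exp (c/2) * exp (c/2 * ?x\<^sup>2)"
      by (simp add: algebra_simps flip: exp_add)
    then have "?x ^ k \<le> fact k / (c/2)^k * exp (c/2) * exp (c/2 * ?x\<^sup>2)"
      using assms by (simp add: field_simps power_mult_distrib)
    then have "?x ^ k * exp (- (c * ?x\<^sup>2)) \<le> fact k / (c/2)^k * exp (c/2) * exp (c/2 * ?x\<^sup>2) * exp (- (c * ?x\<^sup>2))"
      by (intro mult_right_mono) auto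
    also have "\<dots> = fact k / (c/2)^k * exp (c/2) * exp (- (c/2 * ?x\<^sup>2))"
      by (simp add: mult.assoc flip: exp_add)
    finally show ?thesis .
  qed
  have "integrable lborel (\<lambda>z::complex. fact k / (c/2)^k * exp (c/2) * exp (- (c/2 * (cmod z)\<^sup>2)))"
    using has_bochner_integral_gauss[of "c/2"] assms
    by (intro integrable_mult_right) (auto simp: has_bochner_integral_iff)
  then show ?thesis
  proof (rule Bochner_Integration.integrable_bound)
    show "AE z in lborel. norm (cmod z ^ k * exp (- (c * (cmod z)\<^sup>2)))
       \<le> norm (fact k / (c/2)^k * exp (c/2) * exp (- (c/2 * (cmod z)\<^sup>2)))"
    proof (rule AE_I2)
      fix z :: complex
      have "norm (cmod z ^ k * exp (- (c * (cmod z)\<^sup>2))) = cmod z ^ k * exp (- (c * (cmod z)\<^sup>2))" by simp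
      also note b[of z]
      also have "fact k / (c/2)^k * exp (c/2) * exp (- (c/2 * (cmod z)\<^sup>2)) \<le> norm (fact k / (c/2)^k * exp (c/2) * exp (- (c/2 * (cmod z)\<^sup>2)))"
        unfolding real_norm_def by (rule abs_ge_self)
      finally show "norm (cmod z ^ k * exp (- (c * (cmod z)\<^sup>2)))
       \<le> norm (fact k / (c/2)^k * exp (c/2) * exp (- (c/2 * (cmod z)\<^sup>2)))" .
    qed
  qed simp
qed

text \<open>Cauchy-Schwarz for the measure with density \<open>k\<close>, applied to
  \<open>1\<close> and \<open>u\<close>. It is the core of the Schur test in
  \<open>kop_nn_bound\<close> and of the norm bound in \<open>Wint_L2\<close>.\<close>

lemma nn_integral_weighted_square:
  assumes [measurable]: "k \<in> borel_measurable M" "u \<in> borel_measurable M"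
  shows "(\<integral>\<^sup>+x. k x * u x \<partial>M)\<^sup>2 \<le> (\<integral>\<^sup>+x. k x \<partial>M) * (\<integral>\<^sup>+x. k x * (u x)\<^sup>2 \<partial>M)"
proof -
  let ?D = "density M k"
  have "(\<integral>\<^sup>+x. 1 * u x \<partial>?D)\<^sup>2 \<le> (\<integral>\<^sup>+x. 1 ^ 2 \<partial>?D) * (\<integral>\<^sup>+x. (u x)\<^sup>2 \<partial>?D)"
    by (rule Cauchy_Schwarz_nn_integral) auto
  then show ?thesis
    by (simp add: nn_integral_density del: nn_integral_const)
qed


text \<open>A Dynkin argument, followed by approximation with simple functions. The property
  \<open>P\<close> will only be known on half-lines or rectangles and is stable under linear
  combinations and L1 limits; finiteness of \<open>M\<close> makes countable disjoint unions
  converge in L1.\<close>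

lemma integrable_induct_pi_system:
  fixes f :: "'a \<Rightarrow> complex"
  assumes "finite_measure M" "space M = UNIV"
    and gen: "sets M = sigma_sets UNIV E" "Int_stable E" "UNIV \<in> E"
    and f: "integrable M f"
    and ind: "\<And>A. A \<in> E \<Longrightarrow> P (indicator A)"
    and add: "\<And>f g. integrable M f \<Longrightarrow> integrable M g \<Longrightarrow> P f \<Longrightarrow> P g \<Longrightarrow> P (\<lambda>x. f x + g x)"
    and scale: "\<And>f c. integrable M f \<Longrightarrow> P f \<Longrightarrow> P (\<lambda>x. c * f x)"
    and lim: "\<And>s f. (\<And>n. integrable M (s n)) \<Longrightarrow> integrable M f \<Longrightarrow> (\<And>n. P (s n)) \<Longrightarrow>
       (\<lambda>n::nat. \<integral>x. cmod (s n x - f x) \<partial>M) \<longlonglongrightarrow> 0 \<Longrightarrow> P f"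
  shows "P f"
proof -
  interpret finite_measure M by fact
  have int_ind: "integrable M (indicator A :: 'a \<Rightarrow> complex)" if "A \<in> sets M" for A
    using that by (intro Bochner_Integration.integrable_bound[OF integrable_const[of "1::real"]]) (auto simp: indicator_def)
  have set: "P (indicator A)" if "A \<in> sets M" for A
  proof -
    have "E \<subseteq> Pow UNIV" by simp
    have "A \<in> sigma_sets UNIV E" using that gen by simp
    from \<open>Int_stable E\<close> \<open>E \<subseteq> Pow UNIV\<close> this show ?thesis
    proof (induction rule: sigma_sets_induct_disjoint)
      case (basic A) then show ?case by (rule ind)
    next
      case empty
      \<comment> \<open>No closure rule provides the zero function; it arises as a multiple of the
        indicator of \<open>UNIV\<close>, which is one reason to ask for
        \<open>UNIV \<in> E\<close>. The other is the passage to complements.\<close>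
      have "P (\<lambda>x. 0 * indicator UNIV x)"
        by (intro scale ind int_ind gen(3) sets.top[of M, unfolded assms(2)])
      then show ?case by simp
    next
      case (compl A)
      then have A: "A \<in> sets M" using gen by simp
      have "P (\<lambda>x. indicator UNIV x + (-1) * indicator A x)"
        by (intro add scale ind int_ind integrable_mult_right sets.top[of M, unfolded assms(2)] A compl(2) gen(3))
      moreover have "(\<lambda>x. indicator UNIV x + (-1) * indicator A x) = (indicator (UNIV - A) :: 'a \<Rightarrow> complex)"
        by (auto simp: indicator_def)
      ultimately show ?case by simp
    next
      case (union A)
      then have A: "range A \<subseteq> sets M" using gen by simp
      define s where "s = (\<lambda>n. indicator (\<Union>i<n. A i) :: 'a \<Rightarrow> complex)"
      have sm[measurable]: "(\<Union>i<n. A i) \<in> sets M" for n using A by auto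
      have Um[measurable]: "(\<Union>i. A i) \<in> sets M" using A by auto
      have P: "P (s n)" for n
      proof (induction n)
        case 0
        have "P (\<lambda>x. 0 * indicator UNIV x)"
          by (intro scale ind int_ind gen(3) sets.top[of M, unfolded assms(2)])
        then show ?case by (simp add: s_def)
      next
        case (Suc n)
        have "s (Suc n) = (\<lambda>x. s n x + indicator (A n) x)"
        proof
          fix x
          have "x \<in> A n \<Longrightarrow> \<not> (\<exists>i<n. x \<in> A i)"
            using union(1) unfolding disjoint_family_on_def by (metis UNIV_I disjoint_iff less_irrefl)
          then show "s (Suc n) x = s n x + indicator (A n) x"
            by (auto simp: s_def indicator_def less_Suc_eq)
        qed
        then show ?case using Suc A union(3)[of n] sm by (auto simp: s_def intro!: add int_ind)
      qed
      show ?case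
      proof (rule lim[of s])
        show "(\<lambda>n. \<integral>x. cmod (s n x - indicator (\<Union>i. A i) x) \<partial>M) \<longlonglongrightarrow> 0"
        proof -
          have "(\<lambda>n. \<integral>x. cmod (s n x - indicator (\<Union>i. A i) x) \<partial>M) \<longlonglongrightarrow> (\<integral>x. 0 \<partial>M)"
          proof (rule integral_dominated_convergence[where w="\<lambda>_. 1"])
            show "AE x in M. (\<lambda>n. cmod (s n x - indicator (\<Union>i. A i) x)) \<longlonglongrightarrow> 0"
            proof (rule AE_I2)
              fix x
              have "eventually (\<lambda>n. cmod (s n x - indicator (\<Union>i. A i) x) = 0) sequentially"
              proof (cases "x \<in> (\<Union>i. A i)")
                case True
                then obtain i where "x \<in> A i" by auto
                then show ?thesis
                  by (intro eventually_sequentiallyI[of "Suc i"]) (auto simp: s_def indicator_def)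
              next
                case False then show ?thesis by (auto simp: s_def indicator_def)
              qed
              then show "(\<lambda>n. cmod (s n x - indicator (\<Union>i. A i) x)) \<longlonglongrightarrow> 0"
                by (rule tendsto_eventually)
            qed
            show "(\<lambda>x. cmod (s n x - indicator (\<Union>i. A i) x)) \<in> borel_measurable M" for n
              unfolding s_def by measurable
            show "AE x in M. norm (cmod (s n x - indicator (\<Union>i. A i) x)) \<le> 1" for n
              by (auto simp: s_def indicator_def)
          qed auto
          then show ?thesis by simp
        qed
      qed (use P in \<open>auto simp: s_def intro!: int_ind\<close>)
    qed
  qed
  show ?thesis
    using f
  proof (induction rule: integrable_induct)
    case (base A c)
    have "P (\<lambda>x. c * indicator A x)"
      using base by (intro scale set int_ind) auto
    moreover have "(\<lambda>x. c * indicator A x) = (\<lambda>x. indicator A x *\<^sub>R c)"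
      by (auto simp: indicator_def)
    ultimately show ?case by simp
  next
    case (add f g)
    then show ?case by (intro assms(8)) auto
  next
    case (lim f s)
    have conv: "(\<lambda>i. s i x) \<longlonglongrightarrow> f x" "cmod (s i x) \<le> 2 * cmod (f x)" if "x \<in> space M" for x i
      using lim that by blast+
    have [measurable]: "s n \<in> borel_measurable M" "f \<in> borel_measurable M" for n
      using lim by auto
    show ?case
    proof (rule assms(10)[of s])
      have "(\<lambda>n. \<integral>x. cmod (s n x - f x) \<partial>M) \<longlonglongrightarrow> (\<integral>x. 0 \<partial>M)"
      \<comment> \<open>The approximants delivered by \<open>integrable_induct\<close> satisfy
        \<open>cmod (s i x) \<le> 2 * cmod (f x)\<close>, so three times \<open>cmod (f x)\<close>
        is a majorant.\<close>
      proof (rule integral_dominated_convergence[where w="\<lambda>x. 3 * cmod (f x)"])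
        show "AE x in M. (\<lambda>n. cmod (s n x - f x)) \<longlonglongrightarrow> 0"
        proof (rule AE_I2)
          fix x assume "x \<in> space M"
          then show "(\<lambda>n. cmod (s n x - f x)) \<longlonglongrightarrow> 0"
            by (intro tendsto_norm_zero LIM_zero conv(1))
        qed
        show "AE x in M. norm (cmod (s n x - f x)) \<le> 3 * cmod (f x)" for n
        proof (rule AE_I2)
          fix x assume "x \<in> space M"
          then have "cmod (s n x) \<le> 2 * cmod (f x)" using conv(2) by auto
          then show "norm (cmod (s n x - f x)) \<le> 3 * cmod (f x)"
            using norm_triangle_ineq4[of "s n x" "f x"] by simp
        qed
        show "(\<lambda>x. cmod (s n x - f x)) \<in> borel_measurable M" for n
          by measurable
      qed (use lim in auto)
      then show "(\<lambda>n. \<integral>x. cmod (s n x - f x) \<partial>M) \<longlonglongrightarrow> 0" by simp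
    qed (use lim in auto)
  qed
qed

text \<open>Once the increment has modulus at most one, the difference quotient of the exponential
  at \<open>0\<close> is bounded by \<open>exp (2 * cmod (a w))\<close>, and \<open>int\<close>,
  assumed for every \<open>r\<close>, absorbs the additional \<open>2\<close> in the exponent.
  Working along sequences, with an initial segment dropped, makes dominated convergence
  applicable.\<close>

lemma has_field_derivative_exp_integral:
  fixes f a :: "'a \<Rightarrow> complex"
  assumes [measurable]: "f \<in> borel_measurable M" "a \<in> borel_measurable M"
    and int: "\<And>r. integrable M (\<lambda>w. cmod (f w) * exp (r * cmod (a w)))"
  shows "((\<lambda>z. \<integral>w. f w * exp (z * a w) \<partial>M) has_field_derivative (\<integral>w. f w * (a w * exp (z * a w)) \<partial>M)) (at z)"
proof -
  have int1: "integrable M (\<lambda>w. f w * exp (z * a w))" for z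
  proof (rule Bochner_Integration.integrable_bound[OF int[of "cmod z"]])
    show "AE w in M. norm (f w * exp (z * a w)) \<le> norm (cmod (f w) * exp (cmod z * cmod (a w)))"
      using complex_Re_le_cmod[of "z * a _"]
      by (intro AE_I2) (simp add: norm_mult mult_left_mono)
  qed auto
  have "((\<lambda>k. ((\<integral>w. f w * exp ((z + k) * a w) \<partial>M) - (\<integral>w. f w * exp (z * a w) \<partial>M)) / k) \<longlongrightarrow>
      (\<integral>w. f w * (a w * exp (z * a w)) \<partial>M)) (at 0)"
    unfolding tendsto_at_iff_sequentially
  proof (intro allI impI)
    fix X :: "nat \<Rightarrow> complex"
    assume X: "\<forall>i. X i \<in> UNIV - {0}" "X \<longlonglongrightarrow> 0"
    obtain N where N: "\<And>n. n \<ge> N \<Longrightarrow> cmod (X n) \<le> 1"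
      using X(2) unfolding LIMSEQ_iff by (metis diff_zero less_eq_real_def zero_less_one)
    have eq: "((\<integral>w. f w * exp ((z + X n) * a w) \<partial>M) - (\<integral>w. f w * exp (z * a w) \<partial>M)) / X n
       = (\<integral>w. f w * (exp (z * a w) * ((exp (X n * a w) - 1) / X n)) \<partial>M)" for n
    proof -
      have "(\<integral>w. f w * exp ((z + X n) * a w) \<partial>M) - (\<integral>w. f w * exp (z * a w) \<partial>M)
        = (\<integral>w. f w * exp ((z + X n) * a w) - f w * exp (z * a w) \<partial>M)"
        using int1 by (intro Bochner_Integration.integral_diff[symmetric])
      also have "\<dots> / X n = (\<integral>w. (f w * exp ((z + X n) * a w) - f w * exp (z * a w)) / X n \<partial>M)"
        by (rule integral_divide_zero[symmetric])
      also have "\<dots> = (\<integral>w. f w * (exp (z * a w) * ((exp (X n * a w) - 1) / X n)) \<partial>M)"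
        by (simp add: distrib_right exp_add right_diff_distrib diff_divide_distrib)
      finally show ?thesis .
    qed
    have "(\<lambda>n. \<integral>w. f w * (exp (z * a w) * ((exp (X (n + N) * a w) - 1) / X (n + N))) \<partial>M) \<longlonglongrightarrow> (\<integral>w. f w * (a w * exp (z * a w)) \<partial>M)"
    proof (rule integral_dominated_convergence[where w="\<lambda>w. cmod (f w) * exp ((cmod z + 2) * cmod (a w))"])
      show "AE w in M. (\<lambda>n. f w * (exp (z * a w) * ((exp (X (n + N) * a w) - 1) / X (n + N)))) \<longlonglongrightarrow> f w * (a w * exp (z * a w))"
      proof (rule AE_I2)
        fix w
        have "((\<lambda>k. exp (k * a w)) has_field_derivative (a w)) (at 0)"
          by (auto intro!: derivative_eq_intros)
        then have "((\<lambda>k. (exp (k * a w) - 1) / k) \<longlongrightarrow> a w) (at 0)"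
          by (simp add: DERIV_def)
        then have "(\<lambda>n. (exp (X n * a w) - 1) / X n) \<longlonglongrightarrow> a w"
          using X unfolding tendsto_at_iff_sequentially by (auto simp: o_def)
        then have "(\<lambda>n. (exp (X (n + N) * a w) - 1) / X (n + N)) \<longlonglongrightarrow> a w"
          by (rule LIMSEQ_ignore_initial_segment)
        then have "(\<lambda>n. f w * (exp (z * a w) * ((exp (X (n + N) * a w) - 1) / X (n + N)))) \<longlonglongrightarrow> f w * (exp (z * a w) * a w)"
          by (intro tendsto_intros)
        then show "(\<lambda>n. f w * (exp (z * a w) * ((exp (X (n + N) * a w) - 1) / X (n + N)))) \<longlonglongrightarrow> f w * (a w * exp (z * a w))"
          by (simp add: mult.commute)
      qed
      show "AE w in M. norm (f w * (exp (z * a w) * ((exp (X (n + N) * a w) - 1) / X (n + N)))) \<le> cmod (f w) * exp ((cmod z + 2) * cmod (a w))" for n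
      proof (rule AE_I2)
        fix w
        let ?k = "X (n + N)" and ?a = "cmod (a w)"
        have k: "?k \<noteq> 0" "cmod ?k \<le> 1" using X N[of "n + N"] by auto
        have "cmod (exp (?k * a w) - 1) \<le> exp \<bar>Re (?k * a w)\<bar> * cmod (?k * a w)"
          using Taylor_exp[of "?k * a w" 0] by simp
        also have "\<dots> \<le> exp ?a * (cmod ?k * ?a)"
          using abs_Re_le_cmod[of "?k * a w"] mult_right_mono[OF k(2), of ?a]
          by (intro mult_mono) (auto simp: norm_mult)
        also have "\<dots> \<le> exp ?a * (cmod ?k * exp ?a)"
          using order.trans[OF _ exp_ge_add_one_self[of ?a]] by (intro mult_left_mono) auto
        also have "\<dots> = cmod ?k * exp (2 * ?a)"
          by (simp add: exp_double power2_eq_square)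
        finally have 1: "cmod ((exp (?k * a w) - 1) / ?k) \<le> exp (2 * ?a)"
          using k by (simp add: norm_divide divide_le_eq mult.commute)
        have 2: "cmod (exp (z * a w)) \<le> exp (cmod z * ?a)"
          using complex_Re_le_cmod[of "z * a w"] by (simp add: norm_mult)
        have "cmod (exp (z * a w)) * cmod ((exp (?k * a w) - 1) / ?k) \<le> exp (cmod z * ?a) * exp (2 * ?a)"
          using 1 2 by (intro mult_mono) auto
        then show "norm (f w * (exp (z * a w) * ((exp (X (n + N) * a w) - 1) / X (n + N)))) \<le> cmod (f w) * exp ((cmod z + 2) * cmod (a w))"
          unfolding norm_mult distrib_right exp_add by (rule mult_left_mono) simp
      qed
      show "integrable M (\<lambda>w. cmod (f w) * exp ((cmod z + 2) * cmod (a w)))" by (rule int)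
    qed auto
    then have "(\<lambda>n. ((\<integral>w. f w * exp ((z + X n) * a w) \<partial>M) - (\<integral>w. f w * exp (z * a w) \<partial>M)) / X n) \<longlonglongrightarrow>
      (\<integral>w. f w * (a w * exp (z * a w)) \<partial>M)"
      unfolding eq[symmetric] by (rule LIMSEQ_offset)
    then show "((\<lambda>k. ((\<integral>w. f w * exp ((z + k) * a w) \<partial>M) - (\<integral>w. f w * exp (z * a w) \<partial>M)) / k) \<circ> X) \<longlonglongrightarrow>
      (\<integral>w. f w * (a w * exp (z * a w)) \<partial>M)" by (simp add: o_def)
  qed
  then show ?thesis unfolding DERIV_def .
qed

text \<open>Cauchy's formula at the centre of the unit circle: under the parametrization of
  \<open>circlepath\<close> by \<open>{0..1}\<close>, the form \<open>du / u\<close> becomes the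
  constant \<open>2 * pi * \<i>\<close> times \<open>dx\<close>.\<close>

lemma circle_mean_value:
  assumes "f holomorphic_on UNIV"
  shows "(\<integral>x\<in>{0..1}. f (exp (2 * of_real pi * \<i> * of_real x)) \<partial>lborel) = f 0"
proof -
  let ?g = "\<lambda>x. f (exp (2 * of_real pi * \<i> * of_real x))"
  have "((\<lambda>u. f u / (u - 0)) has_contour_integral 2 * of_real pi * \<i> * f 0) (circlepath 0 1)"
    by (rule Cauchy_integral_circlepath_simple) (use assms holomorphic_on_subset in auto)
  then have "((\<lambda>x. (2 * of_real pi * \<i>) * ?g x) has_integral (2 * of_real pi * \<i>) * f 0) {0..1}"
    unfolding has_contour_integral_def
    by (rule has_integral_eq[rotated]) (simp add: vector_derivative_circlepath01, simp add: circlepath)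
  then have "((\<lambda>x. 1 / (2 * of_real pi * \<i>) * ((2 * of_real pi * \<i>) * ?g x)) has_integral
      1 / (2 * of_real pi * \<i>) * ((2 * of_real pi * \<i>) * f 0)) {0..1}"
    by (rule has_integral_mult_right)
  then have I: "(?g has_integral f 0) {0..1}"
    by (simp add: field_simps)
  have cont: "continuous_on {0..1} ?g"
    by (rule continuous_on_compose2[OF holomorphic_on_imp_continuous_on[OF assms]])
      (auto intro!: continuous_intros)
  have "set_integrable lborel {0..1} ?g"
    by (rule borel_integrable_atLeastAtMost'[OF cont])
  from set_borel_integral_eq_integral(2)[OF this] show ?thesis
    unfolding integral_unique[OF I] .
qed

text \<open>Invariance allows averaging over all rotations without changing the integral; after
  Fubini the inner average runs over a circle and is the value at its centre.\<close>

lemma integral_rotation_invariant_holomorphic: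
  fixes f :: "complex \<Rightarrow> complex"
  assumes "finite_measure M" and sets: "sets M = sets borel"
    and inv: "\<And>c. cmod c = 1 \<Longrightarrow> distr M borel (\<lambda>z. c * z) = M"
    and f: "integrable M f" "f holomorphic_on UNIV"
  shows "(\<integral>z. f z \<partial>M) = measure M UNIV *\<^sub>R f 0"
proof -
  interpret finite_measure M by fact
  let ?L = "restrict_space lborel {0..1::real}"
  interpret L: finite_measure ?L
    by standard (simp add: emeasure_restrict_space)
  interpret pair_sigma_finite M ?L ..
  define e where "e = (\<lambda>x::real. exp (2 * of_real pi * \<i> * of_real x))"
  have e1: "cmod (e x) = 1" for x by (simp add: e_def)
  have sp: "space M = UNIV" using sets_eq_imp_space_eq[OF sets] by simp
  note [measurable_cong] = sets
  have fm[measurable]: "f \<in> borel_measurable borel"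
    using f(1) sets by (metis borel_measurable_integrable measurable_cong_sets)
  have em[measurable]: "e \<in> borel_measurable borel"
    unfolding e_def by measurable
  have em'[measurable]: "e \<in> borel_measurable ?L"
    by (rule measurable_restrict_space1) simp
  have id: "(\<integral>z. f z \<partial>M) = (\<integral>z. f (e x * z) \<partial>M)" for x
    by (subst inv[OF e1[of x], symmetric], subst integral_distr) auto
  have int: "integrable M (\<lambda>z. f (e x * z))" for x
  proof -
    have "integrable (distr M borel (\<lambda>z. e x * z)) f" using f(1) inv[OF e1] by simp
    then show ?thesis by (subst (asm) integrable_distr_eq) auto
  qed
  have nn: "(\<integral>\<^sup>+z. norm (f (e x * z)) \<partial>M) = (\<integral>\<^sup>+z. norm (f z) \<partial>M)" for x
    by (subst (2) inv[OF e1[of x], symmetric], subst nn_integral_distr) auto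
  have pi: "integrable (M \<Otimes>\<^sub>M ?L) (\<lambda>(z, x). f (e x * z))"
  proof (rule integrableI_bounded)
    show "(\<lambda>(z, x). f (e x * z)) \<in> borel_measurable (M \<Otimes>\<^sub>M ?L)" by measurable
    have "(\<integral>\<^sup>+p. norm (case p of (z, x) \<Rightarrow> f (e x * z)) \<partial>(M \<Otimes>\<^sub>M ?L))
       = (\<integral>\<^sup>+x. \<integral>\<^sup>+z. norm (f (e x * z)) \<partial>M \<partial>?L)"
      by (subst nn_integral_snd[symmetric]) auto
    also have "\<dots> = (\<integral>\<^sup>+z. norm (f z) \<partial>M) * emeasure ?L (space ?L)"
      by (simp add: nn)
    also have "\<dots> < \<infinity>"
    proof -
      have "emeasure ?L (space ?L) = 1" by (simp add: emeasure_restrict_space)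
      then show ?thesis using f(1) by (simp add: integrable_iff_bounded)
    qed
    finally show "(\<integral>\<^sup>+p. norm (case p of (z, x) \<Rightarrow> f (e x * z)) \<partial>(M \<Otimes>\<^sub>M ?L)) < \<infinity>" .
  qed
  have "(\<integral>z. f z \<partial>M) = (\<integral>x. (\<integral>z. f (e x * z) \<partial>M) \<partial>?L)"
  proof -
    have "measure ?L (space ?L) = 1" by (simp add: measure_restrict_space)
    then show ?thesis by (simp add: id[symmetric])
  qed
  also have "\<dots> = (\<integral>z. (\<integral>x. f (e x * z) \<partial>?L) \<partial>M)"
    using pi by (rule Fubini_integral)
  also have "\<dots> = (\<integral>z. f 0 \<partial>M)"
  proof (rule Bochner_Integration.integral_cong[OF refl])
    fix z
    have "(\<lambda>u. f (u * z)) holomorphic_on UNIV"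
      using holomorphic_on_compose_gen[of "\<lambda>u. u * z" UNIV f UNIV] f(2)
      by (simp add: o_def holomorphic_on_mult holomorphic_on_ident holomorphic_on_const)
    from circle_mean_value[OF this] show "(\<integral>x. f (e x * z) \<partial>?L) = f 0"
      by (simp add: e_def integral_restrict_space set_lebesgue_integral_def)
  qed
  also have "\<dots> = measure M UNIV *\<^sub>R f 0" by (simp add: sp)
  finally show ?thesis .
qed

section \<open>The Gaussian measure and its square-integrable functions\<close>

locale bargmann =
  fixes t :: real
  assumes t_pos: "t > 0"
begin

abbreviation \<mu> :: "complex measure" where "\<mu> \<equiv> gauss_measure t"

definition gw :: "complex \<Rightarrow> real" where "gw z = exp (- (cmod z)\<^sup>2 / t) / (pi * t)"

lemma gw_pos [simp]: "gw z > 0" "gw z \<ge> 0"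
  using t_pos by (auto simp: gw_def)

lemma gw_measurable [measurable]: "gw \<in> borel_measurable borel"
  unfolding gw_def by measurable

lemma gauss_measure_eq: "\<mu> = density lborel (\<lambda>z. ennreal (gw z))"
  by (simp add: gauss_measure_def gw_def)

lemma space_gauss [simp]: "space \<mu> = UNIV"
  by (simp add: gauss_measure_def)

lemma sets_gauss [simp, measurable_cong]: "sets \<mu> = sets borel"
  by (simp add: gauss_measure_def)

lemma measurable_gauss [simp]: "measurable \<mu> M = measurable borel M"
  by (rule measurable_cong_sets) auto

lemma nn_integral_gauss_measure:
  assumes [measurable]: "F \<in> borel_measurable borel"
  shows "(\<integral>\<^sup>+z. F z \<partial>\<mu>) = (\<integral>\<^sup>+z. ennreal (gw z) * F z \<partial>lborel)"
  unfolding gauss_measure_eq by (rule nn_integral_density) auto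

lemma integrable_gauss_iff:
  fixes F :: "complex \<Rightarrow> 'b::{banach, second_countable_topology}"
  assumes [measurable]: "F \<in> borel_measurable borel"
  shows "integrable \<mu> F \<longleftrightarrow> integrable lborel (\<lambda>z. gw z *\<^sub>R F z)"
  unfolding gauss_measure_eq by (rule integrable_density) auto

lemma integral_gauss_measure:
  fixes F :: "complex \<Rightarrow> 'b::{banach, second_countable_topology}"
  assumes [measurable]: "F \<in> borel_measurable borel"
  shows "(\<integral>z. F z \<partial>\<mu>) = (\<integral>z. gw z *\<^sub>R F z \<partial>lborel)"
  unfolding gauss_measure_eq by (rule integral_density) auto

lemma emeasure_gauss_UNIV: "emeasure \<mu> UNIV = 1"
proof -
  have "emeasure \<mu> UNIV = (\<integral>\<^sup>+z. 1 \<partial>\<mu>)" by simp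
  also have "\<dots> = (\<integral>\<^sup>+z. ennreal (1 / (pi * t)) * ennreal (exp (- (1/t * (cmod z)\<^sup>2))) \<partial>lborel)"
    using t_pos by (subst nn_integral_gauss_measure) (auto simp: gw_def ennreal_mult[symmetric] intro!: nn_integral_cong)
  also have "\<dots> = ennreal (1 / (pi * t)) * ennreal (pi / (1/t))"
    using t_pos nn_integral_gauss[of "1/t"] by (subst nn_integral_cmult) auto
  also have "\<dots> = 1"
    using t_pos by (subst ennreal_mult[symmetric]) auto
  finally show ?thesis .
qed

sublocale prob_space \<mu>
  by standard (simp add: emeasure_gauss_UNIV)

lemma gauss_rotation:
  assumes "cmod c = 1"
  shows "distr \<mu> borel (\<lambda>z. c * z) = \<mu>"
proof (rule measure_eqI)
  fix A assume "A \<in> sets (distr \<mu> borel (\<lambda>z. c * z))"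
  then have [measurable]: "A \<in> sets borel" by simp
  have "emeasure (distr \<mu> borel (\<lambda>z. c * z)) A = (\<integral>\<^sup>+z. indicator A z \<partial>distr \<mu> borel (\<lambda>z. c * z))"
    by simp
  also have "\<dots> = (\<integral>\<^sup>+z. ennreal (gw (c * z)) * indicator A (c * z) \<partial>lborel)"
    using assms by (subst nn_integral_distr) (auto simp: nn_integral_gauss_measure gw_def norm_mult)
  also have "\<dots> = (\<integral>\<^sup>+z. ennreal (gw z) * indicator A z \<partial>lborel)"
    using nn_integral_rotate[OF _ assms, of "\<lambda>z. ennreal (gw z) * indicator A z"] by simp
  also have "\<dots> = (\<integral>\<^sup>+z. indicator A z \<partial>\<mu>)"
    by (rule nn_integral_gauss_measure[symmetric]) simp
  finally show "emeasure (distr \<mu> borel (\<lambda>z. c * z)) A = emeasure \<mu> A" by simp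
qed simp

text \<open>The normalized coherent state at \<open>v\<close>: the reproducing kernel at
  \<open>v\<close> divided by its norm. Its squared modulus is the density that translates the
  Gaussian measure by \<open>v\<close> (\<open>gauss_shift\<close>).\<close>

definition E :: "complex \<Rightarrow> complex \<Rightarrow> complex" where
  "E v w = exp ((w * cnj v - (cmod v)\<^sup>2 / 2) / t)"

lemma E_measurable [measurable (raw)]:
  assumes [measurable]: "f \<in> borel_measurable M" "g \<in> borel_measurable M"
  shows "(\<lambda>x. E (f x) (g x)) \<in> borel_measurable M"
  unfolding E_def by measurable

lemma norm_E_sq: "(cmod (E v w))\<^sup>2 = exp ((2 * Re (w * cnj v) - (cmod v)\<^sup>2) / t)"
proof -
  have "Re ((w * cnj v - (cmod v)\<^sup>2 / 2) / t) = (Re (w * cnj v) - (cmod v)\<^sup>2 / 2) / t"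
    by (simp flip: of_real_power)
  then have "cmod (E v w) = exp ((Re (w * cnj v) - (cmod v)\<^sup>2 / 2) / t)"
    by (simp add: E_def)
  then show ?thesis
    by (simp add: exp_double[symmetric] diff_divide_distrib algebra_simps)
qed

lemma cmod_diff_sq: "(cmod (w - v))\<^sup>2 = (cmod w)\<^sup>2 - 2 * Re (w * cnj v) + (cmod v)\<^sup>2"
  unfolding cmod_power2 by (simp add: power2_eq_square algebra_simps)

lemma gw_shift: "gw w * (cmod (E v w))\<^sup>2 = gw (w - v)"
proof -
  have "gw w * (cmod (E v w))\<^sup>2 = exp (- (cmod w)\<^sup>2 / t + (2 * Re (w * cnj v) - (cmod v)\<^sup>2) / t) / (pi * t)"
    by (simp only: norm_E_sq gw_def exp_add times_divide_eq_left)
  also have "- (cmod w)\<^sup>2 / t + (2 * Re (w * cnj v) - (cmod v)\<^sup>2) / t = - (cmod (w - v))\<^sup>2 / t"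
    unfolding cmod_diff_sq by (simp add: diff_divide_distrib add_divide_distrib)
  finally show ?thesis by (simp add: gw_def)
qed

lemma gauss_shift: "density \<mu> (\<lambda>w. ennreal ((cmod (E v w))\<^sup>2)) = distr \<mu> borel (\<lambda>w. w + v)"
proof (rule measure_eqI)
  fix A assume "A \<in> sets (density \<mu> (\<lambda>w. ennreal ((cmod (E v w))\<^sup>2)))"
  then have [measurable]: "A \<in> sets borel" by simp
  have "emeasure (distr \<mu> borel (\<lambda>w. w + v)) A = (\<integral>\<^sup>+w. indicator A w \<partial>distr \<mu> borel (\<lambda>w. w + v))"
    by simp
  also have "\<dots> = (\<integral>\<^sup>+w. ennreal (gw w) * indicator A (w + v) \<partial>lborel)"
    by (subst nn_integral_distr) (auto simp: nn_integral_gauss_measure)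
  also have "\<dots> = (\<integral>\<^sup>+w. ennreal (gw w) * indicator A (w + v) \<partial>distr lborel borel ((+) (- v)))"
    by (simp add: lborel_distr_plus)
  also have "\<dots> = (\<integral>\<^sup>+w. ennreal (gw (w - v)) * indicator A w \<partial>lborel)"
    by (subst nn_integral_distr) (auto simp: add.commute)
  also have "\<dots> = (\<integral>\<^sup>+w. ennreal (gw w) * (ennreal ((cmod (E v w))\<^sup>2) * indicator A w) \<partial>lborel)"
    by (simp add: gw_shift[symmetric] ennreal_mult mult.assoc)
  also have "\<dots> = emeasure (density \<mu> (\<lambda>w. ennreal ((cmod (E v w))\<^sup>2))) A"
    by (subst emeasure_density) (auto simp: nn_integral_gauss_measure)
  finally show "emeasure (density \<mu> (\<lambda>w. ennreal ((cmod (E v w))\<^sup>2))) A = emeasure (distr \<mu> borel (\<lambda>w. w + v)) A" by simp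
qed simp

lemma integrable_exp_norm: "integrable \<mu> (\<lambda>w. exp (r * cmod w))"
proof -
  have "gw w * exp (r * cmod w) \<le> exp (r\<^sup>2 * t / 2) / (pi * t) * exp (- (1/(2*t) * (cmod w)\<^sup>2))" for w
  proof -
    \<comment> \<open>The square is completed with only half of the Gaussian exponent, which keeps
      the other half for integrability.\<close>
    have "0 \<le> (cmod w - r * t)\<^sup>2 / (2 * t)" using t_pos by simp
    also have "\<dots> = (cmod w)\<^sup>2 / (2 * t) - r * cmod w + r\<^sup>2 * t / 2"
      using t_pos by (simp add: field_simps power2_eq_square)
    also have "(cmod w)\<^sup>2 / (2 * t) = (cmod w)\<^sup>2 / t - 1/(2*t) * (cmod w)\<^sup>2"
      using t_pos by (simp add: field_simps)
    finally have "- (cmod w)\<^sup>2 / t + r * cmod w \<le> r\<^sup>2 * t / 2 + - (1/(2*t) * (cmod w)\<^sup>2)"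
      by simp
    then have "exp (- (cmod w)\<^sup>2 / t) * exp (r * cmod w) \<le> exp (r\<^sup>2 * t / 2) * exp (- (1/(2*t) * (cmod w)\<^sup>2))"
      unfolding exp_add[symmetric] by simp
    from divide_right_mono[OF this, of "pi * t"] show ?thesis
      using t_pos by (simp add: gw_def)
  qed
  then have b: "norm (gw w *\<^sub>R exp (r * cmod w)) \<le> norm (exp (r\<^sup>2 * t / 2) / (pi * t) * exp (- (1/(2*t) * (cmod w)\<^sup>2)))" for w
    using t_pos by (simp add: abs_mult)
  have "integrable lborel (\<lambda>w::complex. exp (r\<^sup>2 * t / 2) / (pi * t) * exp (- (1/(2*t) * (cmod w)\<^sup>2)))"
    using has_bochner_integral_gauss[of "1/(2*t)"] t_pos
    by (intro integrable_mult_right) (auto simp: has_bochner_integral_iff)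
  then have "integrable lborel (\<lambda>w. gw w *\<^sub>R exp (r * cmod w))"
    by (rule Bochner_Integration.integrable_bound) (use b in auto)
  then show ?thesis by (subst integrable_gauss_iff) auto
qed

section \<open>Norm and inner product of square-integrable functions\<close>

lemma L2_iff: "f \<in> L2 t \<longleftrightarrow> f \<in> borel_measurable borel \<and> integrable \<mu> (\<lambda>z. (cmod (f z))\<^sup>2)"
  by (simp add: L2_def)

lemma L2D [measurable_dest]: "f \<in> L2 t \<Longrightarrow> f \<in> borel_measurable borel"
  by (simp add: L2_iff)

lemma L2_nnI:
  assumes [measurable]: "f \<in> borel_measurable borel" and "(\<integral>\<^sup>+z. ennreal (cmod (f z)) ^ 2 \<partial>\<mu>) < \<infinity>"
  shows "f \<in> L2 t"
  using assms by (auto simp: L2_iff integrable_iff_bounded ennreal_power)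

lemma L2_norm_nonneg [simp]: "L2_norm t f \<ge> 0"
  by (simp add: L2_norm_def)

lemma L2_norm_sq: "(L2_norm t f)\<^sup>2 = (\<integral>z. (cmod (f z))\<^sup>2 \<partial>\<mu>)"
  by (simp add: L2_norm_def)

lemma L2_nn_norm:
  assumes "f \<in> L2 t"
  shows "(\<integral>\<^sup>+z. ennreal (cmod (f z)) ^ 2 \<partial>\<mu>) = ennreal ((L2_norm t f)\<^sup>2)"
  using assms unfolding L2_norm_sq
  by (subst nn_integral_eq_integral[symmetric]) (auto simp: L2_iff ennreal_power)

lemma L2_norm_le_nn:
  assumes [measurable]: "f \<in> borel_measurable borel" and "(\<integral>\<^sup>+z. ennreal (cmod (f z)) ^ 2 \<partial>\<mu>) \<le> ennreal (c\<^sup>2)" "c \<ge> 0"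
  shows "f \<in> L2 t" "L2_norm t f \<le> c"
proof -
  show *: "f \<in> L2 t"
    using assms(2) by (intro L2_nnI) (auto simp: order_le_less_trans)
  show "L2_norm t f \<le> c"
    using assms(2,3) unfolding L2_nn_norm[OF *] by (simp add: power2_le_iff_abs_le)
qed

lemma L2_cong_norm: 
  assumes "g \<in> L2 t" "f \<in> borel_measurable borel" "\<And>z. cmod (f z) \<le> cmod (g z)"
  shows "f \<in> L2 t"
  using assms by (auto simp: L2_iff intro: Bochner_Integration.integrable_bound[where f="\<lambda>z. (cmod (g z))\<^sup>2"])

lemma L2_zero [simp]: "(\<lambda>z. 0) \<in> L2 t"
  by (simp add: L2_iff)

lemma L2_cmult: 
  assumes "f \<in> L2 t" shows "(\<lambda>z. c * f z) \<in> L2 t"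
  using assms by (auto simp: L2_iff norm_mult power_mult_distrib)

lemma L2_add: 
  assumes "f \<in> L2 t" "g \<in> L2 t" shows "(\<lambda>z. f z + g z) \<in> L2 t"
proof -
  have [measurable]: "f \<in> borel_measurable borel" "g \<in> borel_measurable borel" using assms by (auto simp: L2_iff)
  have b: "(cmod (f z + g z))\<^sup>2 \<le> 2 * (cmod (f z))\<^sup>2 + 2 * (cmod (g z))\<^sup>2" for z
  proof -
    have "(cmod (f z + g z))\<^sup>2 \<le> (cmod (f z) + cmod (g z))\<^sup>2"
      by (intro power_mono norm_triangle_ineq) auto
    also have "\<dots> \<le> 2 * (cmod (f z))\<^sup>2 + 2 * (cmod (g z))\<^sup>2"
      using zero_le_power2[of "cmod (f z) - cmod (g z)"] by (simp add: power2_eq_square algebra_simps)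
    finally show ?thesis .
  qed
  have "integrable \<mu> (\<lambda>z. 2 * (cmod (f z))\<^sup>2 + 2 * (cmod (g z))\<^sup>2)"
    using assms by (auto simp: L2_iff)
  then have "integrable \<mu> (\<lambda>z. (cmod (f z + g z))\<^sup>2)"
    by (rule Bochner_Integration.integrable_bound) (use b in auto)
  then show ?thesis by (simp add: L2_iff)
qed

lemma L2_minus: "f \<in> L2 t \<Longrightarrow> (\<lambda>z. - f z) \<in> L2 t"
  using L2_cmult[of f "-1"] by simp

lemma L2_diff: "f \<in> L2 t \<Longrightarrow> g \<in> L2 t \<Longrightarrow> (\<lambda>z. f z - g z) \<in> L2 t"
  using L2_add[of f "\<lambda>z. - g z"] L2_minus[of g] by simp

lemma L2_mult_bounded:
  assumes "g \<in> L2 t" and [measurable]: "f \<in> borel_measurable borel" and "\<And>z. cmod (f z) \<le> B"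
  shows "(\<lambda>z. f z * g z) \<in> L2 t"
proof (rule L2_cong_norm[OF L2_cmult[OF assms(1), of "of_real B"]])
  have "g \<in> borel_measurable borel" using assms by (simp add: L2_iff)
  then show "(\<lambda>z. f z * g z) \<in> borel_measurable borel" by measurable
  have "B \<ge> 0" using assms(3) norm_ge_zero order.trans by blast
  then show "cmod (f z * g z) \<le> cmod (complex_of_real B * g z)" for z
    using assms(3)[of z] by (auto simp: norm_mult intro!: mult_right_mono)
qed

lemma L2_nn_Cauchy_Schwarz:
  assumes "f \<in> L2 t" "g \<in> L2 t"
  shows "(\<integral>\<^sup>+z. ennreal (cmod (f z)) * ennreal (cmod (g z)) \<partial>\<mu>) \<le> ennreal (L2_norm t f * L2_norm t g)"
proof -
  have [measurable]: "f \<in> borel_measurable borel" "g \<in> borel_measurable borel" using assms by (auto simp: L2_iff)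
  let ?I = "\<integral>\<^sup>+z. ennreal (cmod (f z)) * ennreal (cmod (g z)) \<partial>\<mu>"
  have "?I\<^sup>2 \<le> ennreal ((L2_norm t f)\<^sup>2) * ennreal ((L2_norm t g)\<^sup>2)"
    using Cauchy_Schwarz_nn_integral[of "\<lambda>z. ennreal (cmod (f z))" \<mu> "\<lambda>z. ennreal (cmod (g z))"]
    by (simp add: L2_nn_norm assms)
  also have "\<dots> = ennreal (L2_norm t f * L2_norm t g) ^ 2"
    by (simp add: ennreal_power ennreal_mult[symmetric] power_mult_distrib)
  finally show ?thesis
    by (cases ?I) (auto simp: ennreal_power power2_le_iff_abs_le top_unique)
qed

lemma L2_integrable_mult:
  assumes "f \<in> L2 t" "g \<in> L2 t"
  shows "integrable \<mu> (\<lambda>z. f z * g z)"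
proof (rule integrableI_bounded)
  have [measurable]: "f \<in> borel_measurable borel" "g \<in> borel_measurable borel" using assms by (auto simp: L2_iff)
  show "(\<lambda>z. f z * g z) \<in> borel_measurable \<mu>" by simp
  have "(\<integral>\<^sup>+z. norm (f z * g z) \<partial>\<mu>) \<le> ennreal (L2_norm t f * L2_norm t g)"
    using L2_nn_Cauchy_Schwarz[OF assms] unfolding norm_mult by (simp only: ennreal_mult norm_ge_zero)
  then show "(\<integral>\<^sup>+z. norm (f z * g z) \<partial>\<mu>) < \<infinity>"
    by (rule order_le_less_trans) simp
qed

lemma L2_cnj: "f \<in> L2 t \<Longrightarrow> (\<lambda>z. cnj (f z)) \<in> L2 t"
  by (auto simp: L2_iff)

lemma L2_integrable_inner:
  assumes "f \<in> L2 t" "g \<in> L2 t"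
  shows "integrable \<mu> (\<lambda>z. f z * cnj (g z))"
  using L2_integrable_mult[OF assms(1) L2_cnj[OF assms(2)]] .

lemma L2_Cauchy_Schwarz_int:
  assumes "f \<in> L2 t" "g \<in> L2 t"
  shows "(\<integral>z. cmod (f z) * cmod (g z) \<partial>\<mu>) \<le> L2_norm t f * L2_norm t g"
proof -
  have "integrable \<mu> (\<lambda>z. cmod (f z) * cmod (g z))"
    using integrable_norm[OF L2_integrable_mult[OF assms]] by (simp add: norm_mult)
  then have "ennreal (\<integral>z. cmod (f z) * cmod (g z) \<partial>\<mu>) = (\<integral>\<^sup>+z. ennreal (cmod (f z)) * ennreal (cmod (g z)) \<partial>\<mu>)"
    by (subst nn_integral_eq_integral[symmetric]) (auto simp: ennreal_mult)
  also have "\<dots> \<le> ennreal (L2_norm t f * L2_norm t g)"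
    by (rule L2_nn_Cauchy_Schwarz[OF assms])
  finally show ?thesis by simp
qed

lemma L2_Cauchy_Schwarz:
  assumes "f \<in> L2 t" "g \<in> L2 t"
  shows "cmod (L2_inner t f g) \<le> L2_norm t f * L2_norm t g"
proof -
  have "cmod (L2_inner t f g) \<le> (\<integral>z. norm (f z * cnj (g z)) \<partial>\<mu>)"
    unfolding L2_inner_def by (rule integral_norm_bound)
  also have "\<dots> \<le> L2_norm t f * L2_norm t g"
    using L2_Cauchy_Schwarz_int[OF assms] by (simp add: norm_mult)
  finally show ?thesis .
qed

lemma L2_inner_diff_left:
  assumes "f \<in> L2 t" "g \<in> L2 t" "h \<in> L2 t"
  shows "L2_inner t (\<lambda>z. f z - g z) h = L2_inner t f h - L2_inner t g h"
  unfolding L2_inner_def using assms by (simp add: left_diff_distrib L2_integrable_inner)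

lemma L2_inner_cmult_left: "L2_inner t (\<lambda>z. c * f z) h = c * L2_inner t f h"
  unfolding L2_inner_def by (simp add: mult.assoc)

lemma L2_inner_commute: "L2_inner t g f = cnj (L2_inner t f g)"
  unfolding L2_inner_def Bochner_Integration.integral_cnj[symmetric] by (simp add: mult.commute)

lemma L2_inner_self: "L2_inner t f f = of_real ((L2_norm t f)\<^sup>2)"
  unfolding L2_inner_def L2_norm_sq
  by (subst integral_complex_of_real[symmetric]) (simp add: complex_norm_square del: of_real_power)

lemma L2_norm_cmult: "L2_norm t (\<lambda>z. c * f z) = cmod c * L2_norm t f"
  by (simp add: L2_norm_def norm_mult power_mult_distrib real_sqrt_mult)

lemma L2_norm_zero [simp]: "L2_norm t (\<lambda>z. 0) = 0"
  by (simp add: L2_norm_def)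

lemma L2_norm_triangle:
  assumes "f \<in> L2 t" "g \<in> L2 t"
  shows "L2_norm t (\<lambda>z. f z + g z) \<le> L2_norm t f + L2_norm t g"
proof (rule power2_le_imp_le)
  have int: "integrable \<mu> (\<lambda>z. (cmod (f z))\<^sup>2)" "integrable \<mu> (\<lambda>z. (cmod (g z))\<^sup>2)"
    "integrable \<mu> (\<lambda>z. (cmod (f z + g z))\<^sup>2)" "integrable \<mu> (\<lambda>z. cmod (f z) * cmod (g z))"
    using assms L2_add[OF assms] integrable_norm[OF L2_integrable_mult[OF assms]]
    by (auto simp: L2_iff norm_mult)
  have "(L2_norm t (\<lambda>z. f z + g z))\<^sup>2 = (\<integral>z. (cmod (f z + g z))\<^sup>2 \<partial>\<mu>)"
    by (rule L2_norm_sq)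
  also have "\<dots> \<le> (\<integral>z. ((cmod (f z))\<^sup>2 + (cmod (g z))\<^sup>2) + 2 * (cmod (f z) * cmod (g z)) \<partial>\<mu>)"
  proof (rule integral_mono)
    fix z
    have "(cmod (f z + g z))\<^sup>2 \<le> (cmod (f z) + cmod (g z))\<^sup>2"
      by (intro power_mono norm_triangle_ineq) auto
    then show "(cmod (f z + g z))\<^sup>2 \<le> ((cmod (f z))\<^sup>2 + (cmod (g z))\<^sup>2) + 2 * (cmod (f z) * cmod (g z))"
      by (simp add: power2_sum)
  qed (use int in auto)
  also have "\<dots> = (L2_norm t f)\<^sup>2 + (L2_norm t g)\<^sup>2 + 2 * (\<integral>z. cmod (f z) * cmod (g z) \<partial>\<mu>)"
    using int by (simp add: L2_norm_sq)
  also have "\<dots> \<le> (L2_norm t f)\<^sup>2 + (L2_norm t g)\<^sup>2 + 2 * (L2_norm t f * L2_norm t g)"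
    using L2_Cauchy_Schwarz_int[OF assms] by simp
  finally show "(L2_norm t (\<lambda>z. f z + g z))\<^sup>2 \<le> (L2_norm t f + L2_norm t g)\<^sup>2"
    by (simp add: power2_sum)
qed simp

lemma L2_norm_mult_bounded:
  assumes "g \<in> L2 t" and [measurable]: "f \<in> borel_measurable borel" and "\<And>z. cmod (f z) \<le> B"
  shows "L2_norm t (\<lambda>z. f z * g z) \<le> B * L2_norm t g"
proof -
  have B: "B \<ge> 0" using assms(3) norm_ge_zero order.trans by blast
  have "(\<integral>z. (cmod (f z * g z))\<^sup>2 \<partial>\<mu>) \<le> (\<integral>z. (cmod (of_real B * g z))\<^sup>2 \<partial>\<mu>)"
  proof (rule integral_mono)
    show "integrable \<mu> (\<lambda>z. (cmod (f z * g z))\<^sup>2)" "integrable \<mu> (\<lambda>z. (cmod (of_real B * g z))\<^sup>2)"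
      using L2_mult_bounded[OF assms] L2_cmult[OF assms(1), of "of_real B"] by (auto simp: L2_iff)
    show "(cmod (f z * g z))\<^sup>2 \<le> (cmod (of_real B * g z))\<^sup>2" for z
      using assms(3)[of z] B by (intro power_mono) (auto simp: norm_mult intro!: mult_right_mono)
  qed
  then have "L2_norm t (\<lambda>z. f z * g z) \<le> L2_norm t (\<lambda>z. of_real B * g z)"
    by (simp add: L2_norm_def)
  then show ?thesis using B by (simp add: L2_norm_cmult)
qed

lemma L2_exp_norm: "(\<lambda>w. of_real (exp (r * cmod w))) \<in> L2 t"
  using integrable_exp_norm[of "2 * r"] by (simp add: L2_iff exp_double[symmetric] mult.assoc)

lemma cmod_exp_le: "cmod (exp (z * cnj w / t)) \<le> exp (cmod z / t * cmod w)"
proof -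
  have "Re (z * cnj w / t) \<le> cmod (z * cnj w / t)" by (rule complex_Re_le_cmod)
  then show ?thesis using t_pos by (simp add: norm_mult norm_divide)
qed

lemma exp_kernel_L2: "(\<lambda>w. exp (z * cnj w / t)) \<in> L2 t"
  by (rule L2_cong_norm[OF L2_exp_norm[of "cmod z / t"]]) (use cmod_exp_le[of z] in auto)

text \<open>The kernel is the squared modulus of \<open>E z\<close> times a factor that is
  holomorphic in \<open>w\<close>. This factor joins \<open>f\<close> to form \<open>F\<close>, the
  modulus moves the centre of the Gaussian to \<open>z\<close>, and the mean value property gives
  \<open>F z = f z\<close>. The assumption is integrability of the integrand, because the lemma is
  also applied to products such as \<open>h z * (w - z)\<close> whose square-integrability is not at
  hand.\<close>

lemma reproducing:
  assumes "f holomorphic_on UNIV" and int: "integrable \<mu> (\<lambda>w. f w * exp (z * cnj w / t))"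
  shows "(\<integral>w. f w * exp (z * cnj w / t) \<partial>\<mu>) = f z"
proof -
  have [measurable]: "f \<in> borel_measurable borel"
    using assms(1) by (intro borel_measurable_continuous_onI holomorphic_on_imp_continuous_on)
  define F where "F w = f w * exp (((cmod z)\<^sup>2 - w * cnj z) / t)" for w
  have [measurable]: "F \<in> borel_measurable borel" unfolding F_def by measurable
  have eq: "(cmod (E z w))\<^sup>2 *\<^sub>R F w = f w * exp (z * cnj w / t)" for w
  proof -
    have "complex_of_real ((2 * Re (w * cnj z) - (cmod z)\<^sup>2) / t) + ((cmod z)\<^sup>2 - w * cnj z) / t
      = (w * cnj z + cnj (w * cnj z) - w * cnj z) / t"
      unfolding complex_add_cnj by (simp add: diff_divide_distrib)
    then have "complex_of_real ((cmod (E z w))\<^sup>2) * exp (((cmod z)\<^sup>2 - w * cnj z) / t) = exp (z * cnj w / t)"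
      unfolding norm_E_sq exp_of_real[symmetric] exp_add[symmetric] by (simp add: mult.commute)
    then show ?thesis by (simp add: F_def scaleR_conv_of_real algebra_simps)
  qed
  have int1: "integrable (distr \<mu> borel (\<lambda>w. w + z)) F"
    unfolding gauss_shift[symmetric] using int by (subst integrable_density) (auto simp: eq)
  then have int2: "integrable \<mu> (\<lambda>w. F (w + z))"
    by (subst (asm) integrable_distr_eq) auto
  have hol: "(\<lambda>w. F (w + z)) holomorphic_on UNIV"
    unfolding F_def using assms(1) 
    by (intro holomorphic_intros holomorphic_on_compose_gen[of "\<lambda>w. w + z" UNIV f UNIV, unfolded o_def]) auto
  have "(\<integral>w. f w * exp (z * cnj w / t) \<partial>\<mu>) = (\<integral>w. F w \<partial>density \<mu> (\<lambda>w. ennreal ((cmod (E z w))\<^sup>2)))"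
    by (subst integral_density) (auto simp: eq)
  also have "\<dots> = (\<integral>w. F (w + z) \<partial>\<mu>)"
    unfolding gauss_shift by (subst integral_distr) auto
  also have "\<dots> = F z"
    using integral_rotation_invariant_holomorphic[OF finite_measure_axioms sets_gauss gauss_rotation int2 hol]
    by (simp add: emeasure_gauss_UNIV measure_def)
  also have "F z = f z" by (simp add: F_def complex_norm_square del: of_real_power)
  finally show ?thesis .
qed

end

section \<open>The Fock projection and the Weyl operators\<close>

context bargmann
begin

text \<open>The reproducing kernel weighted by a function of \<open>z - w\<close>:
  \<open>q = 1\<close> gives the projection \<open>P\<close>, and \<open>q = cnj\<close> gives the
  operator \<open>hankel\<close>.\<close>

definition kop :: "(complex \<Rightarrow> complex) \<Rightarrow> (complex \<Rightarrow> complex) \<Rightarrow> complex \<Rightarrow> complex" where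
  "kop q f z = (\<integral>w. f w * (q (z - w) * exp (z * cnj w / t)) \<partial>\<mu>)"

text \<open>Conjugation with the square root of the Gaussian weight turns the modulus of the kernel
  of \<open>kop q\<close> into a convolution kernel; admissibility is integrability of the
  latter.\<close>

definition kernel_adm :: "(complex \<Rightarrow> complex) \<Rightarrow> bool" where
  "kernel_adm q \<longleftrightarrow> q \<in> borel_measurable borel \<and>
     (\<integral>\<^sup>+x. ennreal (cmod (q x) * exp (- (cmod x)\<^sup>2 / (2 * t)) / (pi * t)) \<partial>lborel) < \<infinity>"

lemma nn_integral_reflect:
  fixes k :: "complex \<Rightarrow> ennreal"
  assumes [measurable]: "k \<in> borel_measurable borel"
  shows "(\<integral>\<^sup>+w. k (z - w) \<partial>lborel) = (\<integral>\<^sup>+w. k w \<partial>lborel)"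
proof -
  have "(\<integral>\<^sup>+w. k w \<partial>lborel) = (\<integral>\<^sup>+w. k w \<partial>distr lborel borel (\<lambda>w. z - w))"
    by (simp add: lborel_distr_reflect)
  then show ?thesis by (simp add: nn_integral_distr)
qed

lemma nn_integral_shift:
  fixes k :: "complex \<Rightarrow> ennreal"
  assumes [measurable]: "k \<in> borel_measurable borel"
  shows "(\<integral>\<^sup>+z. k (z - w) \<partial>lborel) = (\<integral>\<^sup>+z. k z \<partial>lborel)"
proof -
  have "(\<integral>\<^sup>+z. k z \<partial>lborel) = (\<integral>\<^sup>+z. k z \<partial>distr lborel borel ((+) (- w)))"
    by (simp add: lborel_distr_plus)
  then show ?thesis by (simp add: nn_integral_distr)
qed

text \<open>Young's inequality for convolution with an L1 kernel, after the Gaussian weights have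
  been moved. The estimate is for the integral of the modulus because \<open>kop_adjoint\<close>
  also needs it as a majorant for Fubini.\<close>

lemma kop_nn_bound:
  assumes q: "kernel_adm q" and f: "f \<in> L2 t"
  shows "(\<integral>\<^sup>+z. (\<integral>\<^sup>+w. ennreal (cmod (f w * (q (z - w) * exp (z * cnj w / t)))) \<partial>\<mu>)\<^sup>2 \<partial>\<mu>) < \<infinity>"
proof -
  have [measurable]: "q \<in> borel_measurable borel" "f \<in> borel_measurable borel"
    using assms by (auto simp: kernel_adm_def L2_iff)
  define k where "k x = ennreal (cmod (q x) * exp (- (cmod x)\<^sup>2 / (2 * t)) / (pi * t))" for x
  define u where "u w = ennreal (cmod (f w) * exp (- (cmod w)\<^sup>2 / (2 * t)))" for w
  have km[measurable]: "k \<in> borel_measurable borel" and um[measurable]: "u \<in> borel_measurable borel"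
    unfolding k_def u_def by measurable
  define C where "C = (\<integral>\<^sup>+x. k x \<partial>lborel)"
  have C: "C < \<infinity>" using q by (simp add: kernel_adm_def C_def k_def)
  \<comment> \<open>Expanding \<open>(cmod (z - w))\<^sup>2\<close> distributes the exponent
    \<open>Re (z * cnj w) - (cmod w)\<^sup>2\<close> over a factor in \<open>z\<close>, a factor in
    \<open>w\<close> and one in the difference.\<close>
  have id: "gw w * cmod (f w * (q (z - w) * exp (z * cnj w / t))) =
      exp ((cmod z)\<^sup>2 / (2 * t)) * ((cmod (q (z - w)) * exp (- (cmod (z - w))\<^sup>2 / (2 * t)) / (pi * t)) * (cmod (f w) * exp (- (cmod w)\<^sup>2 / (2 * t))))" for z w
  proof -
    have "- (cmod w)\<^sup>2 / t + Re (z * cnj w) / t = (cmod z)\<^sup>2 / (2 * t) + (- (cmod (z - w))\<^sup>2 / (2 * t) + - (cmod w)\<^sup>2 / (2 * t))"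
      unfolding cmod_diff_sq using t_pos by (simp add: field_simps)
    then have "exp (- (cmod w)\<^sup>2 / t) * exp (Re (z * cnj w) / t) = exp ((cmod z)\<^sup>2 / (2 * t)) * (exp (- (cmod (z - w))\<^sup>2 / (2 * t)) * exp (- (cmod w)\<^sup>2 / (2 * t)))"
      by (simp only: exp_add[symmetric])
    then have "(cmod (f w) * cmod (q (z - w)) / (pi * t)) * (exp (- (cmod w)\<^sup>2 / t) * exp (Re (z * cnj w) / t)) =
       (cmod (f w) * cmod (q (z - w)) / (pi * t)) * (exp ((cmod z)\<^sup>2 / (2 * t)) * (exp (- (cmod (z - w))\<^sup>2 / (2 * t)) * exp (- (cmod w)\<^sup>2 / (2 * t))))"
      by simp
    then show ?thesis
      by (simp add: gw_def norm_mult mult_ac)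
  qed
  have inner: "(\<integral>\<^sup>+w. ennreal (cmod (f w * (q (z - w) * exp (z * cnj w / t)))) \<partial>\<mu>)
     = ennreal (exp ((cmod z)\<^sup>2 / (2 * t))) * (\<integral>\<^sup>+w. k (z - w) * u w \<partial>lborel)" for z
  proof -
    have "(\<integral>\<^sup>+w. ennreal (cmod (f w * (q (z - w) * exp (z * cnj w / t)))) \<partial>\<mu>)
      = (\<integral>\<^sup>+w. ennreal (gw w * cmod (f w * (q (z - w) * exp (z * cnj w / t)))) \<partial>lborel)"
      by (subst nn_integral_gauss_measure) (auto simp: ennreal_mult)
    also have "\<dots> = (\<integral>\<^sup>+w. ennreal (exp ((cmod z)\<^sup>2 / (2 * t))) * (k (z - w) * u w) \<partial>lborel)"
      unfolding id k_def u_def using t_pos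
      by (intro nn_integral_cong, subst ennreal_mult) (auto simp flip: ennreal_mult intro!: mult_nonneg_nonneg)
    also have "\<dots> = ennreal (exp ((cmod z)\<^sup>2 / (2 * t))) * (\<integral>\<^sup>+w. k (z - w) * u w \<partial>lborel)"
      by (rule nn_integral_cmult) simp
    finally show ?thesis .
  qed
  \<comment> \<open>The squared factor in \<open>z\<close> cancels the Gaussian density of the outer
    integral, leaving Lebesgue measure and the constant \<open>1 / (pi * t)\<close>;
    \<open>usq\<close> uses this constant to restore the density for \<open>f\<close>.\<close>
  have gsq: "ennreal (gw z) * ennreal (exp ((cmod z)\<^sup>2 / (2 * t))) ^ 2 = ennreal (1 / (pi * t))" for z
  proof -
    have "gw z * (exp ((cmod z)\<^sup>2 / (2 * t)))\<^sup>2 = 1 / (pi * t)"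
      using t_pos by (simp add: gw_def exp_double[symmetric] exp_minus field_simps)
    then show ?thesis by (simp add: ennreal_power ennreal_mult[symmetric])
  qed
  have usq: "ennreal (1 / (pi * t)) * (u w)\<^sup>2 = ennreal (gw w) * ennreal (cmod (f w)) ^ 2" for w
  proof -
    have "1 / (pi * t) * (cmod (f w) * exp (- (cmod w)\<^sup>2 / (2 * t)))\<^sup>2 = gw w * (cmod (f w))\<^sup>2"
      using t_pos by (simp add: gw_def power_mult_distrib exp_double[symmetric])
    then show ?thesis using t_pos by (simp add: u_def ennreal_power ennreal_mult[symmetric])
  qed
  have "(\<integral>\<^sup>+z. (\<integral>\<^sup>+w. ennreal (cmod (f w * (q (z - w) * exp (z * cnj w / t)))) \<partial>\<mu>)\<^sup>2 \<partial>\<mu>)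
    = (\<integral>\<^sup>+z. ennreal (gw z) * (ennreal (exp ((cmod z)\<^sup>2 / (2 * t))) * (\<integral>\<^sup>+w. k (z - w) * u w \<partial>lborel))\<^sup>2 \<partial>lborel)"
    unfolding inner by (rule nn_integral_gauss_measure) measurable
  also have "\<dots> = (\<integral>\<^sup>+z. ennreal (1 / (pi * t)) * (\<integral>\<^sup>+w. k (z - w) * u w \<partial>lborel)\<^sup>2 \<partial>lborel)"
    by (simp only: power_mult_distrib mult.assoc[symmetric] gsq)
  also have "\<dots> \<le> (\<integral>\<^sup>+z. ennreal (1 / (pi * t)) * (C * (\<integral>\<^sup>+w. k (z - w) * (u w)\<^sup>2 \<partial>lborel)) \<partial>lborel)"
  proof (intro nn_integral_mono mult_left_mono)
    fix z
    show "(\<integral>\<^sup>+w. k (z - w) * u w \<partial>lborel)\<^sup>2 \<le> C * (\<integral>\<^sup>+w. k (z - w) * (u w)\<^sup>2 \<partial>lborel)"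
      using nn_integral_weighted_square[of "\<lambda>w. k (z - w)" lborel u]
      by (simp add: C_def nn_integral_reflect)
  qed simp
  also have "\<dots> = C * (\<integral>\<^sup>+z. \<integral>\<^sup>+w. k (z - w) * (ennreal (1 / (pi * t)) * (u w)\<^sup>2) \<partial>lborel \<partial>lborel)"
    by (simp add: nn_integral_cmult[symmetric] mult_ac)
  also have "\<dots> = C * (\<integral>\<^sup>+w. \<integral>\<^sup>+z. k (z - w) * (ennreal (1 / (pi * t)) * (u w)\<^sup>2) \<partial>lborel \<partial>lborel)"
    by (subst lborel_pair.Fubini') auto
  also have "\<dots> = C * (\<integral>\<^sup>+w. C * (ennreal (1 / (pi * t)) * (u w)\<^sup>2) \<partial>lborel)"
    by (simp add: nn_integral_multc nn_integral_shift C_def)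
  also have "\<dots> = C * (C * (\<integral>\<^sup>+w. ennreal (gw w) * ennreal (cmod (f w)) ^ 2 \<partial>lborel))"
    unfolding usq by (simp add: nn_integral_cmult)
  also have "(\<integral>\<^sup>+w. ennreal (gw w) * ennreal (cmod (f w)) ^ 2 \<partial>lborel) = ennreal ((L2_norm t f)\<^sup>2)"
    using L2_nn_norm[OF f] by (subst (asm) nn_integral_gauss_measure) auto
  also have "C * (C * ennreal ((L2_norm t f)\<^sup>2)) < \<infinity>"
    using C by (simp add: ennreal_mult_less_top)
  finally show ?thesis .
qed

lemma kop_measurable [measurable]:
  assumes [measurable]: "q \<in> borel_measurable borel" "f \<in> borel_measurable borel"
  shows "kop q f \<in> borel_measurable borel"
  unfolding kop_def by measurable

text \<open>Without integrability the Bochner integral is \<open>0\<close> by convention and the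
  bound is trivial.\<close>

lemma norm_integral_le_nn:
  fixes F :: "'b \<Rightarrow> complex"
  shows "ennreal (cmod (\<integral>w. F w \<partial>M)) \<le> (\<integral>\<^sup>+w. ennreal (cmod (F w)) \<partial>M)"
proof (cases "integrable M F")
  case True then show ?thesis by (rule integral_norm_bound_ennreal)
qed (simp add: not_integrable_integral_eq)

lemma kop_L2:
  assumes q: "kernel_adm q" and f: "f \<in> L2 t"
  shows "kop q f \<in> L2 t"
proof (rule L2_nnI)
  show "kop q f \<in> borel_measurable borel"
    using assms by (intro kop_measurable) (auto simp: kernel_adm_def L2_iff)
  have "(\<integral>\<^sup>+z. ennreal (cmod (kop q f z)) ^ 2 \<partial>\<mu>) \<le>
      (\<integral>\<^sup>+z. (\<integral>\<^sup>+w. ennreal (cmod (f w * (q (z - w) * exp (z * cnj w / t)))) \<partial>\<mu>)\<^sup>2 \<partial>\<mu>)"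
    unfolding kop_def by (intro nn_integral_mono power_mono norm_integral_le_nn) auto
  then show "(\<integral>\<^sup>+z. ennreal (cmod (kop q f z)) ^ 2 \<partial>\<mu>) < \<infinity>"
    using kop_nn_bound[OF assms] by (rule order_le_less_trans)
qed

text \<open>Exchanging \<open>z\<close> and \<open>w\<close> and conjugating maps the kernel for
  \<open>q\<close> to the one for \<open>cnj (q (- x))\<close>. Fubini is justified by
  Cauchy-Schwarz between the majorant of \<open>kop_nn_bound\<close> and \<open>h\<close>.\<close>

lemma kop_adjoint:
  assumes q: "kernel_adm q" and f: "f \<in> L2 t" and h: "h \<in> L2 t"
  shows "L2_inner t (kop q f) h = (\<integral>w. f w * cnj (kop (\<lambda>x. cnj (q (- x))) h w) \<partial>\<mu>)"
proof -
  interpret MM: pair_sigma_finite \<mu> \<mu> ..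
  have [measurable]: "q \<in> borel_measurable borel" "f \<in> borel_measurable borel" "h \<in> borel_measurable borel"
    using assms by (auto simp: kernel_adm_def L2_iff)
  let ?F = "\<lambda>z w. (f w * (q (z - w) * exp (z * cnj w / t))) * cnj (h z)"
  have int: "integrable (\<mu> \<Otimes>\<^sub>M \<mu>) (\<lambda>(z, w). ?F z w)"
  proof (rule integrableI_bounded)
    show "(\<lambda>(z, w). ?F z w) \<in> borel_measurable (\<mu> \<Otimes>\<^sub>M \<mu>)" by measurable
    let ?G = "\<lambda>z. \<integral>\<^sup>+w. ennreal (cmod (f w * (q (z - w) * exp (z * cnj w / t)))) \<partial>\<mu>"
    let ?H = "\<lambda>p. ennreal (norm (case p of (z, w) \<Rightarrow> ?F z w))"
    have "(\<integral>\<^sup>+p. ?H p \<partial>(\<mu> \<Otimes>\<^sub>M \<mu>)) = (\<integral>\<^sup>+z. \<integral>\<^sup>+w. ?H (z, w) \<partial>\<mu> \<partial>\<mu>)"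
      using nn_integral_fst[of ?H \<mu>] by (simp del: measurable_gauss)
    then have "(\<integral>\<^sup>+p. ?H p \<partial>(\<mu> \<Otimes>\<^sub>M \<mu>)) = (\<integral>\<^sup>+z. \<integral>\<^sup>+w. norm (?F z w) \<partial>\<mu> \<partial>\<mu>)"
      by simp
    also have "\<dots> = (\<integral>\<^sup>+z. ?G z * ennreal (cmod (h z)) \<partial>\<mu>)"
    proof (rule nn_integral_cong)
      fix z
      have "(\<integral>\<^sup>+w. norm (?F z w) \<partial>\<mu>) = (\<integral>\<^sup>+w. ennreal (cmod (f w * (q (z - w) * exp (z * cnj w / t)))) * ennreal (cmod (h z)) \<partial>\<mu>)"
        by (subst norm_mult, subst ennreal_mult) auto
      then show "(\<integral>\<^sup>+w. norm (?F z w) \<partial>\<mu>) = ?G z * ennreal (cmod (h z))"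
        by (subst (asm) nn_integral_multc) auto
    qed
    finally have eq: "(\<integral>\<^sup>+p. norm (case p of (z, w) \<Rightarrow> ?F z w) \<partial>(\<mu> \<Otimes>\<^sub>M \<mu>)) = (\<integral>\<^sup>+z. ?G z * ennreal (cmod (h z)) \<partial>\<mu>)" .
    have "(\<integral>\<^sup>+z. ?G z * ennreal (cmod (h z)) \<partial>\<mu>)\<^sup>2 \<le> (\<integral>\<^sup>+z. (?G z)\<^sup>2 \<partial>\<mu>) * (\<integral>\<^sup>+z. ennreal (cmod (h z)) ^ 2 \<partial>\<mu>)"
      by (rule Cauchy_Schwarz_nn_integral) measurable
    also have "\<dots> < \<infinity>"
      using kop_nn_bound[OF q f] by (simp add: L2_nn_norm[OF h] ennreal_mult_less_top)
    finally show "(\<integral>\<^sup>+p. norm (case p of (z, w) \<Rightarrow> ?F z w) \<partial>(\<mu> \<Otimes>\<^sub>M \<mu>)) < \<infinity>"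
      unfolding eq by (cases "(\<integral>\<^sup>+z. ?G z * ennreal (cmod (h z)) \<partial>\<mu>)") auto
  qed
  have "L2_inner t (kop q f) h = (\<integral>z. (\<integral>w. ?F z w \<partial>\<mu>) \<partial>\<mu>)"
    unfolding L2_inner_def kop_def by (subst integral_mult_left_zero) simp
  also have "\<dots> = (\<integral>w. (\<integral>z. ?F z w \<partial>\<mu>) \<partial>\<mu>)"
    by (rule MM.Fubini_integral[symmetric, OF int])
  also have "\<dots> = (\<integral>w. f w * cnj (kop (\<lambda>x. cnj (q (- x))) h w) \<partial>\<mu>)"
  proof (rule Bochner_Integration.integral_cong[OF refl])
    fix w
    have "cnj (kop (\<lambda>x. cnj (q (- x))) h w) = (\<integral>z. cnj (h z) * (q (z - w) * exp (z * cnj w / t)) \<partial>\<mu>)"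
      unfolding kop_def Bochner_Integration.integral_cnj[symmetric] by (simp add: exp_cnj mult.commute)
    then show "(\<integral>z. ?F z w \<partial>\<mu>) = f w * cnj (kop (\<lambda>x. cnj (q (- x))) h w)"
      by (simp add: integral_mult_right_zero[symmetric] mult_ac del: integral_mult_right_zero)
  qed
  finally show ?thesis .
qed

lemma kernel_adm_exp_bound:
  assumes [measurable]: "q \<in> borel_measurable borel" and b: "\<And>x. cmod (q x) \<le> C * cmod x ^ n"
  shows "kernel_adm q"
proof -
  have "integrable lborel (\<lambda>x::complex. C / (pi * t) * (cmod x ^ n * exp (- (1 / (2 * t) * (cmod x)\<^sup>2))))"
    using t_pos by (intro integrable_mult_right integrable_gauss_moment) auto
  then have "integrable lborel (\<lambda>x. cmod (q x) * exp (- (cmod x)\<^sup>2 / (2 * t)) / (pi * t))"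
  proof (rule Bochner_Integration.integrable_bound)
    show "AE x in lborel. norm (cmod (q x) * exp (- (cmod x)\<^sup>2 / (2 * t)) / (pi * t)) \<le> norm (C / (pi * t) * (cmod x ^ n * exp (- (1 / (2 * t) * (cmod x)\<^sup>2))))"
    proof (rule AE_I2)
      fix x
      have "norm (cmod (q x) * exp (- (cmod x)\<^sup>2 / (2 * t)) / (pi * t)) = cmod (q x) * (exp (- (cmod x)\<^sup>2 / (2 * t)) / (pi * t))"
        using t_pos by simp
      also have "\<dots> \<le> (C * cmod x ^ n) * (exp (- (cmod x)\<^sup>2 / (2 * t)) / (pi * t))"
        using t_pos by (intro mult_right_mono b) auto
      also have "\<dots> = C / (pi * t) * (cmod x ^ n * exp (- (1 / (2 * t) * (cmod x)\<^sup>2)))"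
        by (simp add: field_simps)
      finally show "norm (cmod (q x) * exp (- (cmod x)\<^sup>2 / (2 * t)) / (pi * t)) \<le> norm (C / (pi * t) * (cmod x ^ n * exp (- (1 / (2 * t) * (cmod x)\<^sup>2))))"
        unfolding real_norm_def using abs_ge_self order.trans by blast
    qed
  qed measurable
  then show ?thesis using t_pos unfolding kernel_adm_def integrable_iff_bounded by (auto simp: abs_mult)
qed

lemma kernel_adm_const: "kernel_adm (\<lambda>_. c)"
  by (rule kernel_adm_exp_bound[where C="cmod c" and n=0]) auto

section \<open>The projection in integral form and the reproducing kernel\<close>

definition P :: "(complex \<Rightarrow> complex) \<Rightarrow> complex \<Rightarrow> complex" where
  "P f z = (\<integral>w. f w * exp (z * cnj w / t) \<partial>\<mu>)"

lemma P_eq_kop: "P f = kop (\<lambda>_. 1) f"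
  by (simp add: P_def kop_def fun_eq_iff)

lemma fock_L2: "f \<in> fock t \<Longrightarrow> f \<in> L2 t"
  by (simp add: fock_def)

lemma fock_measurable [measurable_dest]: "f \<in> fock t \<Longrightarrow> f \<in> borel_measurable borel"
  by (simp add: fock_def L2_iff)

lemma fock_hol: "f \<in> fock t \<Longrightarrow> f holomorphic_on UNIV"
  by (simp add: fock_def)

lemma integrable_L2_exp:
  assumes "f \<in> L2 t" shows "integrable \<mu> (\<lambda>w. f w * exp (z * cnj w / t))"
  using L2_integrable_mult[OF assms exp_kernel_L2] .

lemma P_derivative:
  assumes f: "f \<in> L2 t"
  shows "(P f has_field_derivative (\<integral>w. f w * (cnj w / t * exp (z * cnj w / t)) \<partial>\<mu>)) (at z)"
proof -
  have [measurable]: "f \<in> borel_measurable borel" using f by (simp add: L2_iff)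
  have "((\<lambda>z. \<integral>w. f w * exp (z * (cnj w / t)) \<partial>\<mu>) has_field_derivative
      (\<integral>w. f w * (cnj w / t * exp (z * (cnj w / t))) \<partial>\<mu>)) (at z)"
  proof (rule has_field_derivative_exp_integral)
    fix r
    have "integrable \<mu> (\<lambda>w. f w * of_real (exp (r / t * cmod w)))"
      by (rule L2_integrable_mult[OF f L2_exp_norm])
    from integrable_norm[OF this]
    show "integrable \<mu> (\<lambda>w. cmod (f w) * exp (r * cmod (cnj w / complex_of_real t)))"
      using t_pos by (simp add: norm_mult norm_divide)
  qed auto
  then show ?thesis unfolding P_def[abs_def] by simp
qed

lemma P_fock:
  assumes f: "f \<in> L2 t" shows "P f \<in> fock t"
  unfolding fock_def
proof safe
  show "P f \<in> L2 t" unfolding P_eq_kop by (rule kop_L2[OF kernel_adm_const f])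
  show "P f holomorphic_on UNIV"
    using P_derivative[OF f] by (auto simp: holomorphic_on_open)
qed

lemma P_ident: "g \<in> fock t \<Longrightarrow> P g = g"
  unfolding P_def by (rule ext, rule reproducing) (auto simp: fock_hol integrable_L2_exp fock_L2)

text \<open>The kernel for the constant \<open>q = 1\<close> is its own adjoint, and
  \<open>h\<close> is fixed by \<open>P\<close>.\<close>

lemma P_inner:
  assumes "f \<in> L2 t" "h \<in> fock t"
  shows "L2_inner t (P f) h = L2_inner t f h"
  using kop_adjoint[OF kernel_adm_const assms(1) fock_L2[OF assms(2)], of 1] P_ident[OF assms(2)]
  by (simp add: P_eq_kop L2_inner_def)

lemma fock_zero [simp]: "(\<lambda>z. 0) \<in> fock t"
  by (simp add: fock_def)

lemma fock_add: "f \<in> fock t \<Longrightarrow> g \<in> fock t \<Longrightarrow> (\<lambda>z. f z + g z) \<in> fock t"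
  by (auto simp: fock_def L2_add intro!: holomorphic_intros)

lemma fock_diff: "f \<in> fock t \<Longrightarrow> g \<in> fock t \<Longrightarrow> (\<lambda>z. f z - g z) \<in> fock t"
  by (auto simp: fock_def L2_diff intro!: holomorphic_intros)

lemma fock_cmult: "f \<in> fock t \<Longrightarrow> (\<lambda>z. c * f z) \<in> fock t"
  by (auto simp: fock_def L2_cmult intro!: holomorphic_intros)

definition ker :: "complex \<Rightarrow> complex \<Rightarrow> complex" where "ker z w = exp (w * cnj z / t)"

lemma cnj_ker: "cnj (ker z w) = exp (z * cnj w / t)"
  by (simp add: ker_def exp_cnj mult.commute)

lemma ker_fock: "ker z \<in> fock t"
proof -
  have "(\<lambda>w. cnj (cnj (ker z w))) \<in> L2 t"
    unfolding cnj_ker by (intro L2_cnj exp_kernel_L2)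
  then have "ker z \<in> L2 t" by simp
  then show ?thesis by (auto simp: fock_def ker_def[abs_def] intro!: holomorphic_intros)
qed

lemma P_inner_ker: "P f z = L2_inner t f (ker z)"
  by (simp add: P_def L2_inner_def cnj_ker)

lemma fock_inner_ker: "g \<in> fock t \<Longrightarrow> L2_inner t g (ker z) = g z"
  using P_inner_ker[of g z] P_ident[of g] by simp

lemma norm_ker: "L2_norm t (ker z) = exp ((cmod z)\<^sup>2 / (2 * t))"
proof -
  have "complex_of_real ((L2_norm t (ker z))\<^sup>2) = ker z z"
    using fock_inner_ker[OF ker_fock, of z z] by (simp add: L2_inner_self)
  also have "\<dots> = complex_of_real (exp ((cmod z)\<^sup>2 / t))"
    by (simp add: ker_def complex_norm_square[symmetric] exp_of_real[symmetric])
  finally have "(L2_norm t (ker z))\<^sup>2 = exp ((cmod z)\<^sup>2 / t)"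
    by (simp only: of_real_eq_iff)
  also have "\<dots> = (exp ((cmod z)\<^sup>2 / (2 * t)))\<^sup>2"
    by (simp add: exp_double[symmetric])
  finally show ?thesis by (rule power2_eq_imp_eq) auto
qed

text \<open>Cauchy-Schwarz against \<open>ker z\<close>. Since the bound is pointwise, a Fock
  function of norm zero vanishes everywhere and not merely almost everywhere.\<close>

lemma fock_bound:
  assumes "g \<in> fock t"
  shows "cmod (g z) \<le> L2_norm t g * exp ((cmod z)\<^sup>2 / (2 * t))"
  using L2_Cauchy_Schwarz[OF fock_L2[OF assms] fock_L2[OF ker_fock], of z]
  by (simp add: fock_inner_ker[OF assms] norm_ker)

lemma fock_norm_zero:
  assumes "g \<in> fock t" "L2_norm t g = 0" shows "g = (\<lambda>z. 0)"
  using fock_bound[OF assms(1)] assms(2) by (auto simp: fun_eq_iff)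

lemma norm_P_le:
  assumes "f \<in> L2 t" shows "L2_norm t (P f) \<le> L2_norm t f"
proof -
  have "(L2_norm t (P f))\<^sup>2 = cmod (L2_inner t (P f) (P f))"
    unfolding L2_inner_self by (simp only: norm_of_real) simp
  also have "\<dots> = cmod (L2_inner t f (P f))"
    by (simp add: P_inner[OF assms P_fock[OF assms]])
  also have "\<dots> \<le> L2_norm t f * L2_norm t (P f)"
    by (rule L2_Cauchy_Schwarz[OF assms fock_L2[OF P_fock[OF assms]]])
  finally show ?thesis
    by (cases "L2_norm t (P f) = 0") (auto simp: power2_eq_square mult_le_cancel_right less_le)
qed

text \<open>The difference of two candidates lies in the Fock space and is orthogonal to itself;
  \<open>fock_norm_zero\<close> then gives equality as functions, which the definite description in
  \<open>fock_proj\<close> demands.\<close>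

lemma fock_proj_unique:
  assumes "f \<in> L2 t" "h \<in> fock t" "\<And>g. g \<in> fock t \<Longrightarrow> L2_inner t h g = L2_inner t f g"
  shows "fock_proj t f = h"
  unfolding fock_proj_def
proof (rule the_equality)
  show "h \<in> fock t \<and> (\<forall>g\<in>fock t. L2_inner t (\<lambda>w. f w - h w) g = 0)"
    using assms by (auto simp: L2_inner_diff_left fock_L2)
  fix h' assume h': "h' \<in> fock t \<and> (\<forall>g\<in>fock t. L2_inner t (\<lambda>w. f w - h' w) g = 0)"
  let ?d = "\<lambda>w. h' w - h w"
  have d: "?d \<in> fock t" using assms h' by (intro fock_diff) auto
  have "L2_inner t f ?d - L2_inner t h' ?d = 0"
    using h' d assms by (simp add: L2_inner_diff_left[symmetric] fock_L2)
  then have "L2_inner t ?d ?d = 0"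
    using assms(3)[OF d] h' d assms by (subst L2_inner_diff_left) (auto simp: fock_L2)
  then have "L2_norm t ?d = 0" by (simp add: L2_inner_self)
  then show "h' = h" using fock_norm_zero[OF d] by (simp add: fun_eq_iff)
qed

lemma fock_proj_eq: "f \<in> L2 t \<Longrightarrow> fock_proj t f = P f"
  by (intro fock_proj_unique P_fock P_inner)

text \<open>Formally \<open>cnj z * g\<close> minus its projection \<open>t * g'\<close>. Neither
  term has to be square-integrable for a general Fock function \<open>g\<close>, but the difference
  is, and this settles the domain question for the resolvents.\<close>

definition hankel :: "(complex \<Rightarrow> complex) \<Rightarrow> complex \<Rightarrow> complex" where
  "hankel g z = cnj z * g z - of_real t * deriv g z"

lemma cmod_le_exp: "cmod x \<le> exp (cmod x)"
  using exp_ge_add_one_self[of "cmod x"] by linarith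

lemma linear_exp_L2: "(\<lambda>w. (a - w) * exp (z * cnj w / t)) \<in> L2 t"
proof (rule L2_cong_norm[OF L2_cmult[OF L2_exp_norm[of "1 + cmod z / t"], of "of_real (exp (cmod a))"]])
  fix w
  have "cmod (a - w) \<le> exp (cmod (a - w))" by (rule cmod_le_exp)
  also have "\<dots> \<le> exp (cmod a + cmod w)" by (simp add: norm_triangle_ineq4)
  finally have "cmod (a - w) * cmod (exp (z * cnj w / t)) \<le> exp (cmod a + cmod w) * exp (cmod z / t * cmod w)"
    by (intro mult_mono cmod_exp_le) auto
  also have "\<dots> = exp (cmod a) * exp ((1 + cmod z / t) * cmod w)"
    by (simp add: algebra_simps flip: exp_add)
  finally show "cmod ((a - w) * exp (z * cnj w / t)) \<le> cmod (complex_of_real (exp (cmod a)) * complex_of_real (exp ((1 + cmod z / t) * cmod w)))"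
    by (simp add: norm_mult)
qed measurable

text \<open>When \<open>cnj (z - w)\<close> is expanded under the integral, the first part
  reproduces \<open>g\<close> and the second is \<open>t\<close> times the differentiated
  reproducing formula. Square-integrability of \<open>hankel g\<close> thereby becomes that of
  \<open>kop cnj g\<close>.\<close>

lemma hankel_kop:
  assumes g: "g \<in> fock t"
  shows "kop cnj g = hankel g"
proof
  fix z
  have d: "deriv g z = (\<integral>w. g w * (cnj w / t * exp (z * cnj w / t)) \<partial>\<mu>)"
    using DERIV_imp_deriv[OF P_derivative[OF fock_L2[OF g], of z]] by (simp add: P_ident[OF g])
  have i1: "integrable \<mu> (\<lambda>w. g w * exp (z * cnj w / t))"
    by (rule integrable_L2_exp[OF fock_L2[OF g]])
  have i2: "integrable \<mu> (\<lambda>w. g w * (cnj w * exp (z * cnj w / t)))"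
  proof -
    have "(\<lambda>w. cnj w * exp (z * cnj w / t)) \<in> L2 t"
      by (rule L2_cong_norm[OF linear_exp_L2[of 0 z]]) (auto simp: norm_mult)
    from L2_integrable_mult[OF fock_L2[OF g] this] show ?thesis .
  qed
  have "kop cnj g z = (\<integral>w. cnj z * (g w * exp (z * cnj w / t)) - g w * (cnj w * exp (z * cnj w / t)) \<partial>\<mu>)"
    unfolding kop_def by (simp add: algebra_simps)
  also have "\<dots> = cnj z * (\<integral>w. g w * exp (z * cnj w / t) \<partial>\<mu>) - (\<integral>w. g w * (cnj w * exp (z * cnj w / t)) \<partial>\<mu>)"
    using i1 i2 by simp
  also have "(\<integral>w. g w * exp (z * cnj w / t) \<partial>\<mu>) = g z"
    using P_ident[OF g] by (simp add: P_def fun_eq_iff)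
  also have "(\<integral>w. g w * (cnj w * exp (z * cnj w / t)) \<partial>\<mu>) = of_real t * deriv g z"
    unfolding d using t_pos by (subst integral_mult_right_zero[symmetric]) simp
  finally show "kop cnj g z = hankel g z" by (simp add: hankel_def)
qed

lemma hankel_L2: "g \<in> fock t \<Longrightarrow> hankel g \<in> L2 t"
  unfolding hankel_kop[symmetric] 
  by (intro kop_L2 fock_L2 kernel_adm_exp_bound[where C=1 and n=1]) auto

text \<open>The adjoint kernel carries the factor \<open>- x\<close>, which is holomorphic in the
  variable of integration: the reproducing formula evaluates \<open>h z * (w - z)\<close> at
  \<open>z = w\<close> and gives \<open>0\<close>.\<close>

lemma hankel_orthogonal:
  assumes g: "g \<in> fock t" and h: "h \<in> fock t"
  shows "L2_inner t (hankel g) h = 0"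
proof -
  have [measurable]: "h \<in> borel_measurable borel" using fock_measurable[OF h] .
  have z: "kop (\<lambda>x. cnj (cnj (- x))) h w = 0" for w
  proof -
    have "integrable \<mu> (\<lambda>z. h z * ((w - z) * exp (w * cnj z / t)))"
      by (rule L2_integrable_mult[OF fock_L2[OF h] linear_exp_L2])
    then have i: "integrable \<mu> (\<lambda>z. (h z * (w - z)) * exp (w * cnj z / t))" by (simp add: mult.assoc)
    have "(\<integral>z. (h z * (w - z)) * exp (w * cnj z / t) \<partial>\<mu>) = h w * (w - w)"
      by (rule reproducing[OF _ i]) (use fock_hol[OF h] in \<open>auto intro!: holomorphic_intros\<close>)
    moreover have "kop (\<lambda>x. cnj (cnj (- x))) h w = - (\<integral>z. (h z * (w - z)) * exp (w * cnj z / t) \<partial>\<mu>)"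
      unfolding kop_def by (simp add: integral_minus[symmetric] mult.assoc algebra_simps del: integral_minus)
    ultimately show ?thesis by simp
  qed
  have "kernel_adm cnj" by (rule kernel_adm_exp_bound[where C=1 and n=1]) auto
  from kop_adjoint[OF this fock_L2[OF g] fock_L2[OF h]] show ?thesis
    by (simp only: hankel_kop[OF g] z) simp
qed

section \<open>Weyl operators\<close>

definition W :: "complex \<Rightarrow> (complex \<Rightarrow> complex) \<Rightarrow> complex \<Rightarrow> complex" where
  "W v g w = E v w * g (w - v)"

lemma W_measurable [measurable (raw)]:
  assumes [measurable]: "a \<in> borel_measurable M" "b \<in> borel_measurable M" "g \<in> borel_measurable borel"
  shows "(\<lambda>x. W (a x) g (b x)) \<in> borel_measurable M"
  unfolding W_def by measurable

lemma integral_W: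
  fixes F :: "complex \<Rightarrow> 'b::{banach, second_countable_topology}"
  assumes [measurable]: "F \<in> borel_measurable borel"
  shows "(\<integral>w. (cmod (E v w))\<^sup>2 *\<^sub>R F w \<partial>\<mu>) = (\<integral>w. F (w + v) \<partial>\<mu>)"
    and "integrable \<mu> (\<lambda>w. (cmod (E v w))\<^sup>2 *\<^sub>R F w) \<longleftrightarrow> integrable \<mu> (\<lambda>w. F (w + v))"
proof -
  have "(\<integral>w. (cmod (E v w))\<^sup>2 *\<^sub>R F w \<partial>\<mu>) = (\<integral>w. F w \<partial>density \<mu> (\<lambda>w. ennreal ((cmod (E v w))\<^sup>2)))"
    by (subst integral_density) auto
  also have "\<dots> = (\<integral>w. F (w + v) \<partial>\<mu>)"
    unfolding gauss_shift by (subst integral_distr) auto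
  finally show "(\<integral>w. (cmod (E v w))\<^sup>2 *\<^sub>R F w \<partial>\<mu>) = (\<integral>w. F (w + v) \<partial>\<mu>)" .
  have "integrable \<mu> (\<lambda>w. (cmod (E v w))\<^sup>2 *\<^sub>R F w) \<longleftrightarrow> integrable (density \<mu> (\<lambda>w. ennreal ((cmod (E v w))\<^sup>2))) F"
    by (subst integrable_density) auto
  also have "\<dots> \<longleftrightarrow> integrable \<mu> (\<lambda>w. F (w + v))"
    unfolding gauss_shift by (subst integrable_distr_eq) auto
  finally show "integrable \<mu> (\<lambda>w. (cmod (E v w))\<^sup>2 *\<^sub>R F w) \<longleftrightarrow> integrable \<mu> (\<lambda>w. F (w + v))" .
qed

lemma W_L2:
  assumes f: "f \<in> L2 t"
  shows "W v f \<in> L2 t" "L2_norm t (W v f) = L2_norm t f"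
proof -
  have [measurable]: "f \<in> borel_measurable borel" using f by (simp add: L2_iff)
  have eq: "(cmod (W v f w))\<^sup>2 = (cmod (E v w))\<^sup>2 *\<^sub>R (cmod (f (w - v)))\<^sup>2" for w
    by (simp add: W_def norm_mult power_mult_distrib)
  show "W v f \<in> L2 t"
    unfolding L2_iff eq using f by (subst integral_W(2)) (auto simp: L2_iff)
  show "L2_norm t (W v f) = L2_norm t f"
    unfolding L2_norm_def eq by (subst integral_W(1)) auto
qed

lemma W_fock:
  assumes f: "f \<in> fock t"
  shows "W v f \<in> fock t"
  unfolding fock_def W_def[abs_def] using W_L2(1)[OF fock_L2[OF f], of v] fock_hol[OF f]
  by (auto simp: E_def W_def[abs_def] intro!: holomorphic_intros holomorphic_on_compose_gen[of "\<lambda>w. w - v" UNIV f UNIV, unfolded o_def])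

text \<open>The exponents of the two multipliers add up to the one for \<open>v + v'\<close> except
  for half of \<open>v * cnj v' - cnj (v * cnj v')\<close>, divided by \<open>- t\<close>. This is
  purely imaginary and is the phase.\<close>

lemma W_W: "W v (W v' g) w = exp (- \<i> * of_real (sigma t v v')) * W (v + v') g w"
proof -
  have a: "E v w * E v' (w - v) = exp (- \<i> * of_real (sigma t v v')) * E (v + v') w"
  proof -
    have "(cmod (v + v'))\<^sup>2 = (cmod v)\<^sup>2 + 2 * Re (v * cnj v') + (cmod v')\<^sup>2"
      using cmod_diff_sq[of v "-v'"] by simp
    then have n: "complex_of_real ((cmod (v + v'))\<^sup>2) = (cmod v)\<^sup>2 + (v * cnj v' + cnj (v * cnj v')) + (cmod v')\<^sup>2"
      unfolding complex_add_cnj by (simp only: of_real_add)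
    have aux: "A / T + B / T = - Y + Z / T" if "T \<noteq> 0" "(A + B) * 2 = - (Y * 2 * T) + Z * 2" for A B T Y Z :: complex
    proof -
      have "(A + B) * 2 = (Z - Y * T) * 2" using that(2) by (simp add: algebra_simps)
      then have "A + B = Z - Y * T" unfolding mult_cancel_right by simp
      then show ?thesis using that(1) by (simp add: add_divide_distrib[symmetric] diff_divide_distrib)
    qed
    have s: "\<i> * of_real (sigma t v v') * 2 * t = v * cnj v' - cnj (v * cnj v')"
      unfolding complex_diff_cnj sigma_def using t_pos by simp
    have "((w * cnj v - (cmod v)\<^sup>2 / 2) + ((w - v) * cnj v' - (cmod v')\<^sup>2 / 2)) * 2 =
       - (\<i> * of_real (sigma t v v') * 2 * t) + (w * cnj (v + v') - (cmod (v + v'))\<^sup>2 / 2) * 2"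
      unfolding s using n by (simp add: algebra_simps)
    then have "(w * cnj v - (cmod v)\<^sup>2 / 2) / t + ((w - v) * cnj v' - (cmod v')\<^sup>2 / 2) / t =
       - (\<i> * of_real (sigma t v v')) + (w * cnj (v + v') - (cmod (v + v'))\<^sup>2 / 2) / t"
      using t_pos by (intro aux) auto
    then show ?thesis unfolding E_def exp_add[symmetric] by simp
  qed
  have "W v (W v' g) w = (E v w * E v' (w - v)) * g (w - v - v')"
    by (simp add: W_def)
  then show ?thesis unfolding a by (simp add: W_def algebra_simps)
qed

lemma W_zero [simp]: "W 0 g = g"
  by (simp add: W_def E_def fun_eq_iff)

text \<open>Uniform in \<open>v\<close> because \<open>W v\<close> is isometric; this is the
  majorant for all integrals over \<open>v\<close> at a fixed point \<open>w\<close>.\<close>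

lemma W_bound:
  assumes "g \<in> fock t"
  shows "cmod (W v g w) \<le> L2_norm t g * exp ((cmod w)\<^sup>2 / (2 * t))"
  using fock_bound[OF W_fock[OF assms], of v w] by (simp add: W_L2 fock_L2[OF assms])

end

section \<open>Bounded operators and integrals of Weyl operators\<close>

lemma BUC_closed_limit:
  assumes "BUC_closed_subspace D" "\<And>n. F n \<in> D" "uniform_limit UNIV F f sequentially"
  shows "f \<in> D"
proof -
  have "\<forall>F f. (\<forall>n. F n \<in> D) \<and> uniform_limit UNIV F f sequentially \<longrightarrow> f \<in> D"
    using assms(1) by (simp add: BUC_closed_subspace_def)
  from this[rule_format, of F f] show ?thesis using assms(2,3) by simp
qed

context bargmann
begin

section \<open>Bounded operators, operator norm and norm closure\<close>

lemma bounded_opsD: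
  assumes "A \<in> bounded_ops t"
  shows "f \<in> fock t \<Longrightarrow> A f \<in> fock t"
    and "f \<in> fock t \<Longrightarrow> g \<in> fock t \<Longrightarrow> A (\<lambda>w. f w + g w) = (\<lambda>w. A f w + A g w)"
    and "f \<in> fock t \<Longrightarrow> A (\<lambda>w. c * f w) = (\<lambda>w. c * A f w)"
    and "f \<notin> fock t \<Longrightarrow> A f = (\<lambda>w. 0)"
  using assms by (simp_all add: bounded_ops_def)

lemma bounded_ops_bound:
  assumes "A \<in> bounded_ops t"
  obtains K where "K \<ge> 0" "\<And>f. f \<in> fock t \<Longrightarrow> L2_norm t (A f) \<le> K * L2_norm t f"
proof -
  have "\<exists>K. \<forall>f\<in>fock t. L2_norm t (A f) \<le> K * L2_norm t f"
    using assms by (simp add: bounded_ops_def)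
  then obtain K where K: "\<And>f. f \<in> fock t \<Longrightarrow> L2_norm t (A f) \<le> K * L2_norm t f" by blast
  have "L2_norm t (A f) \<le> \<bar>K\<bar> * L2_norm t f" if "f \<in> fock t" for f
    using K[OF that] mult_right_mono[OF abs_ge_self[of K] L2_norm_nonneg[of f]] by linarith
  then show ?thesis using that[of "\<bar>K\<bar>"] by simp
qed

lemma bounded_opsI:
  assumes "\<And>f. f \<in> fock t \<Longrightarrow> A f \<in> fock t"
    and "\<And>f g. f \<in> fock t \<Longrightarrow> g \<in> fock t \<Longrightarrow> A (\<lambda>w. f w + g w) = (\<lambda>w. A f w + A g w)"
    and "\<And>f c. f \<in> fock t \<Longrightarrow> A (\<lambda>w. c * f w) = (\<lambda>w. c * A f w)"
    and "\<And>f. f \<in> fock t \<Longrightarrow> L2_norm t (A f) \<le> K * L2_norm t f"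
    and "\<And>f. f \<notin> fock t \<Longrightarrow> A f = (\<lambda>w. 0)"
  shows "A \<in> bounded_ops t"
  unfolding bounded_ops_def by (intro CollectI conjI ballI allI impI exI[of _ K] assms)

lemma bounded_ops_zero: "(\<lambda>g w. 0) \<in> bounded_ops t"
  by (rule bounded_opsI[where K=0]) auto

lemma bounded_ops_add:
  assumes A: "A \<in> bounded_ops t" and B: "B \<in> bounded_ops t"
  shows "(\<lambda>g w. A g w + B g w) \<in> bounded_ops t"
proof -
  obtain K where K: "\<And>f. f \<in> fock t \<Longrightarrow> L2_norm t (A f) \<le> K * L2_norm t f"
    using bounded_ops_bound[OF A] by blast
  obtain L where L: "\<And>f. f \<in> fock t \<Longrightarrow> L2_norm t (B f) \<le> L * L2_norm t f"
    using bounded_ops_bound[OF B] by blast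
  show ?thesis
  proof (rule bounded_opsI[where K="K + L"])
    fix f assume f: "f \<in> fock t"
    show "(\<lambda>w. A f w + B f w) \<in> fock t"
      by (intro fock_add bounded_opsD(1)[OF A] bounded_opsD(1)[OF B] f)
    show "(\<lambda>w. A (\<lambda>w. c * f w) w + B (\<lambda>w. c * f w) w) = (\<lambda>w. c * (A f w + B f w))" for c
      using f by (simp add: bounded_opsD(3)[OF A] bounded_opsD(3)[OF B] distrib_left)
    have "L2_norm t (\<lambda>w. A f w + B f w) \<le> L2_norm t (A f) + L2_norm t (B f)"
      by (intro L2_norm_triangle fock_L2 bounded_opsD(1)[OF A] bounded_opsD(1)[OF B] f)
    then show "L2_norm t (\<lambda>w. A f w + B f w) \<le> (K + L) * L2_norm t f"
      using K[OF f] L[OF f] by (simp add: distrib_right)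
    fix g assume g: "g \<in> fock t"
    show "(\<lambda>w. A (\<lambda>w. f w + g w) w + B (\<lambda>w. f w + g w) w) = (\<lambda>w. A f w + B f w + (A g w + B g w))"
      using f g by (simp add: bounded_opsD(2)[OF A] bounded_opsD(2)[OF B] add_ac)
  qed (simp add: bounded_opsD(4)[OF A] bounded_opsD(4)[OF B])
qed

lemma bounded_ops_cmult:
  assumes A: "A \<in> bounded_ops t"
  shows "(\<lambda>g w. c * A g w) \<in> bounded_ops t"
proof -
  obtain K where K: "\<And>f. f \<in> fock t \<Longrightarrow> L2_norm t (A f) \<le> K * L2_norm t f"
    using bounded_ops_bound[OF A] by blast
  show ?thesis
  proof (rule bounded_opsI[where K="cmod c * K"])
    fix f assume f: "f \<in> fock t"
    show "(\<lambda>w. c * A f w) \<in> fock t"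
      by (intro fock_cmult bounded_opsD(1)[OF A] f)
    show "(\<lambda>w. c * A (\<lambda>w. d * f w) w) = (\<lambda>w. d * (c * A f w))" for d
      using f by (simp add: bounded_opsD(3)[OF A] mult_ac)
    show "L2_norm t (\<lambda>w. c * A f w) \<le> (cmod c * K) * L2_norm t f"
      using K[OF f] by (simp add: L2_norm_cmult mult.assoc mult_left_mono)
    fix g assume g: "g \<in> fock t"
    show "(\<lambda>w. c * A (\<lambda>w. f w + g w) w) = (\<lambda>w. c * A f w + c * A g w)"
      using f g by (simp add: bounded_opsD(2)[OF A] distrib_left)
  qed (simp add: bounded_opsD(4)[OF A])
qed

lemma bounded_ops_diff:
  assumes A: "A \<in> bounded_ops t" and B: "B \<in> bounded_ops t"
  shows "(\<lambda>g w. A g w - B g w) \<in> bounded_ops t"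
  using bounded_ops_add[OF A bounded_ops_cmult[OF B, of "-1"]] by simp

lemma bounded_ops_zero_arg: "A \<in> bounded_ops t \<Longrightarrow> A (\<lambda>w. 0) = (\<lambda>w. 0)"
  using bounded_opsD(3)[of A "\<lambda>w. 0" 0] by simp

lemma bounded_ops_comp:
  assumes A: "A \<in> bounded_ops t" and B: "B \<in> bounded_ops t"
  shows "A \<circ> B \<in> bounded_ops t"
proof -
  obtain K where K: "K \<ge> 0" "\<And>f. f \<in> fock t \<Longrightarrow> L2_norm t (A f) \<le> K * L2_norm t f"
    using bounded_ops_bound[OF A] by blast
  obtain L where L: "\<And>f. f \<in> fock t \<Longrightarrow> L2_norm t (B f) \<le> L * L2_norm t f"
    using bounded_ops_bound[OF B] by blast
  show ?thesis
  proof (rule bounded_opsI[where K="K * L"])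
    fix f assume f: "f \<in> fock t"
    show "(A \<circ> B) f \<in> fock t"
      using f by (simp add: bounded_opsD(1)[OF A] bounded_opsD(1)[OF B])
    show "(A \<circ> B) (\<lambda>w. d * f w) = (\<lambda>w. d * (A \<circ> B) f w)" for d
      using f by (simp add: bounded_opsD(3)[OF A] bounded_opsD(3)[OF B] bounded_opsD(1)[OF B])
    have "L2_norm t ((A \<circ> B) f) \<le> K * L2_norm t (B f)"
      using K(2)[OF bounded_opsD(1)[OF B f]] by simp
    also have "\<dots> \<le> K * (L * L2_norm t f)"
      using K(1) L[OF f] by (rule mult_left_mono[rotated])
    finally show "L2_norm t ((A \<circ> B) f) \<le> (K * L) * L2_norm t f"
      by (simp add: mult.assoc)
    fix g assume g: "g \<in> fock t"
    show "(A \<circ> B) (\<lambda>w. f w + g w) = (\<lambda>w. (A \<circ> B) f w + (A \<circ> B) g w)"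
      using f g by (simp add: bounded_opsD(2)[OF A] bounded_opsD(2)[OF B] bounded_opsD(1)[OF B])
  qed (simp add: bounded_opsD(4)[OF B] bounded_ops_zero_arg[OF A])
qed

lemma bounded_ops_diff_arg:
  assumes A: "A \<in> bounded_ops t" "f \<in> fock t" "g \<in> fock t"
  shows "A (\<lambda>w. f w - g w) = (\<lambda>w. A f w - A g w)"
  using bounded_opsD(2)[OF A(1,2) fock_cmult[OF A(3), of "-1"]] bounded_opsD(3)[OF A(1,3), of "-1"] by simp

lemma op_norm_le:
  assumes "K \<ge> 0" "\<And>g. g \<in> fock t \<Longrightarrow> L2_norm t (A g) \<le> K * L2_norm t g"
  shows "op_norm t A \<le> K"
  unfolding op_norm_def
proof (rule cSUP_least)
  show "{g \<in> fock t. L2_norm t g \<le> 1} \<noteq> {}"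
    using fock_zero by (auto intro!: exI[of _ "\<lambda>z. 0"])
  show "L2_norm t (A g) \<le> K" if "g \<in> {g \<in> fock t. L2_norm t g \<le> 1}" for g
    using assms(2)[of g] that mult_left_mono[of "L2_norm t g" 1 K] assms(1) by auto
qed

text \<open>\<open>op_norm\<close> is a supremum of reals and says something only when the set is
  bounded above, which membership in \<open>bounded_ops\<close> provides. Norm zero is treated apart
  because the proof normalizes \<open>g\<close>.\<close>

lemma op_norm_bound:
  assumes A: "A \<in> bounded_ops t" and g: "g \<in> fock t"
  shows "L2_norm t (A g) \<le> op_norm t A * L2_norm t g"
proof (cases "L2_norm t g = 0")
  case True
  then show ?thesis
    using fock_norm_zero[OF g True] bounded_ops_zero_arg[OF A] by simp
next
  case False
  then have pos: "L2_norm t g > 0" by (simp add: less_le)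
  obtain K where K: "K \<ge> 0" "\<And>f. f \<in> fock t \<Longrightarrow> L2_norm t (A f) \<le> K * L2_norm t f"
    using bounded_ops_bound[OF A] by blast
  define c where "c = complex_of_real (1 / L2_norm t g)"
  have bdd: "bdd_above ((\<lambda>g. L2_norm t (A g)) ` {g \<in> fock t. L2_norm t g \<le> 1})"
  proof (rule bdd_aboveI2[where M=K])
    show "L2_norm t (A g) \<le> K" if "g \<in> {g \<in> fock t. L2_norm t g \<le> 1}" for g
      using K(2)[of g] that mult_left_mono[of "L2_norm t g" 1 K] K(1) by auto
  qed
  have c: "cmod c = 1 / L2_norm t g" by (simp add: c_def norm_divide)
  have "(\<lambda>w. c * g w) \<in> {g \<in> fock t. L2_norm t g \<le> 1}"
    using fock_cmult[OF g, of c] pos by (simp add: L2_norm_cmult c)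
  then have "L2_norm t (A (\<lambda>w. c * g w)) \<le> op_norm t A"
    unfolding op_norm_def by (rule cSUP_upper[OF _ bdd])
  then show ?thesis
    using pos by (simp add: bounded_opsD(3)[OF A g] L2_norm_cmult c divide_le_eq)
qed

text \<open>Phrased with a bound on vectors so that later approximation proofs never touch
  \<open>op_norm\<close>; halving \<open>e\<close> produces the strict inequality.\<close>

lemma op_closureI:
  assumes "A \<in> bounded_ops t"
    and "\<And>e. e > 0 \<Longrightarrow> \<exists>B\<in>S. \<forall>g\<in>fock t. L2_norm t (\<lambda>w. A g w - B g w) \<le> e * L2_norm t g"
  shows "A \<in> op_closure t S"
  unfolding op_closure_def
proof safe
  fix e :: real assume e: "e > 0"
  then obtain B where B: "B \<in> S" "\<forall>g\<in>fock t. L2_norm t (\<lambda>w. A g w - B g w) \<le> e / 2 * L2_norm t g"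
    using assms(2)[of "e/2"] by auto
  have "op_norm t (\<lambda>g w. A g w - B g w) \<le> e / 2"
    using e B by (intro op_norm_le) auto
  then show "\<exists>B\<in>S. op_norm t (\<lambda>g w. A g w - B g w) < e" using e B by (intro bexI[of _ B]) auto
qed (use assms in auto)

lemma op_closure_bounded: "op_closure t S \<subseteq> bounded_ops t"
  by (auto simp: op_closure_def)

lemma op_closure_mono: "S \<subseteq> S' \<Longrightarrow> op_closure t S \<subseteq> op_closure t S'"
  unfolding op_closure_def by blast

lemma op_closureE:
  assumes "A \<in> op_closure t S" "S \<subseteq> bounded_ops t" "e > 0"
  obtains B where "B \<in> S" "B \<in> bounded_ops t" "\<And>g. g \<in> fock t \<Longrightarrow> L2_norm t (\<lambda>w. A g w - B g w) \<le> e * L2_norm t g"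
proof -
  obtain B where B: "B \<in> S" "op_norm t (\<lambda>g w. A g w - B g w) < e"
    using assms unfolding op_closure_def by blast
  have "L2_norm t (\<lambda>w. A g w - B g w) \<le> e * L2_norm t g" if "g \<in> fock t" for g
  proof -
    have "L2_norm t (\<lambda>w. A g w - B g w) \<le> op_norm t (\<lambda>g w. A g w - B g w) * L2_norm t g"
      using assms B by (intro op_norm_bound[OF _ that] bounded_ops_diff) (auto simp: op_closure_def)
    also have "\<dots> \<le> e * L2_norm t g" using B by (intro mult_right_mono) auto
    finally show ?thesis .
  qed
  then show ?thesis using B assms that[of B] by auto
qed

lemma L2_norm_triangle_diff:
  assumes "f \<in> fock t" "g \<in> fock t" "h \<in> fock t"
  shows "L2_norm t (\<lambda>z. f z - h z) \<le> L2_norm t (\<lambda>z. f z - g z) + L2_norm t (\<lambda>z. g z - h z)"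
  using L2_norm_triangle[of "\<lambda>z. f z - g z" "\<lambda>z. g z - h z"] assms
  by (simp add: fock_L2 L2_diff)

lemma op_closure_closed:
  assumes "S \<subseteq> bounded_ops t"
  shows "op_closure t (op_closure t S) \<subseteq> op_closure t S"
proof
  fix A assume A: "A \<in> op_closure t (op_closure t S)"
  show "A \<in> op_closure t S"
  proof (rule op_closureI)
    show Ab: "A \<in> bounded_ops t" using A by (simp add: op_closure_def)
    fix e :: real assume "e > 0"
    then have e: "e / 2 > 0" by simp
    obtain B where B: "B \<in> op_closure t S" "B \<in> bounded_ops t" "\<And>g. g \<in> fock t \<Longrightarrow> L2_norm t (\<lambda>w. A g w - B g w) \<le> e/2 * L2_norm t g"
      using op_closureE[OF A op_closure_bounded e] by blast
    obtain C where C: "C \<in> S" "C \<in> bounded_ops t" "\<And>g. g \<in> fock t \<Longrightarrow> L2_norm t (\<lambda>w. B g w - C g w) \<le> e/2 * L2_norm t g"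
      using op_closureE[OF B(1) assms e] by blast
    have "L2_norm t (\<lambda>w. A g w - C g w) \<le> e * L2_norm t g" if g: "g \<in> fock t" for g
      using L2_norm_triangle_diff[OF bounded_opsD(1)[OF Ab g] bounded_opsD(1)[OF B(2) g] bounded_opsD(1)[OF C(2) g]]
        B(3)[OF g] C(3)[OF g] by simp
    then show "\<exists>C\<in>S. \<forall>g\<in>fock t. L2_norm t (\<lambda>w. A g w - C g w) \<le> e * L2_norm t g"
      using C by blast
  qed
qed

text \<open>The squared norm of \<open>B g\<close> is the modulus of the inner product of
  \<open>A (B g)\<close> with \<open>g\<close>; after Cauchy-Schwarz one factor cancels.
  \<open>A\<close> and \<open>B\<close> are plain functions so that differences of operators can be
  inserted.\<close>

lemma adjoint_norm_le:
  assumes adj: "\<And>f g. f \<in> fock t \<Longrightarrow> g \<in> fock t \<Longrightarrow> L2_inner t (A f) g = L2_inner t f (B g)"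
    and A: "\<And>f. f \<in> fock t \<Longrightarrow> A f \<in> fock t" "\<And>g. g \<in> fock t \<Longrightarrow> L2_norm t (A g) \<le> K * L2_norm t g" and K: "K \<ge> 0"
    and B: "\<And>f. f \<in> fock t \<Longrightarrow> B f \<in> fock t" and g: "g \<in> fock t"
  shows "L2_norm t (B g) \<le> K * L2_norm t g"
proof -
  have "(L2_norm t (B g))\<^sup>2 = cmod (L2_inner t (B g) (B g))"
    unfolding L2_inner_self by (simp only: norm_of_real) simp
  also have "\<dots> = cmod (L2_inner t (A (B g)) g)"
    using adj[OF B[OF g] g] by simp
  also have "\<dots> \<le> L2_norm t (A (B g)) * L2_norm t g"
    using A B g by (intro L2_Cauchy_Schwarz fock_L2) auto
  also have "\<dots> \<le> (K * L2_norm t (B g)) * L2_norm t g"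
    using A B g by (intro mult_right_mono) auto
  finally have "L2_norm t (B g) * L2_norm t (B g) \<le> (K * L2_norm t g) * L2_norm t (B g)"
    by (simp add: power2_eq_square mult_ac)
  then show ?thesis
    using K by (cases "L2_norm t (B g) = 0") (auto simp: mult_le_cancel_right less_le)
qed

text \<open>The density lives on a parameter space and \<open>V\<close> places the parameters in the
  plane. A ray is a null set of the plane, and two collinear rays span only a line, so densities on
  the plane itself would not describe these integrals.\<close>

definition Wint :: "'a measure \<Rightarrow> ('a \<Rightarrow> complex) \<Rightarrow> ('a \<Rightarrow> complex) \<Rightarrow> fock_op" where
  "Wint M \<phi> V g = (if g \<in> fock t then (\<lambda>w. \<integral>x. \<phi> x * W (V x) g w \<partial>M) else (\<lambda>w. 0))"

definition FTint :: "'a measure \<Rightarrow> ('a \<Rightarrow> complex) \<Rightarrow> ('a \<Rightarrow> complex) \<Rightarrow> complex \<Rightarrow> complex" where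
  "FTint M \<phi> V w = (\<integral>x. \<phi> x * exp (2 * \<i> * of_real (sigma t w (V x))) \<partial>M)"

lemma sigma_measurable [measurable (raw)]:
  assumes [measurable]: "a \<in> borel_measurable M" "b \<in> borel_measurable M"
  shows "(\<lambda>x. sigma t (a x) (b x)) \<in> borel_measurable M"
  unfolding sigma_def by measurable

lemma Wint_integrable:
  assumes [measurable]: "V \<in> borel_measurable M" and \<phi>: "integrable M \<phi>" and g: "g \<in> fock t"
  shows "integrable M (\<lambda>x. \<phi> x * W (V x) g w)"
proof -
  have [measurable]: "\<phi> \<in> borel_measurable M" "g \<in> borel_measurable borel"
    using \<phi> g by (auto intro: fock_measurable)
  let ?C = "L2_norm t g * exp ((cmod w)\<^sup>2 / (2 * t))"
  show ?thesis
  proof (rule Bochner_Integration.integrable_bound)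
    show "integrable M (\<lambda>x. ?C * cmod (\<phi> x))" using \<phi> by auto
    show "AE x in M. norm (\<phi> x * W (V x) g w) \<le> norm (?C * cmod (\<phi> x))"
      using mult_left_mono[OF W_bound[OF g, of _ w] norm_ge_zero[of "\<phi> _"]]
      by (intro AE_I2) (simp add: norm_mult abs_mult mult_ac)
  qed measurable
qed

text \<open>Minkowski's inequality, obtained from Cauchy-Schwarz with weight
  \<open>cmod (\<phi> x)\<close> and Tonelli; since the Weyl operators are isometric, the integral
  over \<open>w\<close> does not depend on \<open>x\<close> apart from this weight.\<close>

lemma Wint_L2:
  assumes "finite_measure M" and [measurable]: "V \<in> borel_measurable M" and \<phi>: "integrable M \<phi>" and g: "g \<in> fock t"
  shows "Wint M \<phi> V g \<in> L2 t" "L2_norm t (Wint M \<phi> V g) \<le> (\<integral>x. cmod (\<phi> x) \<partial>M) * L2_norm t g"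
proof -
  interpret M: finite_measure M by fact
  interpret MM: pair_sigma_finite M \<mu> ..
  have [measurable]: "\<phi> \<in> borel_measurable M" "g \<in> borel_measurable borel"
    using \<phi> g by (auto intro: fock_measurable)
  have eq: "Wint M \<phi> V g = (\<lambda>w. \<integral>x. \<phi> x * W (V x) g w \<partial>M)" using g by (simp add: Wint_def)
  have meas: "Wint M \<phi> V g \<in> borel_measurable borel"
    unfolding eq by measurable
  let ?I = "\<integral>x. cmod (\<phi> x) \<partial>M"
  have nI: "(\<integral>\<^sup>+x. ennreal (cmod (\<phi> x)) \<partial>M) = ennreal ?I"
    using \<phi> by (intro nn_integral_eq_integral) auto
  have "(\<integral>\<^sup>+w. ennreal (cmod (Wint M \<phi> V g w)) ^ 2 \<partial>\<mu>)
     \<le> (\<integral>\<^sup>+w. ennreal ?I * (\<integral>\<^sup>+x. ennreal (cmod (\<phi> x)) * ennreal (cmod (W (V x) g w)) ^ 2 \<partial>M) \<partial>\<mu>)"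
  proof (rule nn_integral_mono)
    fix w
    have "ennreal (cmod (Wint M \<phi> V g w)) \<le> (\<integral>\<^sup>+x. ennreal (cmod (\<phi> x)) * ennreal (cmod (W (V x) g w)) \<partial>M)"
      using norm_integral_le_nn[of M "\<lambda>x. \<phi> x * W (V x) g w"] by (simp add: eq norm_mult ennreal_mult)
    then have "ennreal (cmod (Wint M \<phi> V g w)) ^ 2 \<le> (\<integral>\<^sup>+x. ennreal (cmod (\<phi> x)) * ennreal (cmod (W (V x) g w)) \<partial>M) ^ 2"
      by (intro power_mono) auto
    also have "\<dots> \<le> (\<integral>\<^sup>+x. ennreal (cmod (\<phi> x)) \<partial>M) * (\<integral>\<^sup>+x. ennreal (cmod (\<phi> x)) * ennreal (cmod (W (V x) g w)) ^ 2 \<partial>M)"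
      by (rule nn_integral_weighted_square) measurable
    finally show "ennreal (cmod (Wint M \<phi> V g w)) ^ 2 \<le> ennreal ?I * (\<integral>\<^sup>+x. ennreal (cmod (\<phi> x)) * ennreal (cmod (W (V x) g w)) ^ 2 \<partial>M)"
      unfolding nI .
  qed
  also have "\<dots> = ennreal ?I * (\<integral>\<^sup>+w. (\<integral>\<^sup>+x. ennreal (cmod (\<phi> x)) * ennreal (cmod (W (V x) g w)) ^ 2 \<partial>M) \<partial>\<mu>)"
    by (rule nn_integral_cmult) measurable
  also have "(\<integral>\<^sup>+w. (\<integral>\<^sup>+x. ennreal (cmod (\<phi> x)) * ennreal (cmod (W (V x) g w)) ^ 2 \<partial>M) \<partial>\<mu>)
     = (\<integral>\<^sup>+x. (\<integral>\<^sup>+w. ennreal (cmod (\<phi> x)) * ennreal (cmod (W (V x) g w)) ^ 2 \<partial>\<mu>) \<partial>M)"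
    by (rule MM.Fubini') measurable
  also have "\<dots> = (\<integral>\<^sup>+x. ennreal (cmod (\<phi> x)) * ennreal ((L2_norm t g)\<^sup>2) \<partial>M)"
    using W_L2[OF fock_L2[OF g]] by (simp add: nn_integral_cmult L2_nn_norm)
  also have "\<dots> = ennreal ?I * ennreal ((L2_norm t g)\<^sup>2)"
    by (simp add: nn_integral_multc nI)
  also have "ennreal ?I * (ennreal ?I * ennreal ((L2_norm t g)\<^sup>2)) = ennreal ((?I * L2_norm t g)\<^sup>2)"
    by (simp add: ennreal_mult[symmetric] power_mult_distrib power2_eq_square mult_ac)
  finally have *: "(\<integral>\<^sup>+w. ennreal (cmod (Wint M \<phi> V g w)) ^ 2 \<partial>\<mu>) \<le> ennreal ((?I * L2_norm t g)\<^sup>2)" .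
  show "Wint M \<phi> V g \<in> L2 t" "L2_norm t (Wint M \<phi> V g) \<le> ?I * L2_norm t g"
    using L2_norm_le_nn[OF meas *] by auto
qed

lemma Wint_inner:
  assumes "finite_measure M" and [measurable]: "V \<in> borel_measurable M" and \<phi>: "integrable M \<phi>" and g: "g \<in> fock t" and h: "h \<in> L2 t"
  shows "L2_inner t (Wint M \<phi> V g) h = (\<integral>x. \<phi> x * L2_inner t (W (V x) g) h \<partial>M)"
proof -
  interpret M: finite_measure M by fact
  interpret MM: pair_sigma_finite M \<mu> ..
  have [measurable]: "\<phi> \<in> borel_measurable M" "g \<in> borel_measurable borel" "h \<in> borel_measurable borel"
    using \<phi> g h by (auto intro: fock_measurable simp: L2_iff)
  let ?F = "\<lambda>x w. \<phi> x * (W (V x) g w * cnj (h w))"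
  have int: "integrable (M \<Otimes>\<^sub>M \<mu>) (\<lambda>(x, w). ?F x w)"
  proof (rule integrableI_bounded)
    show "(\<lambda>(x, w). ?F x w) \<in> borel_measurable (M \<Otimes>\<^sub>M \<mu>)" by measurable
    let ?H = "\<lambda>p. ennreal (norm (case p of (x, w) \<Rightarrow> ?F x w))"
    have "(\<integral>\<^sup>+p. ?H p \<partial>(M \<Otimes>\<^sub>M \<mu>)) = (\<integral>\<^sup>+x. \<integral>\<^sup>+w. ?H (x, w) \<partial>\<mu> \<partial>M)"
      by (subst nn_integral_fst) auto
    also have "\<dots> = (\<integral>\<^sup>+x. ennreal (cmod (\<phi> x)) * (\<integral>\<^sup>+w. ennreal (cmod (W (V x) g w)) * ennreal (cmod (h w)) \<partial>\<mu>) \<partial>M)"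
      by (simp add: norm_mult ennreal_mult nn_integral_cmult)
    also have "\<dots> \<le> (\<integral>\<^sup>+x. ennreal (cmod (\<phi> x)) * ennreal (L2_norm t g * L2_norm t h) \<partial>M)"
      using L2_nn_Cauchy_Schwarz[OF W_L2(1)[OF fock_L2[OF g]] h] W_L2(2)[OF fock_L2[OF g]]
      by (intro nn_integral_mono mult_left_mono) auto
    also have "\<dots> < \<infinity>"
      using \<phi> by (simp add: nn_integral_multc integrable_iff_bounded ennreal_mult_less_top)
    finally show "(\<integral>\<^sup>+p. ?H p \<partial>(M \<Otimes>\<^sub>M \<mu>)) < \<infinity>" .
  qed
  have "L2_inner t (Wint M \<phi> V g) h = (\<integral>w. (\<integral>x. ?F x w \<partial>M) \<partial>\<mu>)"
    using g unfolding L2_inner_def Wint_def by (simp add: mult.assoc[symmetric])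
  also have "\<dots> = (\<integral>x. (\<integral>w. ?F x w \<partial>\<mu>) \<partial>M)"
    by (rule MM.Fubini_integral[OF int])
  finally show ?thesis by (simp add: L2_inner_def)
qed

text \<open>Holomorphy without differentiating: the pairing with \<open>ker w\<close> passes under
  the integral and returns the value at \<open>w\<close>, so the function equals its own
  projection.\<close>

lemma Wint_fock:
  assumes "finite_measure M" and [measurable]: "V \<in> borel_measurable M" and \<phi>: "integrable M \<phi>" and g: "g \<in> fock t"
  shows "Wint M \<phi> V g \<in> fock t"
proof -
  have "Wint M \<phi> V g = P (Wint M \<phi> V g)"
  proof
    fix w
    have "P (Wint M \<phi> V g) w = (\<integral>x. \<phi> x * L2_inner t (W (V x) g) (ker w) \<partial>M)"
      unfolding P_inner_ker by (rule Wint_inner[OF assms fock_L2[OF ker_fock]])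
    also have "\<dots> = Wint M \<phi> V g w"
      using g by (simp add: fock_inner_ker[OF W_fock[OF g]] Wint_def)
    finally show "Wint M \<phi> V g w = P (Wint M \<phi> V g) w" ..
  qed
  moreover have "P (Wint M \<phi> V g) \<in> fock t"
    by (rule P_fock[OF Wint_L2(1)[OF assms]])
  ultimately show ?thesis by simp
qed

lemma Wint_bounded_ops:
  assumes "finite_measure M" and V: "V \<in> borel_measurable M" and \<phi>: "integrable M \<phi>"
  shows "Wint M \<phi> V \<in> bounded_ops t"
proof (rule bounded_opsI[where K="\<integral>x. cmod (\<phi> x) \<partial>M"])
  fix f assume f: "f \<in> fock t"
  show "Wint M \<phi> V f \<in> fock t" "L2_norm t (Wint M \<phi> V f) \<le> (\<integral>x. cmod (\<phi> x) \<partial>M) * L2_norm t f"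
    using Wint_fock[OF assms f] Wint_L2[OF assms f] by auto
  show "Wint M \<phi> V (\<lambda>w. c * f w) = (\<lambda>w. c * Wint M \<phi> V f w)" for c
  proof -
    have "\<phi> x * W (V x) (\<lambda>w. c * f w) w = c * (\<phi> x * W (V x) f w)" for x w
      by (simp add: W_def)
    then have "(\<integral>x. \<phi> x * W (V x) (\<lambda>w. c * f w) w \<partial>M) = (\<integral>x. c * (\<phi> x * W (V x) f w) \<partial>M)" for w
      by (simp only:)
    then show ?thesis using f by (simp add: Wint_def fock_cmult)
  qed
  fix g assume g: "g \<in> fock t"
  have "\<phi> x * W (V x) (\<lambda>w. f w + g w) w = \<phi> x * W (V x) f w + \<phi> x * W (V x) g w" for x w
    by (simp add: W_def algebra_simps)
  then show "Wint M \<phi> V (\<lambda>w. f w + g w) = (\<lambda>w. Wint M \<phi> V f w + Wint M \<phi> V g w)"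
    using f g by (simp add: Wint_def fock_add fun_eq_iff Wint_integrable[OF V \<phi>])
qed (simp add: Wint_def)

lemma Wint_add:
  assumes V: "V \<in> borel_measurable M" and \<phi>: "integrable M \<phi>" "integrable M \<psi>"
  shows "Wint M (\<lambda>x. \<phi> x + \<psi> x) V = (\<lambda>g w. Wint M \<phi> V g w + Wint M \<psi> V g w)"
  by (auto simp: Wint_def fun_eq_iff distrib_right Wint_integrable[OF V \<phi>(1)] Wint_integrable[OF V \<phi>(2)])

lemma Wint_cmult: "Wint M (\<lambda>x. c * \<phi> x) V = (\<lambda>g w. c * Wint M \<phi> V g w)"
  by (auto simp: Wint_def fun_eq_iff mult.assoc)

lemma Wint_diff:
  assumes V: "V \<in> borel_measurable M" and \<phi>: "integrable M \<phi>" "integrable M \<psi>"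
  shows "Wint M (\<lambda>x. \<phi> x - \<psi> x) V = (\<lambda>g w. Wint M \<phi> V g w - Wint M \<psi> V g w)"
  by (auto simp: Wint_def fun_eq_iff left_diff_distrib Wint_integrable[OF V \<phi>(1)] Wint_integrable[OF V \<phi>(2)])

lemma Wint_diff_norm:
  assumes "finite_measure M" and V: "V \<in> borel_measurable M" and \<phi>: "integrable M \<phi>" "integrable M \<psi>" and g: "g \<in> fock t"
  shows "L2_norm t (\<lambda>w. Wint M \<phi> V g w - Wint M \<psi> V g w) \<le> (\<integral>x. cmod (\<phi> x - \<psi> x) \<partial>M) * L2_norm t g"
  using Wint_L2(2)[OF assms(1) V _ g, of "\<lambda>x. \<phi> x - \<psi> x"] \<phi> by (simp add: Wint_diff[OF V \<phi>])

text \<open>The L1 norm of a density dominates the operator norm (\<open>Wint_diff_norm\<close>), so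
  L1 convergence of densities is norm convergence of operators. \<open>FTint_limit\<close> is the
  counterpart for the sup norm of symbols.\<close>

lemma Wint_limit:
  assumes "finite_measure M" and V: "V \<in> borel_measurable M" and "\<And>n. integrable M (s n)" "integrable M \<phi>"
    and S: "\<And>n. Wint M (s n) V \<in> S" "op_closure t S \<subseteq> S"
    and lim: "(\<lambda>n::nat. \<integral>x. cmod (s n x - \<phi> x) \<partial>M) \<longlonglongrightarrow> 0"
  shows "Wint M \<phi> V \<in> S"
proof -
  have "Wint M \<phi> V \<in> op_closure t S"
  proof (rule op_closureI[OF Wint_bounded_ops[OF assms(1,2,4)]])
    fix e :: real assume "e > 0"
    then obtain n where "(\<integral>x. cmod (s n x - \<phi> x) \<partial>M) < e"
      using eventually_happens'[OF sequentially_bot order_tendstoD(2)[OF lim \<open>e > 0\<close>]] by auto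
    then have e: "(\<integral>x. cmod (\<phi> x - s n x) \<partial>M) < e" by (simp add: norm_minus_commute)
    show "\<exists>B\<in>S. \<forall>g\<in>fock t. L2_norm t (\<lambda>w. Wint M \<phi> V g w - B g w) \<le> e * L2_norm t g"
    proof (intro bexI ballI)
      fix g assume g: "g \<in> fock t"
      have "L2_norm t (\<lambda>w. Wint M \<phi> V g w - Wint M (s n) V g w) \<le> (\<integral>x. cmod (\<phi> x - s n x) \<partial>M) * L2_norm t g"
        by (rule Wint_diff_norm[OF assms(1,2,4,3) g])
      also have "\<dots> \<le> e * L2_norm t g" using e by (intro mult_right_mono) auto
      finally show "L2_norm t (\<lambda>w. Wint M \<phi> V g w - Wint M (s n) V g w) \<le> e * L2_norm t g" .
    qed (rule S(1))
  qed
  then show ?thesis using S(2) by auto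
qed

lemma FTint_integrable:
  assumes [measurable]: "V \<in> borel_measurable M" and \<phi>: "integrable M \<phi>"
  shows "integrable M (\<lambda>x. \<phi> x * exp (2 * \<i> * of_real (sigma t w (V x))))"
proof -
  have [measurable]: "\<phi> \<in> borel_measurable M" using \<phi> by auto
  show ?thesis
    by (rule Bochner_Integration.integrable_bound[OF \<phi>]) (auto simp: norm_mult)
qed

lemma FTint_norm:
  assumes [measurable]: "V \<in> borel_measurable M" and \<phi>: "integrable M \<phi>"
  shows "cmod (FTint M \<phi> V w) \<le> (\<integral>x. cmod (\<phi> x) \<partial>M)"
proof -
  have "cmod (FTint M \<phi> V w) \<le> (\<integral>x. cmod (\<phi> x * exp (2 * \<i> * of_real (sigma t w (V x)))) \<partial>M)"
    unfolding FTint_def by (rule integral_norm_bound)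
  then show ?thesis by (simp add: norm_mult)
qed

lemma FTint_add:
  assumes V: "V \<in> borel_measurable M" and \<phi>: "integrable M \<phi>" "integrable M \<psi>"
  shows "FTint M (\<lambda>x. \<phi> x + \<psi> x) V = (\<lambda>w. FTint M \<phi> V w + FTint M \<psi> V w)"
  by (auto simp: FTint_def fun_eq_iff distrib_right FTint_integrable[OF V \<phi>(1)] FTint_integrable[OF V \<phi>(2)])

lemma FTint_cmult: "FTint M (\<lambda>x. c * \<phi> x) V = (\<lambda>w. c * FTint M \<phi> V w)"
  by (auto simp: FTint_def fun_eq_iff mult.assoc)

lemma FTint_diff:
  assumes V: "V \<in> borel_measurable M" and \<phi>: "integrable M \<phi>" "integrable M \<psi>"
  shows "FTint M (\<lambda>x. \<phi> x - \<psi> x) V = (\<lambda>w. FTint M \<phi> V w - FTint M \<psi> V w)"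
  by (auto simp: FTint_def fun_eq_iff left_diff_distrib FTint_integrable[OF V \<phi>(1)] FTint_integrable[OF V \<phi>(2)])

lemma FTint_limit:
  assumes V: "V \<in> borel_measurable M" and int: "\<And>n. integrable M (s n)" "integrable M \<phi>"
    and D: "\<And>n. FTint M (s n) V \<in> D" "BUC_closed_subspace D"
    and lim: "(\<lambda>n::nat. \<integral>x. cmod (s n x - \<phi> x) \<partial>M) \<longlonglongrightarrow> 0"
  shows "FTint M \<phi> V \<in> D"
proof -
  have "uniform_limit UNIV (\<lambda>n. FTint M (s n) V) (FTint M \<phi> V) sequentially"
  proof (rule uniform_limitI)
    fix e :: real assume "e > 0"
    then have "\<forall>\<^sub>F n in sequentially. (\<integral>x. cmod (s n x - \<phi> x) \<partial>M) < e"
      using order_tendstoD(2)[OF lim] by blast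
    then show "\<forall>\<^sub>F n in sequentially. \<forall>w\<in>UNIV. dist (FTint M (s n) V w) (FTint M \<phi> V w) < e"
    proof eventually_elim
      case (elim n)
      show ?case
      proof
        fix w
        have "dist (FTint M (s n) V w) (FTint M \<phi> V w) = cmod (FTint M (\<lambda>x. s n x - \<phi> x) V w)"
          by (simp add: FTint_diff[OF V int] dist_norm)
        also have "\<dots> \<le> (\<integral>x. cmod (s n x - \<phi> x) \<partial>M)"
          using int by (intro FTint_norm[OF V]) auto
        finally show "dist (FTint M (s n) V w) (FTint M \<phi> V w) < e" using elim by simp
      qed
    qed
  qed
  then show ?thesis by (rule BUC_closed_limit[OF D(2,1)])
qed

section \<open>Toeplitz operators of bounded symbols and of characters\<close>

lemma BUC_measurable: "f \<in> BUC \<Longrightarrow> f \<in> borel_measurable borel"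
  by (rule borel_measurable_continuous_onI, rule uniformly_continuous_imp_continuous) (simp add: BUC_def)

lemma toeplitz_bounded_symbol:
  assumes [measurable]: "f \<in> borel_measurable borel" and b: "\<And>w. cmod (f w) \<le> B" and g: "g \<in> fock t"
  shows "toeplitz t f g = P (\<lambda>w. f w * g w)"
proof -
  have "(\<lambda>w. f w * g w) \<in> L2 t" using L2_mult_bounded[OF fock_L2[OF g] assms(1) b] .
  then show ?thesis using g by (simp add: toeplitz_def toeplitz_dom_def fock_proj_eq)
qed

lemma toeplitz_outside: "g \<notin> fock t \<Longrightarrow> toeplitz t f g = (\<lambda>w. 0)"
  by (simp add: toeplitz_def toeplitz_dom_def)

text \<open>Since \<open>2 * \<i> * sigma t w v\<close> is
  \<open>(w * cnj v - cnj (w * cnj v)) / t\<close>, the character times the kernel at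
  \<open>z\<close> is the holomorphic factor \<open>exp (w * cnj v / t)\<close> times the kernel at
  \<open>z - v\<close>. The reproducing formula evaluates at \<open>z - v\<close>, and the Gaussian
  constant is what distinguishes the resulting multiplier from \<open>E v z\<close>.\<close>

lemma W_exponential:
  assumes g: "g \<in> fock t"
  shows "(\<integral>w. exp (2 * \<i> * of_real (sigma t w v)) * g w * exp (z * cnj w / t) \<partial>\<mu>) = of_real (exp (- (cmod v)\<^sup>2 / (2 * t))) * W v g z"
proof -
  have [measurable]: "g \<in> borel_measurable borel" using g by (rule fock_measurable)
  have e: "exp (2 * \<i> * of_real (sigma t w v)) * exp (z * cnj w / t) = exp (w * cnj v / t) * exp ((z - v) * cnj w / t)" for w
  proof -
    have "2 * \<i> * of_real (sigma t w v) = (w * cnj v - cnj (w * cnj v)) / t"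
      unfolding complex_diff_cnj sigma_def by simp
    then have "2 * \<i> * of_real (sigma t w v) + z * cnj w / t = w * cnj v / t + (z - v) * cnj w / t"
      by (simp add: diff_divide_distrib left_diff_distrib mult.commute[of v "cnj w"] mult.commute[of z "cnj w"])
    then show ?thesis by (simp only: exp_add[symmetric])
  qed
  have m: "cmod (exp (2 * \<i> * of_real (sigma t w v)) * g w) = cmod (g w)" for w by (simp add: norm_mult)
  have "(\<lambda>w. exp (2 * \<i> * of_real (sigma t w v)) * g w) \<in> L2 t"
    by (rule L2_cong_norm[OF fock_L2[OF g]]) (auto simp: m)
  then have "integrable \<mu> (\<lambda>w. (exp (2 * \<i> * of_real (sigma t w v)) * g w) * exp (z * cnj w / t))"
    by (rule integrable_L2_exp)
  then have i: "integrable \<mu> (\<lambda>w. (exp (w * cnj v / t) * g w) * exp ((z - v) * cnj w / t))"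
    using e by (simp add: mult_ac)
  have "(\<integral>w. exp (2 * \<i> * of_real (sigma t w v)) * g w * exp (z * cnj w / t) \<partial>\<mu>) = (\<integral>w. (exp (w * cnj v / t) * g w) * exp ((z - v) * cnj w / t) \<partial>\<mu>)"
    using e by (intro Bochner_Integration.integral_cong) (auto simp: mult_ac)
  also have "\<dots> = exp ((z - v) * cnj v / t) * g (z - v)"
    by (rule reproducing[OF _ i]) (use fock_hol[OF g] in \<open>auto intro!: holomorphic_intros\<close>)
  also have "exp ((z - v) * cnj v / t) = of_real (exp (- (cmod v)\<^sup>2 / (2 * t))) * E v z"
  proof -
    define a where "a = complex_of_real ((cmod v)\<^sup>2)"
    have a: "v * cnj v = a" unfolding a_def by (rule complex_norm_square[symmetric])
    have "complex_of_real (- (cmod v)\<^sup>2 / (2 * t)) = - (a / t / 2)"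
      "(z * cnj v - (cmod v)\<^sup>2 / 2) / t = z * cnj v / t - a / t / 2"
      by (simp_all add: a_def diff_divide_distrib)
    then have "(z - v) * cnj v / t = of_real (- (cmod v)\<^sup>2 / (2 * t)) + (z * cnj v - (cmod v)\<^sup>2 / 2) / t"
      by (simp add: left_diff_distrib diff_divide_distrib a)
    then show ?thesis
      unfolding E_def exp_of_real[symmetric] by (simp only: exp_add[symmetric])
  qed
  finally show ?thesis by (simp add: W_def)
qed

lemma toeplitz_FTint:
  assumes "finite_measure M" and [measurable]: "V \<in> borel_measurable M" and \<phi>: "integrable M \<phi>"
  shows "toeplitz t (FTint M \<phi> V) = Wint M (\<lambda>x. \<phi> x * of_real (exp (- (cmod (V x))\<^sup>2 / (2 * t)))) V"
proof
  fix g
  interpret M: finite_measure M by fact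
  interpret MM: pair_sigma_finite M \<mu> ..
  have [measurable]: "\<phi> \<in> borel_measurable M" using \<phi> by auto
  have Fm: "FTint M \<phi> V \<in> borel_measurable borel" unfolding FTint_def[abs_def] by measurable
  show "toeplitz t (FTint M \<phi> V) g = Wint M (\<lambda>x. \<phi> x * of_real (exp (- (cmod (V x))\<^sup>2 / (2 * t)))) V g"
  proof (cases "g \<in> fock t")
    case g: True
    have [measurable]: "g \<in> borel_measurable borel" using g by (rule fock_measurable)
    have "P (\<lambda>w. FTint M \<phi> V w * g w) z = Wint M (\<lambda>x. \<phi> x * of_real (exp (- (cmod (V x))\<^sup>2 / (2 * t)))) V g z" for z
    proof -
      let ?F = "\<lambda>x w. \<phi> x * (exp (2 * \<i> * of_real (sigma t w (V x))) * g w * exp (z * cnj w / t))"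
      have int: "integrable (M \<Otimes>\<^sub>M \<mu>) (\<lambda>(x, w). ?F x w)"
      proof (rule integrableI_bounded)
        show "(\<lambda>(x, w). ?F x w) \<in> borel_measurable (M \<Otimes>\<^sub>M \<mu>)" by measurable
        let ?H = "\<lambda>p. ennreal (norm (case p of (x, w) \<Rightarrow> ?F x w))"
        have "(\<integral>\<^sup>+p. ?H p \<partial>(M \<Otimes>\<^sub>M \<mu>)) = (\<integral>\<^sup>+x. \<integral>\<^sup>+w. ?H (x, w) \<partial>\<mu> \<partial>M)"
          by (subst nn_integral_fst) auto
        \<comment> \<open>Characters have modulus one, so the majorant factorizes.\<close>
        also have "\<dots> = (\<integral>\<^sup>+x. ennreal (cmod (\<phi> x)) * (\<integral>\<^sup>+w. ennreal (cmod (g w * exp (z * cnj w / t))) \<partial>\<mu>) \<partial>M)"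
          by (subst nn_integral_cmult[symmetric]) (auto simp: norm_mult ennreal_mult mult_ac intro!: nn_integral_cong)
        also have "\<dots> = (\<integral>\<^sup>+x. ennreal (cmod (\<phi> x)) \<partial>M) * (\<integral>\<^sup>+w. ennreal (cmod (g w * exp (z * cnj w / t))) \<partial>\<mu>)"
          by (rule nn_integral_multc) measurable
        also have "\<dots> < \<infinity>"
          using \<phi> integrable_L2_exp[OF fock_L2[OF g], of z] by (simp add: integrable_iff_bounded ennreal_mult_less_top)
        finally show "(\<integral>\<^sup>+p. ?H p \<partial>(M \<Otimes>\<^sub>M \<mu>)) < \<infinity>" .
      qed
      have "P (\<lambda>w. FTint M \<phi> V w * g w) z = (\<integral>w. (\<integral>x. ?F x w \<partial>M) \<partial>\<mu>)"
        unfolding P_def FTint_def by (simp add: mult.assoc[symmetric])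
      also have "\<dots> = (\<integral>x. (\<integral>w. ?F x w \<partial>\<mu>) \<partial>M)"
        by (rule MM.Fubini_integral[OF int])
      also have "\<dots> = Wint M (\<lambda>x. \<phi> x * of_real (exp (- (cmod (V x))\<^sup>2 / (2 * t)))) V g z"
        using g unfolding Wint_def integral_mult_right_zero W_exponential[OF g] by (simp add: mult.assoc)
      finally show ?thesis .
    qed
    then show ?thesis
      using toeplitz_bounded_symbol[OF Fm FTint_norm[OF _ \<phi>] g] by (simp add: fun_eq_iff)
  qed (simp add: toeplitz_outside Wint_def)
qed

end

section \<open>The resolvents\<close>

text \<open>The exponential distribution, kept as a measure on all reals. It is a finite reference
  measure for a ray and carries the Laplace weight of the resolvent at parameter one; densities
  \<open>exp (- s) ^ j\<close> reach the parameters \<open>1 + j\<close>.\<close>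

definition expm :: "real measure" where "expm = density lborel (\<lambda>s. ennreal (exponential_density 1 s))"

lemma expm_prob_space: "prob_space expm"
  unfolding expm_def by (rule prob_space_exponential_density) simp

lemma expm_finite_measure: "finite_measure expm"
  using expm_prob_space by (rule prob_space.finite_measure)

lemma space_expm [simp]: "space expm = UNIV"
  by (simp add: expm_def)

lemma sets_expm [simp, measurable_cong]: "sets expm = sets borel"
  by (simp add: expm_def)

lemma measurable_expm [simp]: "measurable expm M = measurable borel M"
  by (rule measurable_cong_sets) auto

lemma integral_expm:
  fixes F :: "real \<Rightarrow> 'b::{banach, second_countable_topology}"
  assumes [measurable]: "F \<in> borel_measurable borel"
  shows "(\<integral>s. F s \<partial>expm) = (\<integral>s. exponential_density 1 s *\<^sub>R F s \<partial>lborel)"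
  unfolding expm_def by (rule integral_density) (auto simp: exponential_density_nonneg)

lemma integrable_expm_iff:
  fixes F :: "real \<Rightarrow> 'b::{banach, second_countable_topology}"
  assumes [measurable]: "F \<in> borel_measurable borel"
  shows "integrable expm F \<longleftrightarrow> integrable lborel (\<lambda>s. exponential_density 1 s *\<^sub>R F s)"
  unfolding expm_def by (rule integrable_density) (auto simp: exponential_density_nonneg)

lemma AE_expm: "AE s in expm. s \<ge> 0"
  unfolding expm_def by (subst AE_density) (auto simp: exponential_density_def)

lemma integrable_expm_bounded:
  fixes F :: "real \<Rightarrow> 'b::{banach, second_countable_topology}"
  assumes "F \<in> borel_measurable borel" "\<And>s. s \<ge> 0 \<Longrightarrow> norm (F s) \<le> B"
  shows "integrable expm F"
proof (rule finite_measure.integrable_const_bound[OF expm_finite_measure, where B=B])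
  show "AE s in expm. norm (F s) \<le> B" using AE_expm by eventually_elim (rule assms(2))
qed (use assms in simp)

text \<open>The limit of elementary integrals over \<open>{0..n}\<close>. From
  \<open>Re \<kappa> \<ge> 0\<close> comes \<open>Re (1 + \<kappa>) > 0\<close>, so the boundary
  term at \<open>n\<close> tends to zero.\<close>

lemma expm_exp_integral:
  assumes "Re \<kappa> \<ge> 0"
  shows "(\<integral>s. exp (- \<kappa> * of_real s) \<partial>expm) = 1 / (1 + \<kappa>)"
proof -
  define c where "c = 1 + \<kappa>"
  have c0: "c \<noteq> 0" "Re c > 0" using assms by (auto simp: c_def complex_eq_iff)
  have nb: "cmod (exp (- \<kappa> * of_real s)) \<le> 1" if "s \<ge> 0" for s
    using assms that by (simp add: mult_nonneg_nonneg)
  have int: "integrable expm (\<lambda>s. exp (- \<kappa> * of_real s))"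
    by (rule integrable_expm_bounded[where B=1]) (use nb in auto)
  let ?F = "\<lambda>n s. indicator {0..real n} s *\<^sub>R exp (- c * of_real s)"
  have e: "exponential_density 1 s *\<^sub>R exp (- \<kappa> * of_real s) = exp (- c * of_real s)" if "s \<ge> 0" for s
    using that by (simp add: exponential_density_def c_def exp_add[symmetric] scaleR_conv_of_real exp_of_real[symmetric] algebra_simps)
  have lim1: "(\<lambda>n. \<integral>s. ?F n s \<partial>lborel) \<longlonglongrightarrow> (\<integral>s. exponential_density 1 s *\<^sub>R exp (- \<kappa> * of_real s) \<partial>lborel)"
  proof (rule integral_dominated_convergence[where w="\<lambda>s. norm (exponential_density 1 s *\<^sub>R exp (- \<kappa> * of_real s))"])
    show "integrable lborel (\<lambda>s. norm (exponential_density 1 s *\<^sub>R exp (- \<kappa> * of_real s)))"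
    proof (rule integrable_norm)
      show "integrable lborel (\<lambda>s. exponential_density 1 s *\<^sub>R exp (- \<kappa> * of_real s))"
        using int by (subst (asm) integrable_expm_iff) auto
    qed
    show "AE s in lborel. (\<lambda>n. ?F n s) \<longlonglongrightarrow> exponential_density 1 s *\<^sub>R exp (- \<kappa> * of_real s)"
    proof (rule AE_I2)
      fix s :: real
      have "\<forall>\<^sub>F n in sequentially. ?F n s = exponential_density 1 s *\<^sub>R exp (- \<kappa> * of_real s)"
        using eventually_ge_at_top[of "nat \<lceil>s\<rceil>"]
      proof eventually_elim
        case (elim n)
        then have "s \<le> real n" by linarith
        then show ?case by (cases "s \<ge> 0") (auto simp only: e, auto simp: exponential_density_def)
      qed
      then show "(\<lambda>n. ?F n s) \<longlonglongrightarrow> exponential_density 1 s *\<^sub>R exp (- \<kappa> * of_real s)"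
        by (rule tendsto_eventually)
    qed
    show "AE s in lborel. norm (?F n s) \<le> norm (exponential_density 1 s *\<^sub>R exp (- \<kappa> * of_real s))" for n
    proof (rule AE_I2)
      fix s :: real
      show "norm (?F n s) \<le> norm (exponential_density 1 s *\<^sub>R exp (- \<kappa> * of_real s))"
        by (cases "s \<ge> 0") (simp_all only: e, auto simp: indicator_def)
    qed
  qed measurable
  have val: "(\<integral>s. ?F n s \<partial>lborel) = (1 - exp (- c * of_real (real n))) / c" for n
  proof -
    have "((\<lambda>s. exp (- c * of_real s)) has_integral (- exp (- c * of_real (real n)) / c - (- exp (- c * of_real 0) / c))) {0..real n}"
      using c0 by (intro fundamental_theorem_of_calculus)
        (auto intro!: has_vector_derivative_real_field derivative_eq_intros)
    then have I: "integral {0..real n} (\<lambda>s. exp (- c * of_real s)) = (1 - exp (- c * of_real (real n))) / c"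
      by (simp add: integral_unique diff_divide_distrib)
    have "set_integrable lborel {0..real n} (\<lambda>s. exp (- c * of_real s))"
      by (rule borel_integrable_atLeastAtMost') (intro continuous_intros)
    from set_borel_integral_eq_integral(2)[OF this] show ?thesis
      unfolding I by (simp add: set_lebesgue_integral_def)
  qed
  have "(\<lambda>n. exp (- c * of_real (real n))) \<longlonglongrightarrow> 0"
  proof (rule tendsto_norm_zero_cancel)
    have "(\<lambda>n. exp (- Re c) ^ n) \<longlonglongrightarrow> 0"
      using c0 by (intro LIMSEQ_power_zero) auto
    then show "(\<lambda>n. cmod (exp (- c * of_real (real n)))) \<longlonglongrightarrow> 0"
      by (simp add: exp_of_nat_mult[symmetric] mult.commute)
  qed
  then have "(\<lambda>n. (1 - exp (- c * of_real (real n))) / c) \<longlonglongrightarrow> (1 - 0) / c"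
    by (intro tendsto_intros c0)
  with lim1 have "(\<integral>s. exponential_density 1 s *\<^sub>R exp (- \<kappa> * of_real s) \<partial>lborel) = 1 / c"
    unfolding val using LIMSEQ_unique by fastforce
  then show ?thesis by (simp add: integral_expm c_def)
qed

context bargmann
begin

text \<open>Formally the inverse of \<open>1 - X\<close>, where \<open>X\<close> generates the Weyl
  group along \<open>u\<close>. Rescaling \<open>u\<close> makes every resolvent a multiple of such
  an operator (\<open>resolvent_eq\<close>), so the Laplace parameter one suffices.\<close>

definition Q :: "complex \<Rightarrow> fock_op" where
  "Q u = Wint expm (\<lambda>_. 1) (\<lambda>s. of_real s * u)"

lemma Q_fock: "g \<in> fock t \<Longrightarrow> Q u g \<in> fock t"
  unfolding Q_def by (rule Wint_fock[OF expm_finite_measure]) (auto intro!: integrable_expm_bounded[where B=1])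

lemma Q_bounded_ops: "Q u \<in> bounded_ops t"
  unfolding Q_def by (rule Wint_bounded_ops[OF expm_finite_measure]) (auto intro!: integrable_expm_bounded[where B=1])

lemma sigma_collinear: "sigma t (of_real a * u) (of_real b * u) = 0"
  by (simp add: sigma_def)

text \<open>\<open>sigma\<close> vanishes on collinear points, so along \<open>u\<close> the Weyl
  operators form a one-parameter group. Substituting \<open>r = h + s\<close> moves the lower limit
  of the Laplace integral from \<open>0\<close> to \<open>h\<close> and produces the factor
  \<open>exp h\<close>.\<close>

lemma Q_shift:
  assumes g: "g \<in> fock t" and h: "h \<ge> 0"
  shows "W (of_real h * u) (Q u g) w = of_real (exp h) * (Q u g w - integral {0..h} (\<lambda>r. of_real (exp (- r)) * W (of_real r * u) g w))"
proof -
  define G where "G r = W (of_real r * u) g w" for r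
  have gc: "continuous_on UNIV g" using holomorphic_on_imp_continuous_on[OF fock_hol[OF g]] .
  have [measurable]: "g \<in> borel_measurable borel" using g by (rule fock_measurable)
  have Gc: "continuous_on A G" for A
    unfolding G_def W_def E_def
    by (intro continuous_intros continuous_on_compose2[OF gc]) (use t_pos in auto)
  have Gm[measurable]: "G \<in> borel_measurable borel" by (rule borel_measurable_continuous_onI[OF Gc])
  have Gb: "cmod (G r) \<le> L2_norm t g * exp ((cmod w)\<^sup>2 / (2 * t))" for r
    unfolding G_def by (rule W_bound[OF g])
  have Gint: "integrable expm G" by (rule integrable_expm_bounded[OF Gm Gb])
  then have Gi: "integrable lborel (\<lambda>r. exponential_density 1 r *\<^sub>R G r)"
    by (subst (asm) integrable_expm_iff) auto
  have c: "continuous_on {0..h} (\<lambda>r. of_real (exp (- r)) * G r)" by (intro continuous_intros Gc)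
  have si: "set_integrable lborel {0..h} (\<lambda>r. of_real (exp (- r)) * G r)"
    by (rule borel_integrable_atLeastAtMost'[OF c])
  have QG: "Q u g w = (\<integral>s. G s \<partial>expm)"
    using g by (simp add: Q_def Wint_def G_def)
  have "W (of_real h * u) (Q u g) w = (\<integral>s. G (h + s) \<partial>expm)"
  proof -
    have "E (of_real h * u) w * W (of_real s * u) g (w - of_real h * u) = G (h + s)" for s
      using W_W[of "of_real h * u" "of_real s * u" g w]
      by (simp add: sigma_collinear G_def distrib_right[symmetric]) (simp add: W_def)
    moreover have "Q u g x = (\<integral>s. W (of_real s * u) g x \<partial>expm)" for x
      using g by (simp add: Q_def Wint_def)
    ultimately show ?thesis
      unfolding W_def[of _ "Q u g"] by (simp only: integral_mult_right_zero[symmetric])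
  qed
  also have "\<dots> = (\<integral>s. exponential_density 1 s *\<^sub>R G (h + s) \<partial>lborel)"
    by (rule integral_expm) measurable
  also have "\<dots> = (\<integral>r. exponential_density 1 (r - h) *\<^sub>R G r \<partial>lborel)"
    using lborel_integral_real_affine[of 1 "\<lambda>r. exponential_density 1 (r - h) *\<^sub>R G r" h] by simp
  also have "\<dots> = (\<integral>r. of_real (exp h) * (exponential_density 1 r *\<^sub>R G r - indicator {0..h} r *\<^sub>R (of_real (exp (- r)) * G r)) \<partial>lborel)"
  proof (rule integral_cong_AE)
    \<comment> \<open>At \<open>r = h\<close> the two sides differ:
      \<open>exponential_density 1 0\<close> is \<open>1\<close>, whereas the closed interval on the
      right subtracts everything.\<close>
    have "AE r in lborel. r \<noteq> h" by (rule AE_lborel_singleton)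
    then show "AE r in lborel. exponential_density 1 (r - h) *\<^sub>R G r = of_real (exp h) * (exponential_density 1 r *\<^sub>R G r - indicator {0..h} r *\<^sub>R (of_real (exp (- r)) * G r))"
    proof eventually_elim
      case (elim r)
      have eq: "exponential_density 1 (r - h) = exp h * (exponential_density 1 r - indicator {0..h} r * exp (- r))"
        using elim h by (auto simp: exponential_density_def indicator_def exp_diff exp_minus field_simps)
      show ?case unfolding eq by (simp add: scaleR_conv_of_real algebra_simps)
    qed
  qed measurable
  also have "\<dots> = of_real (exp h) * ((\<integral>r. exponential_density 1 r *\<^sub>R G r \<partial>lborel) - (\<integral>r. indicator {0..h} r *\<^sub>R (of_real (exp (- r)) * G r) \<partial>lborel))"
    using Gi si by (simp add: set_integrable_def)
  also have "(\<integral>r. indicator {0..h} r *\<^sub>R (of_real (exp (- r)) * G r) \<partial>lborel) = integral {0..h} (\<lambda>r. of_real (exp (- r)) * G r)"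
    using set_borel_integral_eq_integral(2)[OF si] by (simp add: set_lebesgue_integral_def)
  also have "(\<integral>r. exponential_density 1 r *\<^sub>R G r \<partial>lborel) = Q u g w"
    unfolding QG by (rule integral_expm[symmetric]) measurable
  finally show ?thesis by (simp add: G_def)
qed

text \<open>The function \<open>h \<mapsto> W\<^sub>h\<^sub>u (Q u g) w\<close> is differentiated in two ways: by the chain rule, and with the
  shifted Laplace integral.\<close>

lemma Q_generator:
  assumes g: "g \<in> fock t"
  shows "w * cnj u / t * Q u g w - u * deriv (Q u g) w = Q u g w - g w"
proof -
  let ?f = "Q u g"
  have f: "?f \<in> fock t" by (rule Q_fock[OF g])
  define K where "K h = integral {0..h} (\<lambda>r. of_real (exp (- r)) * W (of_real r * u) g w)" for h
  have gc: "continuous_on UNIV g" using holomorphic_on_imp_continuous_on[OF fock_hol[OF g]] .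
  have c: "continuous_on {0..1} (\<lambda>r. of_real (exp (- r)) * W (of_real r * u) g w)"
    unfolding W_def E_def by (intro continuous_intros continuous_on_compose2[OF gc]) (use t_pos in auto)
  have K: "(K has_vector_derivative g w) (at 0 within {0..1})"
    using integral_has_vector_derivative[OF c, of 0] unfolding K_def by simp
  have e: "((\<lambda>h. complex_of_real (exp h)) has_vector_derivative 1) (at 0 within {0..1})"
    by (auto intro!: derivative_eq_intros simp: has_vector_derivative_def[symmetric] simp flip: has_real_derivative_iff_has_vector_derivative
       intro: has_vector_derivative_of_real)
  have r: "((\<lambda>h. complex_of_real (exp h) * (?f w - K h)) has_vector_derivative (?f w - g w)) (at 0 within {0..1})"
  proof -
    have "((\<lambda>h. ?f w - K h) has_vector_derivative (0 - g w)) (at 0 within {0..1})"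
      by (intro has_vector_derivative_diff K has_vector_derivative_const)
    from has_vector_derivative_mult[OF e this] show ?thesis by (simp add: K_def)
  qed
  \<comment> \<open>With \<open>c\<^sup>2\<close> in place of a squared modulus this extends the
    value of \<open>W (of_real h * u)\<close> holomorphically from real \<open>h\<close> to complex
    \<open>c\<close>, so that the complex chain rule is available.\<close>
  define \<Psi> where "\<Psi> c = exp (c * (w * cnj u / t) - c\<^sup>2 * of_real ((cmod u)\<^sup>2 / 2 / t)) * ?f (w - c * u)" for c
  have "(?f has_field_derivative deriv ?f w) (at (w - 0 * u))"
    using holomorphic_derivI[OF fock_hol[OF f] open_UNIV, of w] by simp
  then have d: "((\<lambda>c. ?f (w - c * u)) has_field_derivative (deriv ?f w * (- u))) (at 0)"
    by (rule DERIV_chain2) (auto intro!: derivative_eq_intros)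
  have "(\<Psi> has_field_derivative (w * cnj u / t * ?f w - u * deriv ?f w)) (at (of_real 0))"
    unfolding \<Psi>_def using t_pos by (auto intro!: derivative_eq_intros d)
  then have l: "((\<lambda>h. \<Psi> (of_real h)) has_vector_derivative (w * cnj u / t * ?f w - u * deriv ?f w)) (at 0 within {0..1})"
    by (rule has_vector_derivative_real_field)
  have eq: "\<Psi> (of_real h) = complex_of_real (exp h) * (?f w - K h)" if "h \<ge> 0" for h
  proof -
    have "\<Psi> (of_real h) = W (of_real h * u) ?f w"
      by (simp add: \<Psi>_def W_def E_def norm_mult power_mult_distrib diff_divide_distrib mult_ac)
    then show ?thesis using Q_shift[OF g that, of u w] by (simp add: K_def)
  qed
  have "((\<lambda>h. \<Psi> (of_real h)) has_vector_derivative (?f w - g w)) (at 0 within {0..1})"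
    by (rule has_vector_derivative_transform[OF _ _ r]) (auto simp: eq)
  then show ?thesis
    by (intro vector_derivative_unique_within[OF _ l]) (auto simp: trivial_limit_within)
qed

lemma toeplitz_dom_linear:
  assumes "F \<in> toeplitz_dom t \<phi>"
  shows "toeplitz t \<phi> F \<in> fock t" "h \<in> fock t \<Longrightarrow> L2_inner t (toeplitz t \<phi> F) h = L2_inner t (\<lambda>w. \<phi> w * F w) h"
  using assms by (auto simp: toeplitz_def toeplitz_dom_def fock_proj_eq P_fock P_inner)

text \<open>For \<open>f = Q u g\<close> with \<open>u = - z / l\<close>, the generator equation
  shows that the symbol times \<open>F\<close> is \<open>f - g\<close> up to a multiple of
  \<open>hankel f\<close>. That multiple is square-integrable, which puts \<open>F\<close> into the
  domain, and orthogonal to the Fock space, so the projection leaves \<open>f - g\<close>.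
  Uniqueness comes from the symbol being real.\<close>

lemma resolvent_eq:
  assumes l: "l \<noteq> 0"
  shows "toeplitz_resolvent t (\<lambda>w. complex_of_real (2 * sigma t w z)) (\<i> * complex_of_real l)
     = (\<lambda>g w. 1 / (\<i> * of_real l) * Q (- z / of_real l) g w)"
proof
  fix g
  let ?\<phi> = "\<lambda>w. complex_of_real (2 * sigma t w z)"
  let ?c = "\<i> * complex_of_real l"
  have c0: "?c \<noteq> 0" using l by simp
  show "toeplitz_resolvent t ?\<phi> ?c g = (\<lambda>w. 1 / ?c * Q (- z / of_real l) g w)"
  proof (cases "g \<in> fock t")
    case g: True
    define u where "u = - z / of_real l"
    define f where "f = Q u g"
    define F where "F w = 1 / ?c * f w" for w
    have f: "f \<in> fock t" unfolding f_def by (rule Q_fock[OF g])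
    have F: "F \<in> fock t" unfolding F_def[abs_def] by (rule fock_cmult[OF f])
    have pF: "?\<phi> w * F w = (f w - g w) - u / t * hankel f w" for w
    proof -
      have s: "sigma t w z = - l * sigma t w u"
        using l by (simp add: sigma_def u_def)
      have "?\<phi> w * F w = 2 * \<i> * of_real (sigma t w u) * f w"
        using l unfolding s F_def by (simp add: field_simps)
      also have "2 * \<i> * of_real (sigma t w u) = (w * cnj u - cnj (w * cnj u)) / t"
        unfolding complex_diff_cnj sigma_def by simp
      \<comment> \<open>Multiplication by \<open>cnj w\<close> is traded for \<open>t\<close> times
        differentiation plus \<open>hankel\<close>; what remains is the generator of the Weyl group
        along \<open>u\<close>.\<close>
      also have "(w * cnj u - cnj (w * cnj u)) / t * f w = (w * cnj u / t * f w - u * deriv f w) - u / t * hankel f w"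
        using t_pos by (simp add: hankel_def field_simps)
      also have "w * cnj u / t * f w - u * deriv f w = f w - g w"
        unfolding f_def by (rule Q_generator[OF g])
      finally show ?thesis .
    qed
    have L2: "(\<lambda>w. (f w - g w) - u / t * hankel f w) \<in> L2 t"
      by (intro L2_diff L2_cmult hankel_L2 fock_L2 f g)
    then have dom: "F \<in> toeplitz_dom t ?\<phi>"
      using F by (simp add: toeplitz_dom_def pF del: of_real_mult)
    have TF: "toeplitz t ?\<phi> F = (\<lambda>w. f w - g w)"
    proof -
      have "toeplitz t ?\<phi> F = fock_proj t (\<lambda>w. (f w - g w) - u / t * hankel f w)"
        using dom by (simp add: toeplitz_def pF del: of_real_mult)
      also have "\<dots> = (\<lambda>w. f w - g w)"
      proof (rule fock_proj_unique[OF L2])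
        show fg: "(\<lambda>w. f w - g w) \<in> fock t" by (intro fock_diff f g)
        fix h assume h: "h \<in> fock t"
        show "L2_inner t (\<lambda>w. f w - g w) h = L2_inner t (\<lambda>w. (f w - g w) - u / t * hankel f w) h"
          unfolding L2_inner_diff_left[OF fock_L2[OF fg] L2_cmult[OF hankel_L2[OF f]] fock_L2[OF h]]
            L2_inner_cmult_left hankel_orthogonal[OF f h] by simp
      qed
      finally show ?thesis .
    qed
    have "(THE f. f \<in> toeplitz_dom t ?\<phi> \<and> (\<lambda>w. ?c * f w - toeplitz t ?\<phi> f w) = g) = F"
    proof (rule the_equality)
      show "F \<in> toeplitz_dom t ?\<phi> \<and> (\<lambda>w. ?c * F w - toeplitz t ?\<phi> F w) = g"
        using dom TF c0 by (simp add: F_def fun_eq_iff)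
      fix F' assume F': "F' \<in> toeplitz_dom t ?\<phi> \<and> (\<lambda>w. ?c * F' w - toeplitz t ?\<phi> F' w) = g"
      then have dom': "F' \<in> toeplitz_dom t ?\<phi>" and eq': "\<And>w. ?c * F' w - toeplitz t ?\<phi> F' w = g w" by (auto simp: fun_eq_iff)
      have F'f: "F' \<in> fock t" using dom' by (simp add: toeplitz_dom_def)
      define d where "d w = F' w - F w" for w
      have d: "d \<in> fock t" unfolding d_def[abs_def] by (intro fock_diff F'f F)
      have dL: "(\<lambda>w. ?\<phi> w * F' w) \<in> L2 t" "(\<lambda>w. ?\<phi> w * F w) \<in> L2 t"
        using dom dom' by (auto simp: toeplitz_dom_def)
      have "?c * d w = toeplitz t ?\<phi> F' w - toeplitz t ?\<phi> F w" for w
      proof -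
        have "?c * F w - toeplitz t ?\<phi> F w = g w" using TF c0 by (simp add: F_def)
        then show ?thesis using eq'[of w] by (simp add: d_def algebra_simps)
      qed
      then have "?c * L2_inner t d d = L2_inner t (\<lambda>w. toeplitz t ?\<phi> F' w - toeplitz t ?\<phi> F w) d"
        by (simp only: L2_inner_cmult_left[symmetric])
      also have "\<dots> = L2_inner t (\<lambda>w. ?\<phi> w * F' w) d - L2_inner t (\<lambda>w. ?\<phi> w * F w) d"
        using toeplitz_dom_linear[OF dom] toeplitz_dom_linear[OF dom'] d
        by (subst L2_inner_diff_left) (auto simp: fock_L2)
      also have "\<dots> = L2_inner t (\<lambda>w. ?\<phi> w * d w) d"
        using dL d by (subst L2_inner_diff_left[symmetric]) (auto simp: fock_L2 d_def right_diff_distrib)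
      finally have 1: "?c * L2_inner t d d = L2_inner t (\<lambda>w. ?\<phi> w * d w) d" .
      \<comment> \<open>A real symbol has a real quadratic form, while \<open>?c\<close> is
        imaginary: the imaginary part of fact \<open>1\<close> is \<open>l\<close> times the squared
        norm of \<open>d\<close>, which must therefore vanish.\<close>
      have "cnj (L2_inner t (\<lambda>w. ?\<phi> w * d w) d) = L2_inner t (\<lambda>w. ?\<phi> w * d w) d"
        unfolding L2_inner_def Bochner_Integration.integral_cnj[symmetric] by (simp add: mult_ac)
      then have "Im (L2_inner t (\<lambda>w. ?\<phi> w * d w) d) = 0"
        by (simp add: complex_eq_iff)
      then have "l * (L2_norm t d)\<^sup>2 = 0"
        unfolding 1[symmetric] L2_inner_self by simp
      then have "L2_norm t d = 0" using l by simp
      then show "F' = F" using fock_norm_zero[OF d] by (simp add: d_def fun_eq_iff)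
    qed
    then show ?thesis
      using g by (simp add: toeplitz_resolvent_def F_def[abs_def] f_def u_def)
  next
    case False
    then show ?thesis by (simp add: toeplitz_resolvent_def Q_def Wint_def)
  qed
qed

end

section \<open>The two C*-algebras as generated objects\<close>

lemma BUC_iff:
  "f \<in> BUC \<longleftrightarrow> (\<exists>B. \<forall>w. cmod (f w) \<le> B) \<and> (\<forall>e>0. \<exists>d>0. \<forall>w w'. cmod (w' - w) < d \<longrightarrow> cmod (f w' - f w) < e)"
  unfolding BUC_def bounded_iff uniformly_continuous_on_def by (auto simp: dist_norm)

lemma BUC_bound: "f \<in> BUC \<Longrightarrow> \<exists>B>0. \<forall>w. cmod (f w) \<le> B"
proof -
  assume "f \<in> BUC"
  then obtain B where "\<And>w. cmod (f w) \<le> B" unfolding BUC_iff by blast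
  then have "cmod (f w) \<le> \<bar>B\<bar> + 1" for w
    using order_trans[of "cmod (f w)" B "\<bar>B\<bar> + 1"] by simp
  then show ?thesis by (intro exI[of _ "\<bar>B\<bar> + 1"]) auto
qed

lemma BUC_ucont: "f \<in> BUC \<Longrightarrow> e > 0 \<Longrightarrow> \<exists>d>0. \<forall>w w'. cmod (w' - w) < d \<longrightarrow> cmod (f w' - f w) < e"
  unfolding BUC_iff by blast

lemma BUC_add: "f \<in> BUC \<Longrightarrow> g \<in> BUC \<Longrightarrow> (\<lambda>w. f w + g w) \<in> BUC"
  by (auto simp: BUC_def intro: bounded_plus_comp[of _ UNIV] uniformly_continuous_on_add)

lemma BUC_mult:
  assumes "f \<in> BUC" "g \<in> BUC" shows "(\<lambda>w. f w * g w) \<in> BUC"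
  unfolding BUC_iff
proof (intro conjI allI impI)
  obtain A B where A: "A > 0" "\<And>w. cmod (f w) \<le> A" and B: "B > 0" "\<And>w. cmod (g w) \<le> B" using assms[THEN BUC_bound] by blast
  have "cmod (f w * g w) \<le> A * B" for w
    using A B by (simp add: norm_mult mult_mono less_imp_le)
  then show "\<exists>B. \<forall>w. cmod (f w * g w) \<le> B" by blast
  fix e :: real assume e: "e > 0"
  have e1: "e / (2 * B) > 0" and e2: "e / (2 * A) > 0" using e A B by auto
  obtain d1 where d1: "d1 > 0" "\<And>w w'. cmod (w' - w) < d1 \<Longrightarrow> cmod (f w' - f w) < e / (2 * B)" using BUC_ucont[OF assms(1) e1] by blast
  obtain d2 where d2: "d2 > 0" "\<And>w w'. cmod (w' - w) < d2 \<Longrightarrow> cmod (g w' - g w) < e / (2 * A)" using BUC_ucont[OF assms(2) e2] by blast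
  have "cmod (f w' * g w' - f w * g w) < e" if "cmod (w' - w) < min d1 d2" for w w'
  proof -
    have "f w' * g w' - f w * g w = (f w' - f w) * g w' + f w * (g w' - g w)" by (simp add: algebra_simps)
    then have "cmod (f w' * g w' - f w * g w) \<le> cmod (f w' - f w) * cmod (g w') + cmod (f w) * cmod (g w' - g w)"
      by (metis norm_mult norm_triangle_ineq)
    also have "cmod (f w' - f w) * cmod (g w') \<le> cmod (f w' - f w) * B"
      using B by (intro mult_left_mono) auto
    also have "cmod (f w' - f w) * B < e / (2 * B) * B"
      using d1(2)[of w' w] that B by (intro mult_strict_right_mono) auto
    also have "e / (2 * B) * B = e / 2" using B by simp
    also have "cmod (f w) * cmod (g w' - g w) \<le> A * (e / (2 * A))"
      using d2(2)[of w' w] that A by (intro mult_mono) auto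
    also have "A * (e / (2 * A)) = e / 2" using A by simp
    finally show ?thesis by simp
  qed
  then show "\<exists>d>0. \<forall>w w'. cmod (w' - w) < d \<longrightarrow> cmod (f w' * g w' - f w * g w) < e"
    using d1(1) d2(1) by (intro exI[of _ "min d1 d2"]) auto
qed

lemma BUC_const: "(\<lambda>w. c) \<in> BUC"
  unfolding BUC_iff by (auto intro: exI[of _ 1])

lemma BUC_cnj: "f \<in> BUC \<Longrightarrow> (\<lambda>w. cnj (f w)) \<in> BUC"
  unfolding BUC_iff complex_cnj_diff[symmetric] complex_mod_cnj .

lemma BUC_limit:
  assumes F: "\<And>n. F n \<in> BUC" and lim: "uniform_limit UNIV F f sequentially"
  shows "f \<in> BUC"
proof -
  have ex: "\<exists>n. \<forall>w. cmod (F n w - f w) < e" if "e > 0" for e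
    using uniform_limitD[OF lim that] unfolding eventually_sequentially by (auto simp: dist_norm)
  show ?thesis
    unfolding BUC_iff
  proof (intro conjI allI impI)
    obtain n where n: "\<And>w. cmod (F n w - f w) < 1" using ex[of 1] by auto
    obtain B where B: "\<And>w. cmod (F n w) \<le> B" using BUC_bound[OF F[of n]] by blast
    have "cmod (f w) \<le> B + 1" for w
      using norm_triangle_ineq4[of "F n w" "F n w - f w"] n[of w] B[of w] by simp
    then show "\<exists>B. \<forall>w. cmod (f w) \<le> B" by blast
    fix e :: real assume e: "e > 0"
    then obtain n where n: "\<And>w. cmod (F n w - f w) < e / 3" using ex[of "e/3"] by auto
    have "e / 3 > 0" using e by simp
    then obtain d where d: "d > 0" "\<And>w w'. cmod (w' - w) < d \<Longrightarrow> cmod (F n w' - F n w) < e / 3"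
      using BUC_ucont[OF F[of n]] by blast
    have "cmod (f w' - f w) < e" if "cmod (w' - w) < d" for w w'
    proof -
      have "f w' - f w = (F n w' - F n w) - (F n w' - f w') + (F n w - f w)" by simp
      then have "cmod (f w' - f w) \<le> cmod (F n w' - F n w) + cmod (F n w' - f w') + cmod (F n w - f w)"
        by (metis add_mono_thms_linordered_semiring(3) norm_triangle_ineq norm_triangle_ineq4 order_trans)
      then show ?thesis using n[of w] n[of w'] d(2)[OF that] by simp
    qed
    then show "\<exists>d>0. \<forall>w w'. cmod (w' - w) < d \<longrightarrow> cmod (f w' - f w) < e" using d(1) by blast
  qed
qed

lemma BUC_closed_subspaceI:
  assumes "D \<subseteq> BUC" "(\<lambda>w. 0) \<in> D" "\<And>f g. f \<in> D \<Longrightarrow> g \<in> D \<Longrightarrow> (\<lambda>w. f w + g w) \<in> D"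
    "\<And>c f. f \<in> D \<Longrightarrow> (\<lambda>w. c * f w) \<in> D"
    "\<And>F f. (\<And>n. F n \<in> D) \<Longrightarrow> uniform_limit UNIV F f sequentially \<Longrightarrow> f \<in> D"
  shows "BUC_closed_subspace D"
proof -
  have "\<forall>F f. (\<forall>n. F n \<in> D) \<and> uniform_limit UNIV F f sequentially \<longrightarrow> f \<in> D"
  proof (intro allI impI, elim conjE)
    fix F f assume "\<forall>n. F n \<in> D" "uniform_limit UNIV F f sequentially"
    then show "f \<in> D" by (intro assms(5)[of F f]) auto
  qed
  then show ?thesis
    using assms(1-4) by (simp add: BUC_closed_subspace_def)
qed

lemma BUC_closed_subspaceD:
  assumes "BUC_closed_subspace D"
  shows "D \<subseteq> BUC" "(\<lambda>w. 0) \<in> D" "f \<in> D \<Longrightarrow> g \<in> D \<Longrightarrow> (\<lambda>w. f w + g w) \<in> D"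
    "f \<in> D \<Longrightarrow> (\<lambda>w. c * f w) \<in> D"
  using assms by (simp_all add: BUC_closed_subspace_def)

lemma BUC_closed_subspace_Inter:
  assumes "\<D> \<noteq> {}" "\<And>D. D \<in> \<D> \<Longrightarrow> BUC_closed_subspace D"
  shows "BUC_closed_subspace (\<Inter>\<D>)"
proof (rule BUC_closed_subspaceI)
  show "\<Inter>\<D> \<subseteq> BUC" using assms BUC_closed_subspaceD(1) by blast
  fix F f assume "\<And>n. F n \<in> \<Inter>\<D>" "uniform_limit UNIV F f sequentially"
  then show "f \<in> \<Inter>\<D>" using BUC_closed_limit[OF assms(2), of _ F f] by auto
qed (use assms(2)[THEN BUC_closed_subspaceD(2)] assms(2)[THEN BUC_closed_subspaceD(3)] assms(2)[THEN BUC_closed_subspaceD(4)] in auto)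

lemma BUC_closed_subspace_BUC: "BUC_closed_subspace BUC"
  by (rule BUC_closed_subspaceI) (auto intro: BUC_const BUC_add BUC_mult BUC_limit)

lemma BUC_cstar_BUC: "BUC_cstar_subalgebra BUC"
  by (auto simp: BUC_cstar_subalgebra_def BUC_closed_subspace_BUC BUC_mult BUC_cnj)

lemma BUC_cstar_Inter:
  assumes "\<D> \<noteq> {}" "\<And>D. D \<in> \<D> \<Longrightarrow> BUC_cstar_subalgebra D"
  shows "BUC_cstar_subalgebra (\<Inter>\<D>)"
proof -
  have "BUC_closed_subspace (\<Inter>\<D>)"
    using assms by (intro BUC_closed_subspace_Inter) (auto simp: BUC_cstar_subalgebra_def)
  then show ?thesis
    using assms(2) by (simp add: BUC_cstar_subalgebra_def)
qed

lemma uniform_limit_mult_bounded: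
  assumes lim: "uniform_limit UNIV F f sequentially" and B: "\<And>w::complex. cmod (m w) \<le> B"
  shows "uniform_limit UNIV (\<lambda>n w. F n w * m w) (\<lambda>w. f w * m w :: complex) sequentially"
proof (rule uniform_limitI)
  fix e :: real assume e: "e > 0"
  have B1: "\<bar>B\<bar> + 1 > 0" by simp
  have "\<forall>\<^sub>F n in sequentially. \<forall>w\<in>UNIV. dist (F n w) (f w) < e / (\<bar>B\<bar> + 1)"
    using uniform_limitD[OF lim] e by simp
  then show "\<forall>\<^sub>F n in sequentially. \<forall>w\<in>UNIV. dist (F n w * m w) (f w * m w) < e"
  proof eventually_elim
    case (elim n)
    show ?case
    proof
      fix w
      have "dist (F n w * m w) (f w * m w) = dist (F n w) (f w) * cmod (m w)"
        by (simp add: dist_norm left_diff_distrib[symmetric] norm_mult)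
      also have "\<dots> \<le> dist (F n w) (f w) * (\<bar>B\<bar> + 1)"
        using B[of w] by (intro mult_left_mono) auto
      also have "\<dots> < e / (\<bar>B\<bar> + 1) * (\<bar>B\<bar> + 1)"
        using elim B1 by (intro mult_strict_right_mono) auto
      also have "\<dots> = e" using B1 by simp
      finally show "dist (F n w * m w) (f w * m w) < e" .
    qed
  qed
qed

text \<open>Multiplication by a bounded function is continuous for the sup norm. The pullback
  extends statements on products from generators to the closed subspace that they span, one factor
  at a time.\<close>

lemma closed_subspace_mult_pullback:
  assumes D: "BUC_closed_subspace D" and m: "m \<in> BUC"
  shows "BUC_closed_subspace {f \<in> BUC. (\<lambda>w. f w * m w) \<in> D}"
proof (rule BUC_closed_subspaceI)
  obtain B where B: "\<And>w. cmod (m w) \<le> B" using BUC_bound[OF m] by blast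
  fix F f assume F: "\<And>n. F n \<in> {f \<in> BUC. (\<lambda>w. f w * m w) \<in> D}" and lim: "uniform_limit UNIV F f sequentially"
  have "f \<in> BUC" using F by (intro BUC_limit[OF _ lim]) auto
  moreover have "(\<lambda>w. f w * m w) \<in> D"
    using F by (intro BUC_closed_limit[OF D _ uniform_limit_mult_bounded[OF lim B]]) auto
  ultimately show "f \<in> {f \<in> BUC. (\<lambda>w. f w * m w) \<in> D}" by simp
next
  fix f g assume "f \<in> {f \<in> BUC. (\<lambda>w. f w * m w) \<in> D}" "g \<in> {f \<in> BUC. (\<lambda>w. f w * m w) \<in> D}"
  then show "(\<lambda>w. f w + g w) \<in> {f \<in> BUC. (\<lambda>w. f w * m w) \<in> D}"
    using BUC_closed_subspaceD(3)[OF D, of "\<lambda>w. f w * m w" "\<lambda>w. g w * m w"] by (simp add: BUC_add distrib_right)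
next
  fix c f assume "f \<in> {f \<in> BUC. (\<lambda>w. f w * m w) \<in> D}"
  then show "(\<lambda>w. c * f w) \<in> {f \<in> BUC. (\<lambda>w. f w * m w) \<in> D}"
    using BUC_closed_subspaceD(4)[OF D, of "\<lambda>w. f w * m w" c] by (simp add: BUC_mult BUC_const mult.assoc)
qed (use BUC_closed_subspaceD(2)[OF D] in \<open>auto simp: BUC_const\<close>)

lemma closed_subspace_cnj_pullback:
  assumes D: "BUC_closed_subspace D"
  shows "BUC_closed_subspace {f \<in> BUC. (\<lambda>w. cnj (f w)) \<in> D}"
proof (rule BUC_closed_subspaceI)
  fix F f assume F: "\<And>n. F n \<in> {f \<in> BUC. (\<lambda>w. cnj (f w)) \<in> D}" and lim: "uniform_limit UNIV F f sequentially"
  have "f \<in> BUC" using F by (intro BUC_limit[OF _ lim]) auto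
  moreover have "uniform_limit UNIV (\<lambda>n w. cnj (F n w)) (\<lambda>w. cnj (f w)) sequentially"
    using lim unfolding uniform_limit_iff dist_norm complex_cnj_diff[symmetric] complex_mod_cnj .
  then have "(\<lambda>w. cnj (f w)) \<in> D"
    using F by (rule_tac BUC_closed_limit[OF D, of "\<lambda>n w. cnj (F n w)"]) auto
  ultimately show "f \<in> {f \<in> BUC. (\<lambda>w. cnj (f w)) \<in> D}" by simp
next
  fix f g assume "f \<in> {f \<in> BUC. (\<lambda>w. cnj (f w)) \<in> D}" "g \<in> {f \<in> BUC. (\<lambda>w. cnj (f w)) \<in> D}"
  then show "(\<lambda>w. f w + g w) \<in> {f \<in> BUC. (\<lambda>w. cnj (f w)) \<in> D}"
    using BUC_closed_subspaceD(3)[OF D, of "\<lambda>w. cnj (f w)" "\<lambda>w. cnj (g w)"] by (simp add: BUC_add)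
next
  fix c f assume "f \<in> {f \<in> BUC. (\<lambda>w. cnj (f w)) \<in> D}"
  then show "(\<lambda>w. c * f w) \<in> {f \<in> BUC. (\<lambda>w. cnj (f w)) \<in> D}"
    using BUC_closed_subspaceD(4)[OF D, of "\<lambda>w. cnj (f w)" "cnj c"] by (simp add: BUC_mult BUC_const)
qed (use BUC_closed_subspaceD(2)[OF D] in \<open>auto simp: BUC_const\<close>)

context bargmann
begin

definition rgen :: "complex \<Rightarrow> complex \<Rightarrow> complex \<Rightarrow> complex" where
  "rgen l z w = inverse (l - 2 * \<i> * of_real (sigma t w z))"

lemma sigma_diff: "sigma t w' z - sigma t w z = sigma t (w' - w) z"
  by (simp add: sigma_def left_diff_distrib diff_divide_distrib)

lemma sigma_bound: "\<bar>sigma t w z\<bar> \<le> cmod w * cmod z / t"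
  using abs_Im_le_cmod[of "w * cnj z"] t_pos by (simp add: sigma_def norm_mult divide_right_mono)

lemma rgen_BUC:
  assumes "Re l \<noteq> 0" shows "rgen l z \<in> BUC"
  unfolding BUC_iff
proof (intro conjI allI impI)
  let ?a = "\<bar>Re l\<bar>"
  have a: "?a > 0" using assms by simp
  have lb: "?a \<le> cmod (l - 2 * \<i> * of_real (sigma t w z))" for w
    using abs_Re_le_cmod[of "l - 2 * \<i> * of_real (sigma t w z)"] by simp
  have ne: "l - 2 * \<i> * of_real (sigma t w z) \<noteq> 0" for w using lb[of w] a by auto
  have b: "cmod (rgen l z w) \<le> 1 / ?a" for w
    using lb[of w] a by (simp add: rgen_def norm_inverse divide_inverse le_imp_inverse_le)
  then show "\<exists>B. \<forall>w. cmod (rgen l z w) \<le> B" by blast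
  fix e :: real assume e: "e > 0"
  \<comment> \<open>A Lipschitz constant read off from the resolvent identity below; the added
    \<open>1\<close> keeps it positive for \<open>z = 0\<close>.\<close>
  define L where "L = 2 * cmod z / t * (1 / ?a) * (1 / ?a) + 1"
  have L: "L > 0" using a t_pos by (auto simp: L_def intro!: add_nonneg_pos)
  have "cmod (rgen l z w' - rgen l z w) < e" if "cmod (w' - w) < e / L" for w w'
  proof -
    have "rgen l z w' - rgen l z w = (2 * \<i> * of_real (sigma t (w' - w) z)) * rgen l z w' * rgen l z w"
      unfolding sigma_diff[symmetric] rgen_def using ne[of w] ne[of w'] by (simp add: field_simps)
    then have "cmod (rgen l z w' - rgen l z w) = 2 * \<bar>sigma t (w' - w) z\<bar> * cmod (rgen l z w') * cmod (rgen l z w)"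
      by (simp add: norm_mult)
    also have "\<dots> \<le> 2 * (cmod (w' - w) * cmod z / t) * (1 / ?a) * (1 / ?a)"
      using t_pos a by (intro mult_mono b sigma_bound mult_nonneg_nonneg) auto
    also have "\<dots> \<le> L * cmod (w' - w)"
      unfolding L_def by (simp add: algebra_simps)
    also have "\<dots> < L * (e / L)" using that L by (intro mult_strict_left_mono) auto
    finally show ?thesis using L by simp
  qed
  then show "\<exists>d>0. \<forall>w w'. cmod (w' - w) < d \<longrightarrow> cmod (rgen l z w' - rgen l z w) < e"
    using e L by (intro exI[of _ "e / L"]) auto
qed

lemma R_cl_eq: "R_cl t = \<Inter>{D. BUC_cstar_subalgebra D \<and> (\<forall>l z. Re l \<noteq> 0 \<longrightarrow> rgen l z \<in> D)}"
  unfolding R_cl_def hull_def rgen_def[abs_def] by (rule arg_cong[where f=Inter]) blast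

lemma R_cl_cstar: "BUC_cstar_subalgebra (R_cl t)"
  unfolding R_cl_eq
proof (rule BUC_cstar_Inter)
  \<comment> \<open>\<open>BUC\<close> itself belongs to the family; an empty intersection would be
    \<open>UNIV\<close>.\<close>
  show "{D. BUC_cstar_subalgebra D \<and> (\<forall>l z. Re l \<noteq> 0 \<longrightarrow> rgen l z \<in> D)} \<noteq> {}"
    using BUC_cstar_BUC rgen_BUC by blast
qed simp

lemma R_cl_closed: "BUC_closed_subspace (R_cl t)"
  using R_cl_cstar by (simp add: BUC_cstar_subalgebra_def)

lemma R_cl_mult: "f \<in> R_cl t \<Longrightarrow> g \<in> R_cl t \<Longrightarrow> (\<lambda>w. f w * g w) \<in> R_cl t"
  using R_cl_cstar by (simp add: BUC_cstar_subalgebra_def)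

lemma R_cl_BUC: "f \<in> R_cl t \<Longrightarrow> f \<in> BUC"
  using BUC_closed_subspaceD(1)[OF R_cl_closed] by blast

lemma R_cl_gen: "Re l \<noteq> 0 \<Longrightarrow> rgen l z \<in> R_cl t"
  unfolding R_cl_eq by blast

lemma R_cl_least:
  assumes "BUC_cstar_subalgebra D" "\<And>l z. Re l \<noteq> 0 \<Longrightarrow> rgen l z \<in> D"
  shows "R_cl t \<subseteq> D"
  unfolding R_cl_eq using assms by blast

text \<open>The condition \<open>Re l > 0\<close> selects the generators that are Laplace integrals
  over a ray; by \<open>rgen_minus\<close> the others are negatives of these. Closure under products
  and conjugation is what makes the closed span an algebra.\<close>

inductive_set Mon :: "(complex \<Rightarrow> complex) set" where
  gen: "Re l > 0 \<Longrightarrow> rgen l z \<in> Mon"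
| mult: "f \<in> Mon \<Longrightarrow> g \<in> Mon \<Longrightarrow> (\<lambda>w. f w * g w) \<in> Mon"

lemma sigma_minus: "sigma t w (- z) = - sigma t w z"
  by (simp only: sigma_def complex_cnj_minus mult_minus_right uminus_complex.sel minus_divide_left)

lemma rgen_cnj: "(\<lambda>w. cnj (rgen l z w)) = rgen (cnj l) (- z)"
  by (simp add: rgen_def[abs_def] sigma_minus)

lemma rgen_minus: "rgen l z w = (-1) * rgen (- l) (- z) w"
proof -
  have "- l - 2 * \<i> * of_real (sigma t w (- z)) = - (l - 2 * \<i> * of_real (sigma t w z))"
    by (simp add: sigma_minus)
  then show ?thesis unfolding rgen_def by (simp only: inverse_minus_eq) simp
qed

lemma Mon_cnj: "f \<in> Mon \<Longrightarrow> (\<lambda>w. cnj (f w)) \<in> Mon"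
proof (induction rule: Mon.induct)
  case (gen l z)
  then show ?case unfolding rgen_cnj by (intro Mon.gen) simp
next
  case (mult f g)
  then show ?case by (simp add: Mon.mult)
qed

lemma Mon_BUC: "f \<in> Mon \<Longrightarrow> f \<in> BUC"
  by (induction rule: Mon.induct) (auto intro: rgen_BUC BUC_mult)

text \<open>The least closed subspace containing \<open>Mon\<close>, called \<open>D0\<close> inside
  the proof, is already a C*-algebra with all generators. Hence a linear and uniformly closed
  statement about \<open>R_cl\<close> has to be verified on monomials only.\<close>

lemma R_cl_subset_closed_subspace:
  assumes "BUC_closed_subspace D" "Mon \<subseteq> D"
  shows "R_cl t \<subseteq> D"
proof -
  let ?F = "{D. BUC_closed_subspace D \<and> Mon \<subseteq> D}"
  define D0 where "D0 = \<Inter>?F"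
  have ne: "?F \<noteq> {}" using assms by blast
  have D0: "BUC_closed_subspace D0" unfolding D0_def by (rule BUC_closed_subspace_Inter[OF ne]) simp
  have MD0: "Mon \<subseteq> D0" unfolding D0_def by blast
  have least: "D0 \<subseteq> D'" if "BUC_closed_subspace D'" "Mon \<subseteq> D'" for D' unfolding D0_def using that by blast
  have D0_BUC: "f \<in> BUC" if "f \<in> D0" for f using BUC_closed_subspaceD(1)[OF D0] that by blast
  \<comment> \<open>One factor runs over the closed span while the other stays a monomial;
    \<open>m2\<close> releases the second factor, with \<open>m1\<close> as the case of
    generators.\<close>
  have m1: "(\<lambda>w. f w * m w) \<in> D0" if "f \<in> D0" "m \<in> Mon" for f m
  proof -
    have "D0 \<subseteq> {f \<in> BUC. (\<lambda>w. f w * m w) \<in> D0}"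
    proof (rule least[OF closed_subspace_mult_pullback[OF D0 Mon_BUC[OF that(2)]]], safe)
      fix f assume f: "f \<in> Mon"
      then show "f \<in> BUC" by (rule Mon_BUC)
      show "(\<lambda>w. f w * m w) \<in> D0" using MD0 Mon.mult[OF f that(2)] by (rule subsetD)
    qed
    then show ?thesis using that by blast
  qed
  have m2: "(\<lambda>w. g w * f w) \<in> D0" if "f \<in> D0" "g \<in> D0" for f g
  proof -
    have "Mon \<subseteq> {g \<in> BUC. (\<lambda>w. g w * f w) \<in> D0}"
    proof safe
      fix m assume m: "m \<in> Mon"
      then show "m \<in> BUC" by (rule Mon_BUC)
      show "(\<lambda>w. m w * f w) \<in> D0" using m1[OF that(1) m] by (simp add: mult.commute)
    qed
    then have "D0 \<subseteq> {g \<in> BUC. (\<lambda>w. g w * f w) \<in> D0}"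
      by (rule least[OF closed_subspace_mult_pullback[OF D0 D0_BUC[OF that(1)]]])
    then show ?thesis using that by blast
  qed
  have m3: "(\<lambda>w. cnj (f w)) \<in> D0" if "f \<in> D0" for f
  proof -
    have "D0 \<subseteq> {f \<in> BUC. (\<lambda>w. cnj (f w)) \<in> D0}"
    proof (rule least[OF closed_subspace_cnj_pullback[OF D0]], safe)
      fix f assume f: "f \<in> Mon"
      then show "f \<in> BUC" by (rule Mon_BUC)
      show "(\<lambda>w. cnj (f w)) \<in> D0" using MD0 Mon_cnj[OF f] by (rule subsetD)
    qed
    then show ?thesis using that by blast
  qed
  have "R_cl t \<subseteq> D0"
  proof (rule R_cl_least)
    show "BUC_cstar_subalgebra D0"
      using D0 m2 m3 by (simp add: BUC_cstar_subalgebra_def)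
    fix l z assume l: "Re l \<noteq> 0"
    show "rgen l z \<in> D0"
    proof (cases "Re l > 0")
      case True then show ?thesis by (intro subsetD[OF MD0] Mon.gen)
    next
      case False
      then have "rgen (- l) (- z) \<in> D0" using l by (intro subsetD[OF MD0] Mon.gen) simp
      then have "(\<lambda>w. (-1) * rgen (- l) (- z) w) \<in> D0" by (rule BUC_closed_subspaceD(4)[OF D0])
      then show ?thesis unfolding rgen_minus[symmetric] .
    qed
  qed
  then show ?thesis using least[OF assms] by blast
qed

lemma rgen_alpha: "alpha u (rgen l z) = rgen (l + 2 * \<i> * of_real (sigma t u z)) z"
  by (simp add: alpha_def rgen_def[abs_def] sigma_diff[symmetric] algebra_simps)

text \<open>A translation changes only the imaginary part of \<open>l\<close> in a generator, so the
  generators with complex \<open>l\<close> are mapped to generators. With real \<open>l\<close>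
  alone the generating set would not be invariant.\<close>

lemma R_cl_alpha_invariant: "alpha_invariant (R_cl t)"
proof -
  have "(\<lambda>w. f (w - u)) \<in> R_cl t" if f: "f \<in> R_cl t" for f u
  proof -
    have "R_cl t \<subseteq> {f \<in> BUC. (\<lambda>w. f (w - u)) \<in> R_cl t}" (is "_ \<subseteq> ?D")
    proof (rule R_cl_least)
      have "BUC_closed_subspace ?D"
      proof (rule BUC_closed_subspaceI)
        fix F f assume F: "\<And>n. F n \<in> ?D" and lim: "uniform_limit UNIV F f sequentially"
        have "f \<in> BUC" using F by (intro BUC_limit[OF _ lim]) auto
        moreover have "uniform_limit UNIV (\<lambda>n w. F n (w - u)) (\<lambda>w. f (w - u)) sequentially"
        proof (rule uniform_limitI)
          fix e :: real assume "e > 0"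
          from uniform_limitD[OF lim this]
          show "\<forall>\<^sub>F n in sequentially. \<forall>w\<in>UNIV. dist (F n (w - u)) (f (w - u)) < e"
            by (rule eventually_mono) simp
        qed
        then have "(\<lambda>w. f (w - u)) \<in> R_cl t"
          using F by (rule_tac BUC_closed_limit[OF R_cl_closed, of "\<lambda>n w. F n (w - u)"]) auto
        ultimately show "f \<in> ?D" by simp
      next
        fix f g assume "f \<in> ?D" "g \<in> ?D"
        then show "(\<lambda>w. f w + g w) \<in> ?D"
          using BUC_closed_subspaceD(3)[OF R_cl_closed, of "\<lambda>w. f (w - u)" "\<lambda>w. g (w - u)"] by (simp add: BUC_add)
      next
        fix c f assume "f \<in> ?D"
        then show "(\<lambda>w. c * f w) \<in> ?D"
          using BUC_closed_subspaceD(4)[OF R_cl_closed, of "\<lambda>w. f (w - u)" c] by (simp add: BUC_mult BUC_const)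
      qed (use BUC_closed_subspaceD(2)[OF R_cl_closed] in \<open>auto simp: BUC_const\<close>)
      then show "BUC_cstar_subalgebra ?D"
        using R_cl_cstar R_cl_mult by (auto simp: BUC_cstar_subalgebra_def BUC_mult BUC_cnj)
      fix l z assume l: "Re l \<noteq> 0"
      have "(\<lambda>w. rgen l z (w - u)) = rgen (l + 2 * \<i> * of_real (sigma t u z)) z"
        using rgen_alpha[of u l z] by (simp add: alpha_def)
      then show "rgen l z \<in> ?D" using l by (auto simp: rgen_BUC intro!: R_cl_gen)
    qed
    then show ?thesis using f by blast
  qed
  then show ?thesis by (simp add: alpha_invariant_def alpha_def)
qed

section \<open>C*-algebras of operators and generators of the resolvent algebra\<close>

lemma op_cstarD:
  assumes "op_cstar_subalgebra t S"
  shows "S \<subseteq> bounded_ops t" "(\<lambda>g w. 0) \<in> S" "A \<in> S \<Longrightarrow> B \<in> S \<Longrightarrow> (\<lambda>g w. A g w + B g w) \<in> S"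
     "A \<in> S \<Longrightarrow> (\<lambda>g w. c * A g w) \<in> S" "A \<in> S \<Longrightarrow> B \<in> S \<Longrightarrow> A \<circ> B \<in> S"
     "A \<in> S \<Longrightarrow> is_op_adjoint t A B \<Longrightarrow> B \<in> S" "op_closure t S \<subseteq> S"
  using assms by (simp_all add: op_cstar_subalgebra_def)

lemma op_cstar_bounded_ops: "op_cstar_subalgebra t (bounded_ops t)"
  unfolding op_cstar_subalgebra_def
  using bounded_ops_zero bounded_ops_add bounded_ops_cmult bounded_ops_comp op_closure_bounded
  by (auto simp: is_op_adjoint_def)

lemma op_cstar_Inter:
  assumes "\<S> \<noteq> {}" "\<And>S. S \<in> \<S> \<Longrightarrow> op_cstar_subalgebra t S"
  shows "op_cstar_subalgebra t (\<Inter>\<S>)"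
proof -
  note 1 = op_cstarD[OF assms(2)]
  have cl: "op_closure t (\<Inter>\<S>) \<subseteq> \<Inter>\<S>"
  proof (rule Inter_greatest)
    fix S assume S: "S \<in> \<S>"
    show "op_closure t (\<Inter>\<S>) \<subseteq> S"
      using op_closure_mono[OF Inter_lower[OF S]] 1(7)[OF S] by (rule order_trans)
  qed
  have bd: "\<Inter>\<S> \<subseteq> bounded_ops t" using assms(1) 1(1) by blast
  show ?thesis
    unfolding op_cstar_subalgebra_def
  proof (intro conjI ballI allI impI)
    show "\<Inter>\<S> \<subseteq> bounded_ops t" "op_closure t (\<Inter>\<S>) \<subseteq> \<Inter>\<S>" by (fact bd, fact cl)
    show "(\<lambda>g w. 0) \<in> \<Inter>\<S>" using 1(2) by (rule InterI)
    fix A B assume A: "A \<in> \<Inter>\<S>"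
    show "(\<lambda>g w. c * A g w) \<in> \<Inter>\<S>" for c
      by (rule InterI, rule 1(4), assumption, rule InterD[OF A])
    show "B \<in> \<Inter>\<S>" if "is_op_adjoint t A B" 
      by (rule InterI, rule 1(6)[OF _ InterD[OF A] that])
    assume B: "B \<in> \<Inter>\<S>"
    show "(\<lambda>g w. A g w + B g w) \<in> \<Inter>\<S>" 
      by (rule InterI, rule 1(3), assumption, rule InterD[OF A], assumption, rule InterD[OF B])
    show "A \<circ> B \<in> \<Inter>\<S>" 
      by (rule InterI, rule 1(5), assumption, rule InterD[OF A], assumption, rule InterD[OF B])
  qed
qed

abbreviation RR :: "fock_op set" where "RR \<equiv> resolvent_algebra t"

text \<open>Every resolvent is a scalar multiple of some \<open>Q u\<close>, and
  \<open>l = 1\<close>, \<open>z = - u\<close> yields \<open>Q u\<close> up to the factor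
  \<open>1 / \<i>\<close>, so both families generate the same C*-algebra.\<close>

lemma RR_eq: "RR = \<Inter>{S. op_cstar_subalgebra t S \<and> (\<forall>u. Q u \<in> S)}"
proof -
  have eq: "{toeplitz_resolvent t (\<lambda>w. complex_of_real (2 * sigma t w z)) (\<i> * complex_of_real l) | l z. l \<noteq> 0} \<subseteq> S
     \<longleftrightarrow> (\<forall>u. Q u \<in> S)" (is "?G \<subseteq> S \<longleftrightarrow> _") if S: "op_cstar_subalgebra t S" for S
  proof
    note sc = op_cstarD(4)[OF S]
    {
      assume G: "?G \<subseteq> S"
      show "\<forall>u. Q u \<in> S"
      proof
        fix u
        have "toeplitz_resolvent t (\<lambda>w. complex_of_real (2 * sigma t w (- u))) (\<i> * complex_of_real 1) \<in> S"
          using G by (rule subsetD) (rule CollectI, rule exI[of _ 1], rule exI[of _ "- u"], simp)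
        moreover have "toeplitz_resolvent t (\<lambda>w. complex_of_real (2 * sigma t w (- u))) (\<i> * complex_of_real 1)
           = (\<lambda>g w. 1 / (\<i> * of_real 1) * Q (- (- u) / of_real 1) g w)"
          by (rule resolvent_eq) simp
        ultimately have "(\<lambda>g w. 1 / (\<i> * of_real 1) * Q (- (- u) / of_real 1) g w) \<in> S"
          by (simp only:)
        from sc[OF this, of \<i>] show "Q u \<in> S" by simp
      qed
    next
      assume Q: "\<forall>u. Q u \<in> S"
      show "?G \<subseteq> S"
      proof (rule subsetI, elim CollectE exE conjE, simp only:)
        fix l :: real and z assume "l \<noteq> 0"
        show "toeplitz_resolvent t (\<lambda>w. complex_of_real (2 * sigma t w z)) (\<i> * complex_of_real l) \<in> S"
          unfolding resolvent_eq[OF \<open>l \<noteq> 0\<close>] by (rule sc, rule Q[rule_format])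
      qed
    }
  qed
  show ?thesis
    unfolding resolvent_algebra_def hull_def by (rule arg_cong[where f=Inter], rule Collect_cong) (simp only: eq cong: conj_cong)
qed

lemma RR_cstar: "op_cstar_subalgebra t RR"
  unfolding RR_eq
proof (rule op_cstar_Inter)
  show "{S. op_cstar_subalgebra t S \<and> (\<forall>u. Q u \<in> S)} \<noteq> {}"
    using op_cstar_bounded_ops Q_bounded_ops by blast
qed simp

lemma RR_Q: "Q u \<in> RR" unfolding RR_eq by blast

lemma RR_least: "op_cstar_subalgebra t S \<Longrightarrow> (\<And>u. Q u \<in> S) \<Longrightarrow> RR \<subseteq> S"
  unfolding RR_eq by blast

end

section \<open>Densities on rays and products\<close>

lemma integrable_pair_mult:
  fixes f :: "'a \<Rightarrow> complex" and g :: "'b \<Rightarrow> complex"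
  assumes "pair_sigma_finite M N" "integrable M f" "integrable N g"
  shows "integrable (M \<Otimes>\<^sub>M N) (\<lambda>p. f (fst p) * g (snd p))"
proof -
  interpret pair_sigma_finite M N by fact
  have [measurable]: "f \<in> borel_measurable M" "g \<in> borel_measurable N" using assms by auto
  show ?thesis
  proof (rule Fubini_integrable)
    show "integrable M (\<lambda>x. \<integral>y. norm (f (fst (x, y)) * g (snd (x, y))) \<partial>N)"
      using assms by (simp add: norm_mult)
    show "AE x in M. integrable N (\<lambda>y. f (fst (x, y)) * g (snd (x, y)))"
      using assms by simp
  qed measurable
qed

context bargmann
begin

text \<open>Both memberships go through a single induction because both are stable under linear
  combinations and L1 limits of the density. The factor \<open>ph\<close> has modulus one and leaves
  L1 distances unchanged; on product spaces it will be the Weyl phase.\<close>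

lemma FW_induct:
  fixes \<phi> :: "'a \<Rightarrow> complex"
  assumes fin: "finite_measure M" "space M = UNIV"
    and gen: "sets M = sigma_sets UNIV G" "Int_stable G" "UNIV \<in> G"
    and V: "V \<in> borel_measurable M" and ph: "ph \<in> borel_measurable M" "\<And>x. cmod (ph x) = 1"
    and base: "\<And>A. A \<in> G \<Longrightarrow> FTint M (indicator A) V \<in> R_cl t" "\<And>A. A \<in> G \<Longrightarrow> Wint M (\<lambda>x. indicator A x * ph x) V \<in> RR"
    and \<phi>: "integrable M \<phi>"
  shows "FTint M \<phi> V \<in> R_cl t \<and> Wint M (\<lambda>x. \<phi> x * ph x) V \<in> RR"
proof -
  have iph: "integrable M (\<lambda>x. f x * ph x)" if "integrable M f" for f
    using that ph by (intro Bochner_Integration.integrable_bound[OF that]) (auto simp: norm_mult)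
  show ?thesis
  proof (rule integrable_induct_pi_system[where P="\<lambda>\<phi>. FTint M \<phi> V \<in> R_cl t \<and> Wint M (\<lambda>x. \<phi> x * ph x) V \<in> RR", OF fin gen \<phi>])
    show "FTint M (indicator A) V \<in> R_cl t \<and> Wint M (\<lambda>x. indicator A x * ph x) V \<in> RR" if "A \<in> G" for A
      using base that by simp
  next
    fix f g assume "integrable M f" "integrable M g" "FTint M f V \<in> R_cl t \<and> Wint M (\<lambda>x. f x * ph x) V \<in> RR"
      "FTint M g V \<in> R_cl t \<and> Wint M (\<lambda>x. g x * ph x) V \<in> RR"
    then show "FTint M (\<lambda>x. f x + g x) V \<in> R_cl t \<and> Wint M (\<lambda>x. (f x + g x) * ph x) V \<in> RR"
      by (simp add: FTint_add[OF V] Wint_add[OF V iph iph] distrib_right BUC_closed_subspaceD(3)[OF R_cl_closed] op_cstarD(3)[OF RR_cstar])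
  next
    fix f c assume "integrable M f" "FTint M f V \<in> R_cl t \<and> Wint M (\<lambda>x. f x * ph x) V \<in> RR"
    then show "FTint M (\<lambda>x. c * f x) V \<in> R_cl t \<and> Wint M (\<lambda>x. c * f x * ph x) V \<in> RR"
      by (simp add: FTint_cmult Wint_cmult mult.assoc BUC_closed_subspaceD(4)[OF R_cl_closed] op_cstarD(4)[OF RR_cstar])
  next
    fix s f assume s: "\<And>n. integrable M (s n)" "integrable M f"
      "\<And>n. FTint M (s n) V \<in> R_cl t \<and> Wint M (\<lambda>x. s n x * ph x) V \<in> RR"
      "(\<lambda>n::nat. \<integral>x. cmod (s n x - f x) \<partial>M) \<longlonglongrightarrow> 0"
    have "cmod (s n x * ph x - f x * ph x) = cmod (s n x - f x)" for n x
      unfolding left_diff_distrib[symmetric] norm_mult ph(2) by simp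
    then have lim: "(\<lambda>n. \<integral>x. cmod (s n x * ph x - f x * ph x) \<partial>M) \<longlonglongrightarrow> 0"
      using s(4) by simp
    have "FTint M f V \<in> R_cl t"
      by (rule FTint_limit[OF V s(1,2) _ R_cl_closed s(4)]) (use s(3) in simp)
    moreover have "Wint M (\<lambda>x. f x * ph x) V \<in> RR"
      by (rule Wint_limit[OF fin(1) V iph[OF s(1)] iph[OF s(2)] _ op_cstarD(7)[OF RR_cstar] lim]) (use s(3) in simp)
    ultimately show "FTint M f V \<in> R_cl t \<and> Wint M (\<lambda>x. f x * ph x) V \<in> RR" ..
  qed
qed

text \<open>The weight \<open>exp (- s) ^ j\<close> moves the point of the Laplace transform from
  \<open>1\<close> to \<open>1 + j\<close>.\<close>

lemma expm_moment_FT: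
  "FTint expm (\<lambda>s. of_real (exp (- s) ^ j)) (\<lambda>s. of_real s * z) = rgen (1 + of_nat j) z"
proof
  fix w
  have "FTint expm (\<lambda>s. of_real (exp (- s) ^ j)) (\<lambda>s. of_real s * z) w
    = (\<integral>s. exp (- (of_nat j - 2 * \<i> * of_real (sigma t w z)) * of_real s) \<partial>expm)"
    unfolding FTint_def
  proof (rule Bochner_Integration.integral_cong[OF refl])
    fix s
    have "sigma t w (of_real s * z) = s * sigma t w z"
      by (simp add: sigma_def algebra_simps)
    moreover have "complex_of_real (exp (- s) ^ j) = exp (- of_nat j * of_real s)"
      by (simp add: exp_of_nat_mult[symmetric] exp_of_real[symmetric])
    ultimately show "of_real (exp (- s) ^ j) * exp (2 * \<i> * of_real (sigma t w (of_real s * z)))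
       = exp (- (of_nat j - 2 * \<i> * of_real (sigma t w z)) * of_real s)"
      by (simp add: exp_add[symmetric] algebra_simps)
  qed
  also have "\<dots> = rgen (1 + of_nat j) z w"
    by (subst expm_exp_integral) (auto simp: rgen_def divide_inverse add_diff_eq)
  finally show "FTint expm (\<lambda>s. of_real (exp (- s) ^ j)) (\<lambda>s. of_real s * z) w = rgen (1 + of_nat j) z w" .
qed

text \<open>Substituting \<open>(1 + j) * s\<close> restores the standard exponential weight at the
  price of dividing the direction by \<open>1 + j\<close>; the result is again a multiple of a
  generator.\<close>

lemma expm_moment_W:
  "Wint expm (\<lambda>s. of_real (exp (- s) ^ j)) (\<lambda>s. of_real s * z)
    = (\<lambda>g w. 1 / (1 + of_nat j) * Q (z / (1 + of_nat j)) g w)"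
proof (intro ext)
  fix g w
  show "Wint expm (\<lambda>s. of_real (exp (- s) ^ j)) (\<lambda>s. of_real s * z) g w = 1 / (1 + of_nat j) * Q (z / (1 + of_nat j)) g w"
  proof (cases "g \<in> fock t")
    case True
    have [measurable]: "g \<in> borel_measurable borel" using True by (rule fock_measurable)
    define a where "a = 1 + real j"
    have a: "a > 0" by (simp add: a_def)
    have ac: "complex_of_real a = 1 + of_nat j" by (simp add: a_def)
    have "(\<integral>s. of_real (exp (- s) ^ j) * W (of_real s * z) g w \<partial>expm) =
      (\<integral>s. exponential_density 1 s *\<^sub>R (of_real (exp (- s) ^ j) * W (of_real s * z) g w) \<partial>lborel)"
      by (rule integral_expm) measurable
    also have "\<dots> = (\<integral>s. exponential_density 1 (a * s) *\<^sub>R W (of_real (a * s) * (z / of_real a)) g w \<partial>lborel)"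
    proof (rule Bochner_Integration.integral_cong[OF refl])
      fix s
      have e1: "exponential_density 1 s * exp (- s) ^ j = exponential_density 1 (a * s)"
      proof -
        have "exp (- s) * exp (- s) ^ j = exp (- (a * s))"
          by (simp add: a_def exp_of_nat_mult[symmetric] exp_add[symmetric] algebra_simps)
        moreover have "a * s < 0 \<longleftrightarrow> s < 0"
          using a by (simp add: mult_less_0_iff)
        ultimately show ?thesis by (simp add: exponential_density_def mult.commute)
      qed
      have e2: "of_real (a * s) * (z / of_real a) = of_real s * z" using a by simp
      show "exponential_density 1 s *\<^sub>R (of_real (exp (- s) ^ j) * W (of_real s * z) g w)
         = exponential_density 1 (a * s) *\<^sub>R W (of_real (a * s) * (z / of_real a)) g w"
        unfolding e2 e1[symmetric] by (simp add: scaleR_conv_of_real mult.assoc)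
    qed
    also have "\<dots> = (1 / a) *\<^sub>R (\<integral>s. exponential_density 1 s *\<^sub>R W (of_real s * (z / of_real a)) g w \<partial>lborel)"
      using lborel_integral_real_affine[of a "\<lambda>s. exponential_density 1 s *\<^sub>R W (of_real s * (z / of_real a)) g w" 0] a by simp
    also have "(\<integral>s. exponential_density 1 s *\<^sub>R W (of_real s * (z / of_real a)) g w \<partial>lborel) = (\<integral>s. W (of_real s * (z / of_real a)) g w \<partial>expm)"
      by (rule integral_expm[symmetric]) measurable
    finally show ?thesis
      using True by (simp add: Wint_def Q_def ac scaleR_conv_of_real)
  qed (simp add: Wint_def Q_def)
qed

lemma expm_poly:
  assumes "real_polynomial_function q"
  shows "FTint expm (\<lambda>s. of_real (q (exp (- s)))) (\<lambda>s. of_real s * z) \<in> R_cl t"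
    "Wint expm (\<lambda>s. of_real (q (exp (- s)))) (\<lambda>s. of_real s * z) \<in> RR"
    "integrable expm (\<lambda>s. complex_of_real (q (exp (- s))))"
proof -
  obtain a n where q: "q = (\<lambda>x. \<Sum>i\<le>n. a i * x ^ i)"
    using assms unfolding real_polynomial_function_iff_sum by blast
  have V: "(\<lambda>s. of_real s * z) \<in> borel_measurable expm" by simp
  have im: "integrable expm (\<lambda>s. complex_of_real (exp (- s) ^ j))" for j
    by (rule integrable_expm_bounded[where B=1]) (auto simp: norm_power power_le_one)
  have "FTint expm (\<lambda>s. \<Sum>i\<le>n. of_real (a i) * of_real (exp (- s) ^ i)) (\<lambda>s. of_real s * z) \<in> R_cl t \<and>
     Wint expm (\<lambda>s. \<Sum>i\<le>n. of_real (a i) * of_real (exp (- s) ^ i)) (\<lambda>s. of_real s * z) \<in> RR" for n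
  proof (induction n)
    have *: "FTint expm (\<lambda>s. of_real (a i) * of_real (exp (- s) ^ i)) (\<lambda>s. of_real s * z) \<in> R_cl t \<and>
      Wint expm (\<lambda>s. of_real (a i) * of_real (exp (- s) ^ i)) (\<lambda>s. of_real s * z) \<in> RR" for i
      unfolding FTint_cmult Wint_cmult expm_moment_FT expm_moment_W
      by (rule conjI; rule BUC_closed_subspaceD(4)[OF R_cl_closed] op_cstarD(4)[OF RR_cstar];
         (rule op_cstarD(4)[OF RR_cstar])?; (rule R_cl_gen RR_Q)) simp
    {
      case 0 then show ?case using *[of 0] by simp
    next
      case (Suc n)
      have i1: "integrable expm (\<lambda>s. \<Sum>i\<le>n. complex_of_real (a i) * of_real (exp (- s) ^ i))"
        by (intro Bochner_Integration.integrable_sum integrable_mult_right im)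
      have i2: "integrable expm (\<lambda>s. complex_of_real (a (Suc n)) * of_real (exp (- s) ^ Suc n))"
        by (intro integrable_mult_right im)
      show ?case
        unfolding sum.atMost_Suc FTint_add[OF V i1 i2] Wint_add[OF V i1 i2]
        using Suc *[of "Suc n"] BUC_closed_subspaceD(3)[OF R_cl_closed] op_cstarD(3)[OF RR_cstar] by blast
    }
  qed
  moreover have "(\<lambda>s. complex_of_real (q (exp (- s)))) = (\<lambda>s. \<Sum>i\<le>n. of_real (a i) * of_real (exp (- s) ^ i))"
    by (simp add: q)
  moreover have "integrable expm (\<lambda>s. \<Sum>i\<le>n. complex_of_real (a i) * of_real (exp (- s) ^ i))"
    by (intro Bochner_Integration.integrable_sum integrable_mult_right im)
  ultimately show "FTint expm (\<lambda>s. of_real (q (exp (- s)))) (\<lambda>s. of_real s * z) \<in> R_cl t"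
    "Wint expm (\<lambda>s. of_real (q (exp (- s)))) (\<lambda>s. of_real s * z) \<in> RR"
    "integrable expm (\<lambda>s. complex_of_real (q (exp (- s))))" by simp_all
qed

text \<open>For \<open>s \<ge> 0\<close> the variable \<open>exp (- s)\<close> stays in
  \<open>{0..1}\<close>, where the Weierstrass theorem applies. As \<open>expm\<close> is a
  probability measure concentrated there, the uniform error bounds the L1 error.\<close>

lemma expm_continuous:
  assumes c: "continuous_on UNIV q"
  shows "FTint expm (\<lambda>s. of_real (q (exp (- s)))) (\<lambda>s. of_real s * z) \<in> R_cl t"
    "Wint expm (\<lambda>s. of_real (q (exp (- s)))) (\<lambda>s. of_real s * z) \<in> RR"
    "integrable expm (\<lambda>s. complex_of_real (q (exp (- s))))"
proof -
  interpret X: prob_space expm by (rule expm_prob_space)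
  have c1: "continuous_on {0..1} q" using c continuous_on_subset by blast
  have "\<exists>p. real_polynomial_function p \<and> (\<forall>x\<in>{0..1}. \<bar>q x - p x\<bar> < 1 / (real n + 1))" for n
  proof -
    have "1 / (real n + 1) > 0" by simp
    from Stone_Weierstrass_real_polynomial_function[OF compact_Icc c1 this] obtain g
      where "real_polynomial_function g" "\<And>x. x \<in> {0..1} \<Longrightarrow> \<bar>q x - g x\<bar> < 1 / (real n + 1)" by blast
    then show ?thesis by (intro exI[of _ g]) simp
  qed
  then have "\<exists>p. \<forall>n. real_polynomial_function (p n) \<and> (\<forall>x\<in>{0..1}. \<bar>q x - p n x\<bar> < 1 / (real n + 1))"
    by (intro choice allI)
  then obtain p where p: "\<And>n. real_polynomial_function (p n)" "\<And>n x. x \<in> {0..1} \<Longrightarrow> \<bar>q x - p n x\<bar> < 1 / (real n + 1)"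
    by blast
  have V: "(\<lambda>s. of_real s * z) \<in> borel_measurable expm" by simp
  have [measurable]: "q \<in> borel_measurable borel" using c by (rule borel_measurable_continuous_onI)
  have pm[measurable]: "p n \<in> borel_measurable borel" for n
    using p(1)[of n] by (intro borel_measurable_continuous_onI continuous_on_polymonial_function) (simp add: real_polynomial_function_eq)
  have d: "cmod (of_real (p n (exp (- s))) - of_real (q (exp (- s)))) \<le> 1 / (real n + 1)" if "s \<ge> 0" for n s
  proof -
    have "\<bar>q (exp (- s)) - p n (exp (- s))\<bar> < 1 / (real n + 1)" using that by (intro p(2)) auto
    then show ?thesis unfolding of_real_diff[symmetric] norm_of_real by (simp add: abs_minus_commute)
  qed
  have di: "integrable expm (\<lambda>s. complex_of_real (p n (exp (- s))) - of_real (q (exp (- s))))" for n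
    by (rule integrable_expm_bounded[OF _ d]) measurable
  show i: "integrable expm (\<lambda>s. complex_of_real (q (exp (- s))))"
    using Bochner_Integration.integrable_diff[OF expm_poly(3)[OF p(1)[of 0]] di[of 0]] by simp
  have lim: "(\<lambda>n. \<integral>s. cmod (of_real (p n (exp (- s))) - of_real (q (exp (- s)))) \<partial>expm) \<longlonglongrightarrow> 0"
  proof (rule tendsto_sandwich[where f="\<lambda>_. 0" and h="\<lambda>n. 1 / (real n + 1)"])
    have "(\<integral>s. cmod (of_real (p n (exp (- s))) - of_real (q (exp (- s)))) \<partial>expm) \<le> (\<integral>s. 1 / (real n + 1) \<partial>expm)" for n
      using AE_expm d di by (intro integral_mono_AE) auto
    then show "\<forall>\<^sub>F n in sequentially. (\<integral>s. cmod (of_real (p n (exp (- s))) - of_real (q (exp (- s)))) \<partial>expm) \<le> 1 / (real n + 1)"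
      by (simp add: X.prob_space[simplified])
    show "(\<lambda>n. 1 / (real n + 1)) \<longlonglongrightarrow> 0" by real_asymp
  qed auto
  show "FTint expm (\<lambda>s. of_real (q (exp (- s)))) (\<lambda>s. of_real s * z) \<in> R_cl t"
    by (rule FTint_limit[OF V expm_poly(3)[OF p(1)] i expm_poly(1)[OF p(1)] R_cl_closed lim])
  show "Wint expm (\<lambda>s. of_real (q (exp (- s)))) (\<lambda>s. of_real s * z) \<in> RR"
    by (rule Wint_limit[OF expm_finite_measure V expm_poly(3)[OF p(1)] i expm_poly(2)[OF p(1)] op_cstarD(7)[OF RR_cstar] lim])
qed

lemma expm_atMost:
  shows "FTint expm (indicator {..a}) (\<lambda>s. of_real s * z) \<in> R_cl t"
    "Wint expm (indicator {..a}) (\<lambda>s. of_real s * z) \<in> RR"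
proof -
  interpret X: prob_space expm by (rule expm_prob_space)
  have V: "(\<lambda>s. of_real s * z) \<in> borel_measurable expm" by simp
  define c where "c = exp (- a)"
  \<comment> \<open>Continuous ramps in \<open>x = exp (- s)\<close>: equal to \<open>1\<close> for
    \<open>x \<ge> c\<close>, that is for \<open>s \<le> a\<close>, and for positive
    \<open>n\<close> equal to \<open>0\<close> when \<open>x \<le> c - 1 / n\<close>.\<close>
  define q where "q n x = max 0 (min 1 (1 + real n * (x - c)))" for n x
  have qc: "continuous_on UNIV (q n)" for n unfolding q_def by (intro continuous_intros)
  have [measurable]: "q n \<in> borel_measurable borel" for n by (rule borel_measurable_continuous_onI[OF qc])
  have q01: "0 \<le> q n x" "q n x \<le> 1" for n x by (auto simp: q_def)
  have i: "integrable expm (indicator {..a} :: real \<Rightarrow> complex)"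
    by (rule integrable_expm_bounded[where B=1]) (auto simp: indicator_def)
  have lim: "(\<lambda>n. \<integral>s. cmod (of_real (q n (exp (- s))) - indicator {..a} s) \<partial>expm) \<longlonglongrightarrow> 0"
  proof -
    have "(\<lambda>n. \<integral>s. cmod (of_real (q n (exp (- s))) - indicator {..a} s) \<partial>expm) \<longlonglongrightarrow> (\<integral>s. 0 \<partial>expm)"
    proof (rule integral_dominated_convergence[where w="\<lambda>_. 2"])
      show "AE s in expm. norm (cmod (of_real (q n (exp (- s))) - indicator {..a} s)) \<le> 2" for n
      proof (rule AE_I2)
        fix s
        have "cmod (of_real (q n (exp (- s))) - indicator {..a} s) \<le> cmod (of_real (q n (exp (- s)))) + cmod (indicator {..a} s :: complex)"
          by (rule norm_triangle_ineq4)
        also have "\<dots> \<le> 1 + 1" using q01[of n "exp (- s)"] by (intro add_mono) (auto simp: indicator_def)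
        finally show "norm (cmod (of_real (q n (exp (- s))) - indicator {..a} s)) \<le> 2" by simp
      qed
      show "AE s in expm. (\<lambda>n. cmod (of_real (q n (exp (- s))) - indicator {..a} s)) \<longlonglongrightarrow> 0"
      proof (rule AE_I2)
        fix s :: real
        have "\<forall>\<^sub>F n in sequentially. cmod (of_real (q n (exp (- s))) - indicator {..a} s) = 0"
        proof (cases "s \<le> a")
          case True
          then have "exp (- s) \<ge> c" by (simp add: c_def)
          then have "q n (exp (- s)) = 1" for n by (simp add: q_def)
          then show ?thesis using True by simp
        next
          case False
          then have less: "c - exp (- s) > 0" by (simp add: c_def)
          obtain N where N: "1 / (c - exp (- s)) < real N" using reals_Archimedean2 by blast
          show ?thesis
          proof (rule eventually_sequentiallyI[of N])
            fix n assume "N \<le> n"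
            then have "1 / (c - exp (- s)) \<le> real n" using N by simp
            then have "1 \<le> real n * (c - exp (- s))" using less by (simp add: divide_le_eq)
            then have "q n (exp (- s)) = 0" by (simp add: q_def algebra_simps)
            then show "cmod (of_real (q n (exp (- s))) - indicator {..a} s) = 0" using False by simp
          qed
        qed
        then show "(\<lambda>n. cmod (of_real (q n (exp (- s))) - indicator {..a} s)) \<longlonglongrightarrow> 0"
          by (rule tendsto_eventually)
      qed
    qed auto
    then show ?thesis by simp
  qed
  show "FTint expm (indicator {..a}) (\<lambda>s. of_real s * z) \<in> R_cl t"
    by (rule FTint_limit[OF V expm_continuous(3)[OF qc] i expm_continuous(1)[OF qc] R_cl_closed lim])
  show "Wint expm (indicator {..a}) (\<lambda>s. of_real s * z) \<in> RR"
    by (rule Wint_limit[OF expm_finite_measure V expm_continuous(3)[OF qc] i expm_continuous(2)[OF qc] op_cstarD(7)[OF RR_cstar] lim])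
qed

lemma expm_good:
  assumes "integrable expm \<phi>"
  shows "FTint expm \<phi> (\<lambda>s. of_real s * z) \<in> R_cl t" "Wint expm \<phi> (\<lambda>s. of_real s * z) \<in> RR"
proof -
  \<comment> \<open>The half-lines generate but do not include the whole line, for which the
    induction principle asks; \<open>UNIV\<close> is covered by the constant function in
    \<open>expm_continuous\<close>.\<close>
  let ?E = "insert UNIV (range (\<lambda>a::real. {..a}))"
  have 1: "sets expm = sigma_sets UNIV ?E"
  proof -
    have "sets expm = sigma_sets UNIV (range (\<lambda>a::real. {..a}))"
      by (simp add: borel_eq_atMost)
    also have "\<dots> = sigma_sets UNIV ?E"
      by (rule sigma_sets_eqI) (auto intro: sigma_sets.Basic sigma_sets_top)
    finally show ?thesis .
  qed
  have 2: "Int_stable ?E"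
  proof (rule Int_stableI)
    fix A B assume "A \<in> ?E" "B \<in> ?E"
    moreover have "{..a} \<inter> {..b} = {..min a b}" for a b :: real by auto
    ultimately show "A \<inter> B \<in> ?E" by auto
  qed
  have c: "(\<lambda>s. complex_of_real ((\<lambda>_. 1) (exp (- s)))) = (indicator UNIV :: real \<Rightarrow> complex)" by auto
  have "FTint expm \<phi> (\<lambda>s. of_real s * z) \<in> R_cl t \<and> Wint expm (\<lambda>x. \<phi> x * (\<lambda>_. 1) x) (\<lambda>s. of_real s * z) \<in> RR"
  proof (rule FW_induct[OF expm_finite_measure space_expm 1 2 _ _ _ _ _ _ assms])
    fix A assume "A \<in> ?E"
    then consider "A = UNIV" | a where "A = {..a}" by auto
    then have "FTint expm (indicator A) (\<lambda>s. of_real s * z) \<in> R_cl t \<and> Wint expm (indicator A) (\<lambda>s. of_real s * z) \<in> RR"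
      by cases (use expm_continuous(1,2)[of "\<lambda>_. 1" z, unfolded c] expm_atMost in auto)
    then show "FTint expm (indicator A) (\<lambda>s. of_real s * z) \<in> R_cl t" "Wint expm (\<lambda>x. indicator A x * 1) (\<lambda>s. of_real s * z) \<in> RR"
      by auto
  qed auto
  then show "FTint expm \<phi> (\<lambda>s. of_real s * z) \<in> R_cl t" "Wint expm \<phi> (\<lambda>s. of_real s * z) \<in> RR" by auto
qed

section \<open>Products of two parameter spaces\<close>

lemma FTint_pair:
  assumes "pair_sigma_finite M1 M2" and [measurable]: "V1 \<in> borel_measurable M1" "V2 \<in> borel_measurable M2"
    and \<phi>: "integrable M1 \<phi>1" "integrable M2 \<phi>2"
  shows "FTint (M1 \<Otimes>\<^sub>M M2) (\<lambda>p. \<phi>1 (fst p) * \<phi>2 (snd p)) (\<lambda>p. V1 (fst p) + V2 (snd p)) = (\<lambda>w. FTint M1 \<phi>1 V1 w * FTint M2 \<phi>2 V2 w)"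
proof
  fix w
  interpret pair_sigma_finite M1 M2 by fact
  have e: "exp (2 * \<i> * of_real (sigma t w (a + b))) = exp (2 * \<i> * of_real (sigma t w a)) * exp (2 * \<i> * of_real (sigma t w b))" for a b
  proof -
    have "sigma t w (a + b) = sigma t w a + sigma t w b"
      by (simp add: sigma_def distrib_left add_divide_distrib)
    then show ?thesis unfolding exp_add[symmetric] by (simp add: distrib_left)
  qed
  have i: "integrable (M1 \<Otimes>\<^sub>M M2) (\<lambda>p. (\<phi>1 (fst p) * \<phi>2 (snd p)) * exp (2 * \<i> * of_real (sigma t w (V1 (fst p) + V2 (snd p)))))"
    by (rule FTint_integrable[OF _ integrable_pair_mult[OF assms(1) \<phi>]]) measurable
  show "FTint (M1 \<Otimes>\<^sub>M M2) (\<lambda>p. \<phi>1 (fst p) * \<phi>2 (snd p)) (\<lambda>p. V1 (fst p) + V2 (snd p)) w = FTint M1 \<phi>1 V1 w * FTint M2 \<phi>2 V2 w"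
  proof -
    have "(\<integral>y. (\<phi>1 x * \<phi>2 y) * exp (2 * \<i> * of_real (sigma t w (V1 x + V2 y))) \<partial>M2)
       = (\<phi>1 x * exp (2 * \<i> * of_real (sigma t w (V1 x)))) * FTint M2 \<phi>2 V2 w" for x
      unfolding FTint_def e integral_mult_right_zero[symmetric]
      by (rule Bochner_Integration.integral_cong[OF refl]) (simp only: mult_ac)
    then have "FTint (M1 \<Otimes>\<^sub>M M2) (\<lambda>p. \<phi>1 (fst p) * \<phi>2 (snd p)) (\<lambda>p. V1 (fst p) + V2 (snd p)) w
       = (\<integral>x. (\<phi>1 x * exp (2 * \<i> * of_real (sigma t w (V1 x)))) * FTint M2 \<phi>2 V2 w \<partial>M1)"
      using integral_fst'[OF i] by (simp only: FTint_def[of "M1 \<Otimes>\<^sub>M M2"] fst_conv snd_conv)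
    then show ?thesis
      by (simp only: integral_mult_left_zero FTint_def[of M1])
  qed
qed

text \<open>The Weyl relation turns a product of two integrals into one integral over the product
  space; its phase is the only difference from the commutative case
  \<open>FTint_pair\<close>.\<close>

lemma Wint_pair:
  assumes "finite_measure M1" "finite_measure M2" and [measurable]: "V1 \<in> borel_measurable M1" "V2 \<in> borel_measurable M2"
    and \<phi>: "integrable M1 \<phi>1" "integrable M2 \<phi>2"
  shows "Wint (M1 \<Otimes>\<^sub>M M2) (\<lambda>p. \<phi>1 (fst p) * \<phi>2 (snd p) * exp (- \<i> * of_real (sigma t (V1 (fst p)) (V2 (snd p)))))
     (\<lambda>p. V1 (fst p) + V2 (snd p)) = Wint M1 \<phi>1 V1 \<circ> Wint M2 \<phi>2 V2"
proof (intro ext)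
  fix g w
  interpret M1: finite_measure M1 by fact
  interpret M2: finite_measure M2 by fact
  interpret MM: pair_sigma_finite M1 M2 ..
  have [measurable]: "\<phi>1 \<in> borel_measurable M1" "\<phi>2 \<in> borel_measurable M2" using \<phi> by auto
  let ?\<phi> = "\<lambda>p. \<phi>1 (fst p) * \<phi>2 (snd p) * exp (- \<i> * of_real (sigma t (V1 (fst p)) (V2 (snd p))))"
  have i\<phi>: "integrable (M1 \<Otimes>\<^sub>M M2) ?\<phi>"
    by (rule Bochner_Integration.integrable_bound[OF integrable_pair_mult[OF MM.pair_sigma_finite_axioms \<phi>]])
       (auto simp: norm_mult)
  show "Wint (M1 \<Otimes>\<^sub>M M2) ?\<phi> (\<lambda>p. V1 (fst p) + V2 (snd p)) g w = (Wint M1 \<phi>1 V1 \<circ> Wint M2 \<phi>2 V2) g w"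
  proof (cases "g \<in> fock t")
    case g: True
    have i: "integrable (M1 \<Otimes>\<^sub>M M2) (\<lambda>p. ?\<phi> p * W (V1 (fst p) + V2 (snd p)) g w)"
      by (rule Wint_integrable[OF _ i\<phi> g]) measurable
    have inner: "\<phi>1 x * W (V1 x) (Wint M2 \<phi>2 V2 g) w = (\<integral>y. ?\<phi> (x, y) * W (V1 x + V2 y) g w \<partial>M2)" for x
    proof -
      have "E (V1 x) w * W (V2 y) g (w - V1 x) = exp (- \<i> * of_real (sigma t (V1 x) (V2 y))) * W (V1 x + V2 y) g w" for y
        using W_W[of "V1 x" "V2 y" g w] by (simp only: W_def[of "V1 x" "W (V2 y) g"])
      then have "\<phi>1 x * (E (V1 x) w * (\<phi>2 y * W (V2 y) g (w - V1 x))) = ?\<phi> (x, y) * W (V1 x + V2 y) g w" for y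
        by (simp add: mult_ac)
      moreover have "W (V1 x) (Wint M2 \<phi>2 V2 g) w = E (V1 x) w * (\<integral>y. \<phi>2 y * W (V2 y) g (w - V1 x) \<partial>M2)"
      proof -
        have "Wint M2 \<phi>2 V2 g u = (\<integral>y. \<phi>2 y * W (V2 y) g u \<partial>M2)" for u
          using g by (simp add: Wint_def)
        then show ?thesis unfolding W_def[of "V1 x" "Wint M2 \<phi>2 V2 g"] by (simp only:)
      qed
      ultimately show ?thesis
        by (simp only: integral_mult_right_zero[symmetric])
    qed
    have "Wint (M1 \<Otimes>\<^sub>M M2) ?\<phi> (\<lambda>p. V1 (fst p) + V2 (snd p)) g w = (\<integral>x. (\<integral>y. ?\<phi> (x, y) * W (V1 x + V2 y) g w \<partial>M2) \<partial>M1)"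
      using g MM.integral_fst'[OF i] by (simp add: Wint_def)
    also have "\<dots> = (Wint M1 \<phi>1 V1 \<circ> Wint M2 \<phi>2 V2) g w"
      using Wint_fock[OF assms(2,4) \<phi>(2) g] unfolding inner[symmetric] by (simp add: Wint_def[of M1])
    finally show ?thesis .
  next
    case False
    have "W v (\<lambda>w. 0) = (\<lambda>w. 0)" for v by (simp add: W_def fun_eq_iff)
    then show ?thesis using False by (simp add: Wint_def)
  qed
qed

lemma integrable_indicator_complex:
  "finite_measure M \<Longrightarrow> A \<in> sets M \<Longrightarrow> integrable M (indicator A :: _ \<Rightarrow> complex)"
  by (intro finite_measure.integrable_const_bound[where B=1]) (auto simp: indicator_def)

text \<open>The phase has modulus one, so it may be moved between the density and the Weyl operators.\<close>

lemma pair_good: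
  fixes \<phi> :: "'a \<times> 'b \<Rightarrow> complex"
  assumes fin: "finite_measure M1" "finite_measure M2" and sp: "space M1 = UNIV" "space M2 = UNIV"
    and V[measurable]: "V1 \<in> borel_measurable M1" "V2 \<in> borel_measurable M2"
    and g1: "\<And>\<phi>. integrable M1 \<phi> \<Longrightarrow> FTint M1 \<phi> V1 \<in> R_cl t" "\<And>\<phi>. integrable M1 \<phi> \<Longrightarrow> Wint M1 \<phi> V1 \<in> RR"
    and g2: "\<And>\<phi>. integrable M2 \<phi> \<Longrightarrow> FTint M2 \<phi> V2 \<in> R_cl t" "\<And>\<phi>. integrable M2 \<phi> \<Longrightarrow> Wint M2 \<phi> V2 \<in> RR"
    and \<phi>: "integrable (M1 \<Otimes>\<^sub>M M2) \<phi>"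
  shows "FTint (M1 \<Otimes>\<^sub>M M2) \<phi> (\<lambda>p. V1 (fst p) + V2 (snd p)) \<in> R_cl t"
    "Wint (M1 \<Otimes>\<^sub>M M2) \<phi> (\<lambda>p. V1 (fst p) + V2 (snd p)) \<in> RR"
proof -
  interpret M1: finite_measure M1 by fact
  interpret M2: finite_measure M2 by fact
  interpret MM: pair_sigma_finite M1 M2 ..
  note ind = integrable_indicator_complex
  have finP: "finite_measure (M1 \<Otimes>\<^sub>M M2)"
    by (rule finite_measure_pair_measure[OF fin(2,1)])
  let ?V = "\<lambda>p. V1 (fst p) + V2 (snd p)"
  let ?ph = "\<lambda>p. exp (- \<i> * complex_of_real (sigma t (V1 (fst p)) (V2 (snd p))))"
  let ?E = "{A \<times> B | A B. A \<in> sets M1 \<and> B \<in> sets M2}"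
  have gen: "sets (M1 \<Otimes>\<^sub>M M2) = sigma_sets UNIV ?E" "Int_stable ?E" "UNIV \<in> ?E"
    using sp by (auto simp: sets_pair_measure Int_stable_pair_measure_generator) (metis UNIV_Times_UNIV sets.top)+
  have good: "FTint (M1 \<Otimes>\<^sub>M M2) \<psi> ?V \<in> R_cl t \<and> Wint (M1 \<Otimes>\<^sub>M M2) (\<lambda>p. \<psi> p * ?ph p) ?V \<in> RR"
    if "integrable (M1 \<Otimes>\<^sub>M M2) \<psi>" for \<psi>
  proof (rule FW_induct[OF finP _ gen _ _ _ _ _ that])
    fix C assume "C \<in> ?E"
    then obtain A B where C: "C = A \<times> B" and A: "A \<in> sets M1" and B: "B \<in> sets M2" by blast
    have eq: "(indicator C :: _ \<Rightarrow> complex) = (\<lambda>p. indicator A (fst p) * indicator B (snd p))"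
      by (auto simp: C indicator_def)
    show "FTint (M1 \<Otimes>\<^sub>M M2) (indicator C) ?V \<in> R_cl t"
      unfolding eq FTint_pair[OF MM.pair_sigma_finite_axioms V ind[OF fin(1) A] ind[OF fin(2) B]]
      by (intro R_cl_mult g1 g2 ind fin A B)
    show "Wint (M1 \<Otimes>\<^sub>M M2) (\<lambda>p. indicator C p * ?ph p) ?V \<in> RR"
      unfolding eq Wint_pair[OF fin V ind[OF fin(1) A] ind[OF fin(2) B]]
      by (rule op_cstarD(5)[OF RR_cstar]; rule g1 g2; rule ind; fact)
  qed (auto simp: space_pair_measure sp)
  show "FTint (M1 \<Otimes>\<^sub>M M2) \<phi> ?V \<in> R_cl t" using good[OF \<phi>] by simp
  have [measurable]: "\<phi> \<in> borel_measurable (M1 \<Otimes>\<^sub>M M2)" using \<phi> by auto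
  have "integrable (M1 \<Otimes>\<^sub>M M2) (\<lambda>p. \<phi> p * cnj (?ph p))"
    by (rule Bochner_Integration.integrable_bound[OF \<phi>]) (auto simp: norm_mult)
  from good[OF this] have "Wint (M1 \<Otimes>\<^sub>M M2) (\<lambda>p. \<phi> p * cnj (?ph p) * ?ph p) ?V \<in> RR" by simp
  moreover have "\<phi> p * cnj (?ph p) * ?ph p = \<phi> p" for p
    by (simp add: exp_cnj mult.assoc exp_add[symmetric])
  ultimately show "Wint (M1 \<Otimes>\<^sub>M M2) \<phi> ?V \<in> RR" by (simp only:)
qed

end

section \<open>The resolvent algebra is the Toeplitz image\<close>

context bargmann
begin

lemma FTint_distr:
  assumes "T \<in> measurable M N" "\<phi> \<in> borel_measurable N" "V \<in> borel_measurable N"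
  shows "FTint (distr M N T) \<phi> V = FTint M (\<lambda>x. \<phi> (T x)) (\<lambda>x. V (T x))"
proof
  fix w
  have [measurable]: "\<phi> \<in> borel_measurable N" "V \<in> borel_measurable N" by fact+
  show "FTint (distr M N T) \<phi> V w = FTint M (\<lambda>x. \<phi> (T x)) (\<lambda>x. V (T x)) w"
    unfolding FTint_def by (rule integral_distr[OF assms(1)]) measurable
qed

lemma Wint_distr:
  assumes "T \<in> measurable M N" "\<phi> \<in> borel_measurable N" "V \<in> borel_measurable N"
  shows "Wint (distr M N T) \<phi> V = Wint M (\<lambda>x. \<phi> (T x)) (\<lambda>x. V (T x))"
proof (intro ext)
  fix g w
  have [measurable]: "\<phi> \<in> borel_measurable N" "V \<in> borel_measurable N" by fact+
  show "Wint (distr M N T) \<phi> V g w = Wint M (\<lambda>x. \<phi> (T x)) (\<lambda>x. V (T x)) g w"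
  proof (cases "g \<in> fock t")
    case True
    have [measurable]: "g \<in> borel_measurable borel" using True by (rule fock_measurable)
    have "(\<integral>x. \<phi> x * W (V x) g w \<partial>distr M N T) = (\<integral>x. \<phi> (T x) * W (V (T x)) g w \<partial>M)"
      by (rule integral_distr[OF assms(1)]) measurable
    then show ?thesis using True by (simp add: Wint_def)
  qed (simp add: Wint_def)
qed

text \<open>The second coordinate carries a complex weight. Weights multiply under convolution, whereas a
  weight that is a function of the first coordinate would not survive addition of the points.\<close>

definition adm :: "(complex \<times> complex) measure \<Rightarrow> bool" where
  "adm N \<longleftrightarrow> finite_measure N \<and> sets N = sets (borel \<Otimes>\<^sub>M borel) \<and> integrable N snd \<and>
     (\<forall>\<phi>. integrable N \<phi> \<longrightarrow> FTint N \<phi> fst \<in> R_cl t \<and> Wint N \<phi> fst \<in> RR)"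

lemma admD:
  assumes "adm N"
  shows "finite_measure N" "sets N = sets (borel \<Otimes>\<^sub>M borel)" "integrable N snd" "space N = UNIV"
    "integrable N \<phi> \<Longrightarrow> FTint N \<phi> fst \<in> R_cl t" "integrable N \<phi> \<Longrightarrow> Wint N \<phi> fst \<in> RR"
  using assms sets_eq_imp_space_eq[of N "borel \<Otimes>\<^sub>M borel"] by (auto simp: adm_def space_pair_measure)

text \<open>Iterated products would change the type of the parameter space with the number of
  factors. Pushing forward to pairs of a point and a weight keeps the type fixed, so that the
  induction over \<open>Mon\<close> can be stated.\<close>

lemma adm_distrI:
  assumes "finite_measure M" and T: "T \<in> measurable M (borel \<Otimes>\<^sub>M borel)" and "integrable M (\<lambda>x. snd (T x))"
    and good: "\<And>\<phi>. integrable M \<phi> \<Longrightarrow> FTint M \<phi> (\<lambda>x. fst (T x)) \<in> R_cl t" "\<And>\<phi>. integrable M \<phi> \<Longrightarrow> Wint M \<phi> (\<lambda>x. fst (T x)) \<in> RR"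
  shows "adm (distr M (borel \<Otimes>\<^sub>M borel) T)"
  unfolding adm_def
proof (intro conjI allI impI)
  show "finite_measure (distr M (borel \<Otimes>\<^sub>M borel) T)"
    using assms(1) T by (rule finite_measure.finite_measure_distr)
  show "integrable (distr M (borel \<Otimes>\<^sub>M borel) T) snd"
    using assms(3) T by (subst integrable_distr_eq) auto
  fix \<phi> :: "complex \<times> complex \<Rightarrow> complex" assume i: "integrable (distr M (borel \<Otimes>\<^sub>M borel) T) \<phi>"
  then have m: "\<phi> \<in> borel_measurable (borel \<Otimes>\<^sub>M borel)" by auto
  have i': "integrable M (\<lambda>x. \<phi> (T x))" using i T by (rule integrable_distr[rotated])
  show "FTint (distr M (borel \<Otimes>\<^sub>M borel) T) \<phi> fst \<in> R_cl t"
    unfolding FTint_distr[OF T m measurable_fst] by (rule good(1)[OF i'])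
  show "Wint (distr M (borel \<Otimes>\<^sub>M borel) T) \<phi> fst \<in> RR"
    unfolding Wint_distr[OF T m measurable_fst] by (rule good(2)[OF i'])
qed simp

lemma Mon_adm:
  assumes "f \<in> Mon"
  shows "\<exists>N. adm N \<and> f = FTint N snd fst"
  using assms
proof (induction rule: Mon.induct)
  case (gen l z)
  define a b where "a = Re l" and "b = Im l"
  have a: "a > 0" using gen by (simp add: a_def)
  \<comment> \<open>The exponential measure has rate one. The real part \<open>a\<close> of
    \<open>l\<close> is therefore absorbed by rescaling the ray, which leaves a factor
    \<open>1 / a\<close>, and the imaginary part becomes a phase in the weight.\<close>
  define T where "T s = (of_real s * (z / of_real a), 1 / of_real a * exp (- (\<i> * of_real (b / a)) * of_real s))" for s :: real
  have T[measurable]: "T \<in> measurable expm (borel \<Otimes>\<^sub>M borel)"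
    unfolding T_def by simp
  have fT: "(\<lambda>s. fst (T s)) = (\<lambda>s. of_real s * (z / of_real a))" by (simp add: T_def)
  have iT: "integrable expm (\<lambda>s. snd (T s))"
    using a by (intro integrable_expm_bounded[where B="1 / a"]) (auto simp: T_def norm_mult norm_divide)
  have "adm (distr expm (borel \<Otimes>\<^sub>M borel) T)"
    by (rule adm_distrI[OF expm_finite_measure T iT]) (simp_all only: fT expm_good)
  moreover have "rgen l z = FTint (distr expm (borel \<Otimes>\<^sub>M borel) T) snd fst"
  proof
    fix w
    have "FTint (distr expm (borel \<Otimes>\<^sub>M borel) T) snd fst w = (\<integral>s. 1 / of_real a * exp (- (\<i> * of_real (b / a) - 2 * \<i> * of_real (sigma t w z / a)) * of_real s) \<partial>expm)"
      unfolding FTint_distr[OF T measurable_snd measurable_fst] FTint_def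
    proof (rule Bochner_Integration.integral_cong[OF refl])
      fix s
      define \<theta> where "\<theta> = sigma t w z / a"
      have sg: "sigma t w (of_real s * (z / of_real a)) = s * \<theta>"
        by (simp add: \<theta>_def sigma_def algebra_simps diff_divide_distrib)
      have "- (\<i> * of_real (b / a)) * of_real s + 2 * \<i> * of_real (s * \<theta>) = - (\<i> * of_real (b / a) - 2 * \<i> * of_real \<theta>) * of_real s"
        by (simp add: algebra_simps)
      then show "snd (T s) * exp (2 * \<i> * of_real (sigma t w (fst (T s)))) = 1 / of_real a * exp (- (\<i> * of_real (b / a) - 2 * \<i> * of_real (sigma t w z / a)) * of_real s)"
        unfolding T_def fst_conv snd_conv sg \<theta>_def[symmetric] mult.assoc[of "1 / complex_of_real a"] exp_add[symmetric] by (simp only:)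
    qed
    also have "\<dots> = 1 / of_real a * (1 / (1 + (\<i> * of_real (b / a) - 2 * \<i> * of_real (sigma t w z / a))))"
      by (subst integral_mult_right_zero, subst expm_exp_integral) auto
    also have "\<dots> = 1 / (of_real a * (1 + (\<i> * of_real (b / a) - 2 * \<i> * of_real (sigma t w z / a))))"
      by simp
    also have "of_real a * (1 + (\<i> * of_real (b / a) - 2 * \<i> * of_real (sigma t w z / a))) = l - 2 * \<i> * of_real (sigma t w z)"
    proof -
      have "of_real a + \<i> * of_real b = l" by (simp add: a_def b_def complex_eq_iff)
      then show ?thesis using a by (simp add: distrib_left right_diff_distrib mult.left_commute add_diff_eq)
    qed
    finally show "rgen l z w = FTint (distr expm (borel \<Otimes>\<^sub>M borel) T) snd fst w"
      by (simp add: rgen_def divide_inverse)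
  qed
  ultimately show ?case by blast
next
  case (mult f g)
  then obtain N1 N2 where N: "adm N1" "f = FTint N1 snd fst" "adm N2" "g = FTint N2 snd fst" by blast
  note fin = admD(1)[OF N(1)] admD(1)[OF N(3)] and [measurable_cong] = admD(2)[OF N(1)] admD(2)[OF N(3)]
    and i = admD(3)[OF N(1)] admD(3)[OF N(3)] and sp = admD(4)[OF N(1)] admD(4)[OF N(3)]
    and g1 = admD(5,6)[OF N(1)] and g2 = admD(5,6)[OF N(3)]
  interpret F1: finite_measure N1 by fact
  interpret F2: finite_measure N2 by fact
  interpret MM: pair_sigma_finite N1 N2 ..
  have m: "fst \<in> borel_measurable N1" "fst \<in> borel_measurable N2" by measurable
  define T where "T p = (fst (fst p) + fst (snd p), snd (fst p) * snd (snd p))" for p :: "(complex \<times> complex) \<times> (complex \<times> complex)"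
  have T: "T \<in> measurable (N1 \<Otimes>\<^sub>M N2) (borel \<Otimes>\<^sub>M borel)"
    unfolding T_def by measurable
  have eq: "(\<lambda>p. fst (T p)) = (\<lambda>p. fst (fst p) + fst (snd p))" "(\<lambda>p. snd (T p)) = (\<lambda>p. snd (fst p) * snd (snd p))"
    by (simp_all add: T_def)
  have "adm (distr (N1 \<Otimes>\<^sub>M N2) (borel \<Otimes>\<^sub>M borel) T)"
  proof (rule adm_distrI[OF finite_measure_pair_measure[OF fin(2,1)] T])
    show "integrable (N1 \<Otimes>\<^sub>M N2) (\<lambda>x. snd (T x))"
      unfolding eq by (rule integrable_pair_mult[OF MM.pair_sigma_finite_axioms i])
    fix \<phi> :: "_ \<Rightarrow> complex" assume "integrable (N1 \<Otimes>\<^sub>M N2) \<phi>"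
    from pair_good[OF fin sp m g1 g2 this]
    show "FTint (N1 \<Otimes>\<^sub>M N2) \<phi> (\<lambda>x. fst (T x)) \<in> R_cl t" "Wint (N1 \<Otimes>\<^sub>M N2) \<phi> (\<lambda>x. fst (T x)) \<in> RR"
      unfolding eq by auto
  qed
  moreover have "(\<lambda>w. f w * g w) = FTint (distr (N1 \<Otimes>\<^sub>M N2) (borel \<Otimes>\<^sub>M borel) T) snd fst"
    unfolding FTint_distr[OF T measurable_snd measurable_fst] eq N(2,4)
    by (rule FTint_pair[OF MM.pair_sigma_finite_axioms m i, symmetric])
  ultimately show ?case by blast
qed

section \<open>Toeplitz operators as a function of the symbol: bound, linearity, adjoint\<close>

lemma toeplitz_norm:
  assumes [measurable]: "f \<in> borel_measurable borel" and b: "\<And>w. cmod (f w) \<le> B" and g: "g \<in> fock t"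
  shows "toeplitz t f g \<in> fock t" "L2_norm t (toeplitz t f g) \<le> B * L2_norm t g"
proof -
  have L: "(\<lambda>w. f w * g w) \<in> L2 t" by (rule L2_mult_bounded[OF fock_L2[OF g] assms(1) b])
  show "toeplitz t f g \<in> fock t" unfolding toeplitz_bounded_symbol[OF assms(1) b g] by (rule P_fock[OF L])
  have "L2_norm t (toeplitz t f g) \<le> L2_norm t (\<lambda>w. f w * g w)"
    unfolding toeplitz_bounded_symbol[OF assms(1) b g] by (rule norm_P_le[OF L])
  also have "\<dots> \<le> B * L2_norm t g" by (rule L2_norm_mult_bounded[OF fock_L2[OF g] assms(1) b])
  finally show "L2_norm t (toeplitz t f g) \<le> B * L2_norm t g" .
qed

lemma toeplitz_inner:
  assumes [measurable]: "f \<in> borel_measurable borel" and b: "\<And>w. cmod (f w) \<le> B" and g: "g \<in> fock t" and h: "h \<in> fock t"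
  shows "L2_inner t (toeplitz t f g) h = (\<integral>w. f w * (g w * cnj (h w)) \<partial>\<mu>)"
proof -
  have L: "(\<lambda>w. f w * g w) \<in> L2 t" by (rule L2_mult_bounded[OF fock_L2[OF g] assms(1) b])
  show ?thesis
    unfolding toeplitz_bounded_symbol[OF assms(1) b g] P_inner[OF L h] by (simp add: L2_inner_def mult.assoc)
qed

lemma BUC_meas_bound:
  assumes "f \<in> BUC" obtains B where "B > 0" "f \<in> borel_measurable borel" "\<And>w. cmod (f w) \<le> B"
  using BUC_bound[OF assms] BUC_measurable[OF assms] by blast

lemma toeplitz_add:
  assumes f: "f \<in> BUC" and g: "g \<in> BUC"
  shows "toeplitz t (\<lambda>w. f w + g w) = (\<lambda>h w. toeplitz t f h w + toeplitz t g h w)"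
proof
  fix h
  obtain A where A: "f \<in> borel_measurable borel" "\<And>w. cmod (f w) \<le> A" using BUC_meas_bound[OF f] by blast
  obtain B where B: "g \<in> borel_measurable borel" "\<And>w. cmod (g w) \<le> B" using BUC_meas_bound[OF g] by blast
  obtain C where C: "(\<lambda>w. f w + g w) \<in> borel_measurable borel" "\<And>w. cmod (f w + g w) \<le> C" using BUC_meas_bound[OF BUC_add[OF f g]] by blast
  show "toeplitz t (\<lambda>w. f w + g w) h = (\<lambda>w. toeplitz t f h w + toeplitz t g h w)"
  proof (cases "h \<in> fock t")
    case True
    note i = integrable_L2_exp[OF L2_mult_bounded[OF fock_L2[OF True]]]
    show ?thesis
      unfolding toeplitz_bounded_symbol[OF A True] toeplitz_bounded_symbol[OF B True] toeplitz_bounded_symbol[OF C True]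
      by (simp add: P_def[abs_def] distrib_right i[OF A] i[OF B])
  qed (simp add: toeplitz_outside)
qed

lemma toeplitz_cmult:
  assumes f: "f \<in> BUC"
  shows "toeplitz t (\<lambda>w. c * f w) = (\<lambda>h w. c * toeplitz t f h w)"
proof
  fix h
  obtain A where A: "f \<in> borel_measurable borel" "\<And>w. cmod (f w) \<le> A" using BUC_meas_bound[OF f] by blast
  obtain C where C: "(\<lambda>w. c * f w) \<in> borel_measurable borel" "\<And>w. cmod (c * f w) \<le> C" using BUC_meas_bound[OF BUC_mult[OF BUC_const f]] by blast
  show "toeplitz t (\<lambda>w. c * f w) h = (\<lambda>w. c * toeplitz t f h w)"
  proof (cases "h \<in> fock t")
    case True
    show ?thesis
      unfolding toeplitz_bounded_symbol[OF A True] toeplitz_bounded_symbol[OF C True]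
      by (simp add: P_def[abs_def] mult.assoc)
  qed (simp add: toeplitz_outside)
qed

lemma toeplitz_bounded_ops:
  assumes f: "f \<in> BUC"
  shows "toeplitz t f \<in> bounded_ops t"
proof -
  obtain A where A: "A > 0" "f \<in> borel_measurable borel" "\<And>w. cmod (f w) \<le> A" using BUC_meas_bound[OF f] by blast
  have L: "(\<lambda>w. f w * g w) \<in> L2 t" if "g \<in> fock t" for g by (rule L2_mult_bounded[OF fock_L2[OF that] A(2,3)])
  show ?thesis
  proof (rule bounded_opsI[where K=A])
    fix g assume g: "g \<in> fock t"
    show "toeplitz t f g \<in> fock t" "L2_norm t (toeplitz t f g) \<le> A * L2_norm t g" by (rule toeplitz_norm[OF A(2,3) g])+
    show "toeplitz t f (\<lambda>w. c * g w) = (\<lambda>w. c * toeplitz t f g w)" for c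
      unfolding toeplitz_bounded_symbol[OF A(2,3) g] toeplitz_bounded_symbol[OF A(2,3) fock_cmult[OF g]]
    proof
      fix z
      have "P (\<lambda>w. f w * (c * g w)) z = (\<integral>w. c * (f w * g w * exp (z * cnj w / t)) \<partial>\<mu>)"
        unfolding P_def by (rule Bochner_Integration.integral_cong[OF refl]) (simp only: mult_ac)
      then show "P (\<lambda>w. f w * (c * g w)) z = c * P (\<lambda>w. f w * g w) z" by (simp add: P_def)
    qed
    fix h assume h: "h \<in> fock t"
    show "toeplitz t f (\<lambda>w. g w + h w) = (\<lambda>w. toeplitz t f g w + toeplitz t f h w)"
      unfolding toeplitz_bounded_symbol[OF A(2,3) g] toeplitz_bounded_symbol[OF A(2,3) h] toeplitz_bounded_symbol[OF A(2,3) fock_add[OF g h]]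
      by (simp add: P_def[abs_def] distrib_left distrib_right integrable_L2_exp[OF L[OF g]] integrable_L2_exp[OF L[OF h]])
  qed (simp add: toeplitz_outside)
qed

lemma toeplitz_adjoint:
  assumes f: "f \<in> BUC" and g: "g \<in> fock t" and h: "h \<in> fock t"
  shows "L2_inner t (toeplitz t f g) h = L2_inner t g (toeplitz t (\<lambda>w. cnj (f w)) h)"
proof -
  obtain A where A: "A > 0" "f \<in> borel_measurable borel" "\<And>w. cmod (f w) \<le> A" using BUC_meas_bound[OF f] by blast
  have A': "(\<lambda>w. cnj (f w)) \<in> borel_measurable borel" "\<And>w. cmod (cnj (f w)) \<le> A" using A by auto
  show ?thesis
    unfolding L2_inner_commute[of g] toeplitz_inner[OF A(2,3) g h] toeplitz_inner[OF A' h g] Bochner_Integration.integral_cnj[symmetric]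
    by (simp add: mult_ac)
qed

lemma op_closure_approx:
  assumes "A \<in> op_closure t S" "S \<subseteq> bounded_ops t" "e > 0"
  shows "\<exists>B\<in>S. B \<in> bounded_ops t \<and> (\<forall>g\<in>fock t. L2_norm t (\<lambda>w. A g w - B g w) \<le> e * L2_norm t g)"
  by (rule op_closureE[OF assms]) auto

section \<open>Closed subspaces of operators and their pullbacks\<close>

definition op_closed_subspace :: "fock_op set \<Rightarrow> bool" where
  "op_closed_subspace S \<longleftrightarrow> S \<subseteq> bounded_ops t \<and> (\<lambda>g w. 0) \<in> S \<and>
     (\<forall>A\<in>S. \<forall>B\<in>S. (\<lambda>g w. A g w + B g w) \<in> S) \<and> (\<forall>c. \<forall>A\<in>S. (\<lambda>g w. c * A g w) \<in> S) \<and> op_closure t S \<subseteq> S"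

lemma op_closed_subspaceD:
  assumes "op_closed_subspace S"
  shows "S \<subseteq> bounded_ops t" "(\<lambda>g w. 0) \<in> S" "A \<in> S \<Longrightarrow> B \<in> S \<Longrightarrow> (\<lambda>g w. A g w + B g w) \<in> S"
    "A \<in> S \<Longrightarrow> (\<lambda>g w. c * A g w) \<in> S" "op_closure t S \<subseteq> S"
  using assms by (simp_all add: op_closed_subspace_def)

lemma op_closed_subspace_RR: "op_closed_subspace RR"
  using op_cstarD[OF RR_cstar] by (simp add: op_closed_subspace_def)

lemma toeplitz_zero: "toeplitz t (\<lambda>w. 0) = (\<lambda>g w. 0)"
  using toeplitz_cmult[OF BUC_const, of 0 0] by simp

text \<open>Toeplitz quantization is linear and does not increase norms, so preimages of closed
  subspaces are closed. Combined with \<open>R_cl_subset_closed_subspace\<close>, memberships of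
  Toeplitz operators need to be checked on \<open>Mon\<close> only.\<close>

lemma toeplitz_pullback:
  assumes S: "op_closed_subspace S"
  shows "BUC_closed_subspace {f \<in> BUC. toeplitz t f \<in> S}"
proof (rule BUC_closed_subspaceI)
  show "(\<lambda>w. 0) \<in> {f \<in> BUC. toeplitz t f \<in> S}" by (simp add: BUC_const toeplitz_zero op_closed_subspaceD(2)[OF S])
  show "(\<lambda>w. f w + g w) \<in> {f \<in> BUC. toeplitz t f \<in> S}" if "f \<in> {f \<in> BUC. toeplitz t f \<in> S}" "g \<in> {f \<in> BUC. toeplitz t f \<in> S}" for f g
    using that by (simp add: BUC_add toeplitz_add op_closed_subspaceD(3)[OF S])
  show "(\<lambda>w. c * f w) \<in> {f \<in> BUC. toeplitz t f \<in> S}" if "f \<in> {f \<in> BUC. toeplitz t f \<in> S}" for f c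
    using that by (simp add: BUC_mult BUC_const toeplitz_cmult op_closed_subspaceD(4)[OF S])
  fix F f assume F: "\<And>n. F n \<in> {f \<in> BUC. toeplitz t f \<in> S}" and lim: "uniform_limit UNIV F f sequentially"
  have FB: "F n \<in> BUC" for n using F by blast
  have fB: "f \<in> BUC" by (rule BUC_limit[OF FB lim])
  have "toeplitz t f \<in> op_closure t S"
  proof (rule op_closureI[OF toeplitz_bounded_ops[OF fB]])
    fix e :: real assume "e > 0"
    from eventually_happens'[OF sequentially_bot uniform_limitD[OF lim this]]
    obtain n where n: "\<And>w. dist (F n w) (f w) < e" by auto
    show "\<exists>B\<in>S. \<forall>g\<in>fock t. L2_norm t (\<lambda>w. toeplitz t f g w - B g w) \<le> e * L2_norm t g"
    proof (intro bexI ballI)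
      show "toeplitz t (F n) \<in> S" using F by blast
      fix g assume g: "g \<in> fock t"
      have d: "(\<lambda>w. f w + (-1) * F n w) \<in> BUC" by (intro BUC_add BUC_mult BUC_const fB FB)
      have b: "cmod (f w + (-1) * F n w) \<le> e" for w using n[of w] by (simp add: dist_norm norm_minus_commute)
      have "(\<lambda>w. toeplitz t f g w - toeplitz t (F n) g w) = toeplitz t (\<lambda>w. f w + (-1) * F n w) g"
        unfolding toeplitz_add[OF fB BUC_mult[OF BUC_const FB]] toeplitz_cmult[OF FB] by simp
      then show "L2_norm t (\<lambda>w. toeplitz t f g w - toeplitz t (F n) g w) \<le> e * L2_norm t g"
        using toeplitz_norm(2)[OF BUC_measurable[OF d] b g] by simp
    qed
  qed
  then show "f \<in> {f \<in> BUC. toeplitz t f \<in> S}" using op_closed_subspaceD(5)[OF S] fB by blast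
qed auto

lemma op_closed_subspace_comp_right:
  assumes S: "op_closed_subspace S" and B: "B \<in> bounded_ops t"
  shows "op_closed_subspace {X \<in> bounded_ops t. X \<circ> B \<in> S}"
  unfolding op_closed_subspace_def
proof (intro conjI ballI allI)
  let ?S = "{X \<in> bounded_ops t. X \<circ> B \<in> S}"
  show "(\<lambda>g w. 0) \<in> ?S" using op_closed_subspaceD(2)[OF S] by (simp add: bounded_ops_zero comp_def)
  show "(\<lambda>g w. X g w + Y g w) \<in> ?S" if "X \<in> ?S" "Y \<in> ?S" for X Y
    using that op_closed_subspaceD(3)[OF S, of "X \<circ> B" "Y \<circ> B"] by (simp add: bounded_ops_add comp_def)
  show "(\<lambda>g w. c * X g w) \<in> ?S" if "X \<in> ?S" for X c
    using that op_closed_subspaceD(4)[OF S, of "X \<circ> B" c] by (simp add: bounded_ops_cmult comp_def)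
  show "op_closure t ?S \<subseteq> ?S"
  proof
    fix X assume X: "X \<in> op_closure t ?S"
    then have Xb: "X \<in> bounded_ops t" by (simp add: op_closure_def)
    obtain K where K: "K \<ge> 0" "\<And>f. f \<in> fock t \<Longrightarrow> L2_norm t (B f) \<le> K * L2_norm t f" using bounded_ops_bound[OF B] by blast
    have "X \<circ> B \<in> op_closure t S"
    proof (rule op_closureI[OF bounded_ops_comp[OF Xb B]])
      fix e :: real assume "e > 0"
      \<comment> \<open>\<open>K\<close> may be \<open>0\<close>, hence the denominator
        \<open>K + 1\<close>.\<close>
      then have e: "e / (K + 1) > 0" using K by simp
      obtain Y where Y: "Y \<in> ?S" "Y \<in> bounded_ops t" "\<And>g. g \<in> fock t \<Longrightarrow> L2_norm t (\<lambda>w. X g w - Y g w) \<le> e / (K + 1) * L2_norm t g"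
        by (rule op_closureE[OF X _ e]) auto
      show "\<exists>Z\<in>S. \<forall>g\<in>fock t. L2_norm t (\<lambda>w. (X \<circ> B) g w - Z g w) \<le> e * L2_norm t g"
      proof (intro bexI ballI)
        show "Y \<circ> B \<in> S" using Y by simp
        fix g assume g: "g \<in> fock t"
        have "L2_norm t (\<lambda>w. X (B g) w - Y (B g) w) \<le> e / (K + 1) * L2_norm t (B g)" by (rule Y(3)[OF bounded_opsD(1)[OF B g]])
        also have "\<dots> \<le> e / (K + 1) * ((K + 1) * L2_norm t g)"
          using e K(2)[OF g] by (intro mult_left_mono) (auto simp: distrib_right intro: order_trans)
        also have "\<dots> = e * L2_norm t g" using K by simp
        finally show "L2_norm t (\<lambda>w. (X \<circ> B) g w - (Y \<circ> B) g w) \<le> e * L2_norm t g" by simp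
      qed
    qed
    then show "X \<in> ?S" using op_closed_subspaceD(5)[OF S] Xb by blast
  qed
qed auto

text \<open>In contrast to composition on the right, linearity of \<open>A\<close> is applied to the
  values of the operators. At arguments outside the Fock space these values are the zero function by
  convention, and this case is treated apart.\<close>

lemma op_closed_subspace_comp_left:
  assumes S: "op_closed_subspace S" and A: "A \<in> bounded_ops t"
  shows "op_closed_subspace {X \<in> bounded_ops t. A \<circ> X \<in> S}"
  unfolding op_closed_subspace_def
proof (intro conjI ballI allI)
  let ?S = "{X \<in> bounded_ops t. A \<circ> X \<in> S}"
  have Xz: "X g = (\<lambda>w. 0)" if "X \<in> bounded_ops t" "g \<notin> fock t" for X g using bounded_opsD(4)[OF that] .
  show "(\<lambda>g w. 0) \<in> ?S" using op_closed_subspaceD(2)[OF S] by (simp add: bounded_ops_zero comp_def bounded_ops_zero_arg[OF A])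
  show "(\<lambda>g w. X g w + Y g w) \<in> ?S" if X: "X \<in> ?S" and Y: "Y \<in> ?S" for X Y
  proof -
    have XY: "X \<in> bounded_ops t" "Y \<in> bounded_ops t" using X Y by auto
    have "A (\<lambda>w. X g w + Y g w) = (\<lambda>w. A (X g) w + A (Y g) w)" for g
    proof (cases "g \<in> fock t")
      case True then show ?thesis by (intro bounded_opsD(2)[OF A] bounded_opsD(1)[OF XY(1)] bounded_opsD(1)[OF XY(2)])
    next
      case False then show ?thesis by (simp add: Xz XY bounded_ops_zero_arg[OF A])
    qed
    then show ?thesis using X Y op_closed_subspaceD(3)[OF S, of "A \<circ> X" "A \<circ> Y"] by (simp add: bounded_ops_add comp_def)
  qed
  show "(\<lambda>g w. c * X g w) \<in> ?S" if X: "X \<in> ?S" for X c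
  proof -
    have Xb: "X \<in> bounded_ops t" using X by auto
    have "A (\<lambda>w. c * X g w) = (\<lambda>w. c * A (X g) w)" for g
    proof (cases "g \<in> fock t")
      case True then show ?thesis by (intro bounded_opsD(3)[OF A] bounded_opsD(1)[OF Xb])
    next
      case False then show ?thesis by (simp add: Xz Xb bounded_ops_zero_arg[OF A])
    qed
    then show ?thesis using X op_closed_subspaceD(4)[OF S, of "A \<circ> X" c] by (simp add: bounded_ops_cmult comp_def)
  qed
  show "op_closure t ?S \<subseteq> ?S"
  proof
    fix X assume X: "X \<in> op_closure t ?S"
    then have Xb: "X \<in> bounded_ops t" by (simp add: op_closure_def)
    obtain K where K: "K \<ge> 0" "\<And>f. f \<in> fock t \<Longrightarrow> L2_norm t (A f) \<le> K * L2_norm t f" using bounded_ops_bound[OF A] by blast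
    have "A \<circ> X \<in> op_closure t S"
    proof (rule op_closureI[OF bounded_ops_comp[OF A Xb]])
      fix e :: real assume "e > 0"
      then have e: "e / (K + 1) > 0" using K by simp
      obtain Y where Y: "Y \<in> ?S" "Y \<in> bounded_ops t" "\<And>g. g \<in> fock t \<Longrightarrow> L2_norm t (\<lambda>w. X g w - Y g w) \<le> e / (K + 1) * L2_norm t g"
        by (rule op_closureE[OF X _ e]) auto
      show "\<exists>Z\<in>S. \<forall>g\<in>fock t. L2_norm t (\<lambda>w. (A \<circ> X) g w - Z g w) \<le> e * L2_norm t g"
      proof (intro bexI ballI)
        show "A \<circ> Y \<in> S" using Y by simp
        fix g assume g: "g \<in> fock t"
        have f: "X g \<in> fock t" "Y g \<in> fock t" by (rule bounded_opsD(1)[OF Xb g], rule bounded_opsD(1)[OF Y(2) g])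
        have "L2_norm t (\<lambda>w. A (X g) w - A (Y g) w) = L2_norm t (A (\<lambda>w. X g w - Y g w))"
          by (simp only: bounded_ops_diff_arg[OF A f])
        also have "\<dots> \<le> K * L2_norm t (\<lambda>w. X g w - Y g w)" by (rule K(2)[OF fock_diff[OF f]])
        also have "\<dots> \<le> (K + 1) * (e / (K + 1) * L2_norm t g)"
          using K Y(3)[OF g] by (intro mult_mono) auto
        also have "\<dots> = e * L2_norm t g" using K by simp
        finally show "L2_norm t (\<lambda>w. (A \<circ> X) g w - (A \<circ> Y) g w) \<le> e * L2_norm t g" by simp
      qed
    qed
    then show "X \<in> ?S" using op_closed_subspaceD(5)[OF S] Xb by blast
  qed
qed auto

section \<open>The closed Toeplitz image of the classical algebra is a C*-algebra\<close>

abbreviation TT :: "fock_op set" where "TT \<equiv> T_lin t (R_cl t)"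

lemma TT_image_bounded: "toeplitz t ` R_cl t \<subseteq> bounded_ops t"
  using toeplitz_bounded_ops[OF R_cl_BUC] by blast

lemma toeplitz_in_T_lin:
  assumes "D \<subseteq> BUC" "f \<in> D" shows "toeplitz t f \<in> T_lin t D"
  unfolding T_lin_def
proof (rule op_closureI[OF toeplitz_bounded_ops])
  show "f \<in> BUC" using assms by blast
  fix e :: real assume "e > 0"
  then show "\<exists>B\<in>toeplitz t ` D. \<forall>g\<in>fock t. L2_norm t (\<lambda>w. toeplitz t f g w - B g w) \<le> e * L2_norm t g"
    using assms by (intro bexI[of _ "toeplitz t f"]) auto
qed

lemma op_closed_subspace_TT: "op_closed_subspace TT"
  unfolding op_closed_subspace_def
proof (intro conjI ballI allI)
  have RB: "R_cl t \<subseteq> BUC" using R_cl_BUC by blast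
  show bd: "TT \<subseteq> bounded_ops t" by (simp add: T_lin_def op_closure_bounded)
  show "(\<lambda>g w. 0) \<in> TT"
    using toeplitz_in_T_lin[OF RB BUC_closed_subspaceD(2)[OF R_cl_closed]] by (simp add: toeplitz_zero)
  show "op_closure t TT \<subseteq> TT"
    unfolding T_lin_def by (rule op_closure_closed[OF TT_image_bounded])
  fix A assume A: "A \<in> TT"
  then have Ab: "A \<in> bounded_ops t" using bd by blast
  show "(\<lambda>g w. c * A g w) \<in> TT" for c
    unfolding T_lin_def
  proof (rule op_closureI[OF bounded_ops_cmult[OF Ab]])
    fix e :: real assume "e > 0"
    then have e: "e / (cmod c + 1) > 0" by (simp add: add_nonneg_pos)
    obtain X where X: "X \<in> toeplitz t ` R_cl t" "X \<in> bounded_ops t" "\<And>g. g \<in> fock t \<Longrightarrow> L2_norm t (\<lambda>w. A g w - X g w) \<le> e / (cmod c + 1) * L2_norm t g"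
      using op_closure_approx[OF A[unfolded T_lin_def] TT_image_bounded e] by auto
    then obtain f where f: "f \<in> R_cl t" "X = toeplitz t f" by blast
    show "\<exists>B\<in>toeplitz t ` R_cl t. \<forall>g\<in>fock t. L2_norm t (\<lambda>w. c * A g w - B g w) \<le> e * L2_norm t g"
    proof (intro bexI ballI)
      show "toeplitz t (\<lambda>w. c * f w) \<in> toeplitz t ` R_cl t"
        by (intro imageI BUC_closed_subspaceD(4)[OF R_cl_closed] f)
      fix g assume g: "g \<in> fock t"
      have "L2_norm t (\<lambda>w. c * A g w - toeplitz t (\<lambda>w. c * f w) g w) = cmod c * L2_norm t (\<lambda>w. A g w - X g w)"
        unfolding toeplitz_cmult[OF R_cl_BUC[OF f(1)]] f(2) L2_norm_cmult[symmetric] by (simp add: right_diff_distrib)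
      also have "\<dots> \<le> (cmod c + 1) * (e / (cmod c + 1) * L2_norm t g)"
        using X(3)[OF g] by (intro mult_mono) auto
      also have "\<dots> = e * L2_norm t g"
      proof -
        have "cmod c + 1 \<noteq> 0" using norm_ge_zero[of c] by linarith
        then show ?thesis by simp
      qed
      finally show "L2_norm t (\<lambda>w. c * A g w - toeplitz t (\<lambda>w. c * f w) g w) \<le> e * L2_norm t g" .
    qed
  qed
  fix B assume B: "B \<in> TT"
  then have Bb: "B \<in> bounded_ops t" using bd by blast
  show "(\<lambda>g w. A g w + B g w) \<in> TT"
    unfolding T_lin_def
  proof (rule op_closureI[OF bounded_ops_add[OF Ab Bb]])
    fix e :: real assume "e > 0"
    then have e: "e / 2 > 0" by simp
    obtain X where X: "X \<in> toeplitz t ` R_cl t" "X \<in> bounded_ops t" "\<And>g. g \<in> fock t \<Longrightarrow> L2_norm t (\<lambda>w. A g w - X g w) \<le> e / 2 * L2_norm t g"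
      using op_closure_approx[OF A[unfolded T_lin_def] TT_image_bounded e] by auto
    then obtain f where f: "f \<in> R_cl t" "X = toeplitz t f" by blast
    obtain Y where Y: "Y \<in> toeplitz t ` R_cl t" "Y \<in> bounded_ops t" "\<And>g. g \<in> fock t \<Longrightarrow> L2_norm t (\<lambda>w. B g w - Y g w) \<le> e / 2 * L2_norm t g"
      using op_closure_approx[OF B[unfolded T_lin_def] TT_image_bounded e] by auto
    then obtain f' where f': "f' \<in> R_cl t" "Y = toeplitz t f'" by blast
    show "\<exists>Z\<in>toeplitz t ` R_cl t. \<forall>g\<in>fock t. L2_norm t (\<lambda>w. A g w + B g w - Z g w) \<le> e * L2_norm t g"
    proof (intro bexI ballI)
      show "toeplitz t (\<lambda>w. f w + f' w) \<in> toeplitz t ` R_cl t"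
        by (intro imageI BUC_closed_subspaceD(3)[OF R_cl_closed] f f')
      fix g assume g: "g \<in> fock t"
      have "L2_norm t (\<lambda>w. A g w + B g w - toeplitz t (\<lambda>w. f w + f' w) g w) = L2_norm t (\<lambda>w. (A g w - X g w) + (B g w - Y g w))"
        unfolding toeplitz_add[OF R_cl_BUC[OF f(1)] R_cl_BUC[OF f'(1)]] f(2) f'(2) by (simp add: algebra_simps)
      also have "\<dots> \<le> L2_norm t (\<lambda>w. A g w - X g w) + L2_norm t (\<lambda>w. B g w - Y g w)"
        by (intro L2_norm_triangle L2_diff fock_L2 bounded_opsD(1)[OF Ab g] bounded_opsD(1)[OF Bb g] bounded_opsD(1)[OF X(2) g] bounded_opsD(1)[OF Y(2) g])
      also have "\<dots> \<le> e * L2_norm t g" using X(3)[OF g] Y(3)[OF g] by simp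
      finally show "L2_norm t (\<lambda>w. A g w + B g w - toeplitz t (\<lambda>w. f w + f' w) g w) \<le> e * L2_norm t g" .
    qed
  qed
qed

lemma TT_subset:
  assumes "op_closed_subspace S" "\<And>f. f \<in> R_cl t \<Longrightarrow> toeplitz t f \<in> S"
  shows "TT \<subseteq> S"
proof -
  have "TT \<subseteq> op_closure t S" unfolding T_lin_def by (rule op_closure_mono) (use assms(2) in blast)
  then show ?thesis using op_closed_subspaceD(5)[OF assms(1)] by blast
qed

text \<open>Taking the Gaussian factor out of a density means dividing by it, which is safe for
  integrability where \<open>V\<close> is bounded. The Weyl integrals of the cutoffs of
  \<open>\<phi>\<close> to \<open>cmod (V x) \<le> n\<close> are therefore exactly Toeplitz
  operators with symbols in \<open>R_cl\<close>, and the cutoffs converge to \<open>\<phi>\<close>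
  in L1.\<close>

lemma Wint_in_TT:
  assumes fin: "finite_measure M" and V[measurable]: "V \<in> borel_measurable M"
    and good: "\<And>\<phi>. integrable M \<phi> \<Longrightarrow> FTint M \<phi> V \<in> R_cl t" and \<phi>: "integrable M \<phi>"
  shows "Wint M \<phi> V \<in> TT"
proof -
  have [measurable]: "\<phi> \<in> borel_measurable M" using \<phi> by auto
  have RB: "R_cl t \<subseteq> BUC" using R_cl_BUC by blast
  define s where "s n x = \<phi> x * indicator {v. cmod v \<le> real n} (V x)" for n :: nat and x
  define \<psi> where "\<psi> n x = s n x * of_real (exp ((cmod (V x))\<^sup>2 / (2 * t)))" for n :: nat and x
  have sm[measurable]: "s n \<in> borel_measurable M" for n unfolding s_def by measurable
  have sle: "cmod (s n x) \<le> cmod (\<phi> x)" for n x by (simp add: s_def norm_mult indicator_def)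
  have si: "integrable M (s n)" for n
    by (rule Bochner_Integration.integrable_bound[OF \<phi>]) (use sle in auto)
  have \<psi>i: "integrable M (\<psi> n)" for n
  proof (rule Bochner_Integration.integrable_bound)
    show "integrable M (\<lambda>x. of_real (exp ((real n)\<^sup>2 / (2 * t))) * \<phi> x)" using \<phi> by auto
    show "\<psi> n \<in> borel_measurable M" unfolding \<psi>_def by measurable
    show "AE x in M. norm (\<psi> n x) \<le> norm (of_real (exp ((real n)\<^sup>2 / (2 * t))) * \<phi> x)"
    proof (rule AE_I2)
      fix x
      show "norm (\<psi> n x) \<le> norm (of_real (exp ((real n)\<^sup>2 / (2 * t))) * \<phi> x)"
      proof (cases "cmod (V x) \<le> real n")
        case True
        then have "(cmod (V x))\<^sup>2 \<le> (real n)\<^sup>2" by (intro power_mono) auto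
        then have "exp ((cmod (V x))\<^sup>2 / (2 * t)) \<le> exp ((real n)\<^sup>2 / (2 * t))" using t_pos by (simp add: divide_right_mono)
        then show ?thesis using True by (simp add: \<psi>_def s_def norm_mult mult.commute mult_left_mono)
      next
        case False then show ?thesis by (simp add: \<psi>_def s_def)
      qed
    qed
  qed
  have "(\<lambda>x. \<psi> n x * of_real (exp (- (cmod (V x))\<^sup>2 / (2 * t)))) = s n" for n
  proof
    fix x
    have "exp ((cmod (V x))\<^sup>2 / (2 * t)) * exp (- (cmod (V x))\<^sup>2 / (2 * t)) = 1" by (simp add: exp_add[symmetric])
    then show "\<psi> n x * of_real (exp (- (cmod (V x))\<^sup>2 / (2 * t))) = s n x"
      unfolding \<psi>_def mult.assoc of_real_mult[symmetric] by simp
  qed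
  then have "Wint M (s n) V = toeplitz t (FTint M (\<psi> n) V)" for n
    using toeplitz_FTint[OF fin V \<psi>i[of n]] by simp
  then have S: "Wint M (s n) V \<in> TT" for n
    using toeplitz_in_T_lin[OF RB good[OF \<psi>i[of n]]] by simp
  have "(\<lambda>n. \<integral>x. cmod (s n x - \<phi> x) \<partial>M) \<longlonglongrightarrow> (\<integral>x. 0 \<partial>M)"
  proof (rule integral_dominated_convergence[where w="\<lambda>x. 2 * cmod (\<phi> x)"])
    show "AE x in M. norm (cmod (s n x - \<phi> x)) \<le> 2 * cmod (\<phi> x)" for n
    proof (rule AE_I2)
      fix x
      show "norm (cmod (s n x - \<phi> x)) \<le> 2 * cmod (\<phi> x)"
        using norm_triangle_ineq4[of "s n x" "\<phi> x"] sle[of n x] by simp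
    qed
    show "AE x in M. (\<lambda>n. cmod (s n x - \<phi> x)) \<longlonglongrightarrow> 0"
    proof (rule AE_I2)
      fix x
      have "\<forall>\<^sub>F n in sequentially. cmod (s n x - \<phi> x) = 0"
        using eventually_ge_at_top[of "nat \<lceil>cmod (V x)\<rceil>"]
      proof eventually_elim
        case (elim n)
        then have "cmod (V x) \<le> real n" by linarith
        then show ?case by (simp add: s_def)
      qed
      then show "(\<lambda>n. cmod (s n x - \<phi> x)) \<longlonglongrightarrow> 0" by (rule tendsto_eventually)
    qed
  qed (use \<phi> in auto)
  then have lim: "(\<lambda>n. \<integral>x. cmod (s n x - \<phi> x) \<partial>M) \<longlonglongrightarrow> 0" by simp
  show ?thesis
    by (rule Wint_limit[OF fin V si \<phi> S op_closed_subspaceD(5)[OF op_closed_subspace_TT] lim])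
qed

text \<open>The Gaussian factor is at most \<open>1\<close>, so the new density remains integrable.
  For a product of generators it depends on the sum of the points and is not of product form; the
  clause of \<open>adm\<close> for all integrable densities covers it.\<close>

lemma toeplitz_Mon_RR:
  assumes "f \<in> Mon" shows "toeplitz t f \<in> RR"
proof -
  obtain N where N: "adm N" "f = FTint N snd fst" using Mon_adm[OF assms] by blast
  note fin = admD(1)[OF N(1)] and [measurable_cong] = admD(2)[OF N(1)] and i = admD(3)[OF N(1)] and g = admD(6)[OF N(1)]
  have m: "fst \<in> borel_measurable N" "snd \<in> borel_measurable N" by measurable
  have le: "exp (- (cmod v)\<^sup>2 / (2 * t)) \<le> 1" for v using t_pos by simp
  have "integrable N (\<lambda>x. snd x * of_real (exp (- (cmod (fst x))\<^sup>2 / (2 * t))))"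
    by (rule Bochner_Integration.integrable_bound[OF i]) (use le in \<open>auto simp: norm_mult mult_left_le\<close>)
  then show ?thesis unfolding N(2) toeplitz_FTint[OF fin m(1) i] by (rule g)
qed

lemma TT_subset_RR: "TT \<subseteq> RR"
proof (rule TT_subset[OF op_closed_subspace_RR])
  have "R_cl t \<subseteq> {f \<in> BUC. toeplitz t f \<in> RR}"
    by (rule R_cl_subset_closed_subspace[OF toeplitz_pullback[OF op_closed_subspace_RR]]) (auto simp: Mon_BUC toeplitz_Mon_RR)
  then show "toeplitz t f \<in> RR" if "f \<in> R_cl t" for f using that by blast
qed

text \<open>The composition is one Weyl integral over the product space, with the phase and both
  Gaussian factors in its density. By \<open>pair_good\<close> the symbols of all densities on this
  space lie in \<open>R_cl\<close>, which is the hypothesis of \<open>Wint_in_TT\<close>.\<close>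

lemma toeplitz_Mon_comp:
  assumes "f \<in> Mon" "g \<in> Mon"
  shows "toeplitz t f \<circ> toeplitz t g \<in> TT"
proof -
  obtain N1 N2 where N: "adm N1" "f = FTint N1 snd fst" "adm N2" "g = FTint N2 snd fst" using assms[THEN Mon_adm] by blast
  note fin = admD(1)[OF N(1)] admD(1)[OF N(3)] and [measurable_cong] = admD(2)[OF N(1)] admD(2)[OF N(3)]
    and i = admD(3)[OF N(1)] admD(3)[OF N(3)] and sp = admD(4)[OF N(1)] admD(4)[OF N(3)]
    and g1 = admD(5,6)[OF N(1)] and g2 = admD(5,6)[OF N(3)]
  interpret F1: finite_measure N1 by fact
  interpret F2: finite_measure N2 by fact
  interpret MM: pair_sigma_finite N1 N2 ..
  have m: "fst \<in> borel_measurable N1" "fst \<in> borel_measurable N2" by measurable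
  have le: "exp (- (cmod v)\<^sup>2 / (2 * t)) \<le> 1" for v using t_pos by simp
  let ?\<gamma> = "\<lambda>x. snd x * complex_of_real (exp (- (cmod (fst x))\<^sup>2 / (2 * t)))"
  have \<gamma>: "integrable N1 ?\<gamma>" by (rule Bochner_Integration.integrable_bound[OF i(1)]) (use le in \<open>auto simp: norm_mult mult_left_le\<close>)
  have \<gamma>': "integrable N2 ?\<gamma>" by (rule Bochner_Integration.integrable_bound[OF i(2)]) (use le in \<open>auto simp: norm_mult mult_left_le\<close>)
  have "integrable (N1 \<Otimes>\<^sub>M N2) (\<lambda>p. ?\<gamma> (fst p) * ?\<gamma> (snd p) * exp (- \<i> * of_real (sigma t (fst (fst p)) (fst (snd p)))))"
    by (rule Bochner_Integration.integrable_bound[OF integrable_pair_mult[OF MM.pair_sigma_finite_axioms \<gamma> \<gamma>']]) (auto simp: norm_mult)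
  then have "Wint (N1 \<Otimes>\<^sub>M N2) (\<lambda>p. ?\<gamma> (fst p) * ?\<gamma> (snd p) * exp (- \<i> * of_real (sigma t (fst (fst p)) (fst (snd p))))) (\<lambda>p. fst (fst p) + fst (snd p)) \<in> TT"
    by (intro Wint_in_TT[OF finite_measure_pair_measure[OF fin(2,1)]] pair_good(1)[OF fin sp m g1 g2]) auto
  then show ?thesis
    unfolding N(2,4) toeplitz_FTint[OF fin(1) m(1) i(1)] toeplitz_FTint[OF fin(2) m(2) i(2)] Wint_pair[OF fin m \<gamma> \<gamma>'] .
qed

text \<open>Bilinear extension from monomials: the right symbol and then the left symbol run over
  \<open>R_cl\<close>, after that the left and then the right operator over the norm closure. Each
  passage rests on the fact that composition with a fixed bounded operator pulls closed subspaces
  back to closed subspaces.\<close>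

lemma TT_comp:
  assumes A: "A \<in> TT" and B: "B \<in> TT"
  shows "A \<circ> B \<in> TT"
proof -
  have bd: "X \<in> bounded_ops t" if "X \<in> TT" for X using that op_closed_subspaceD(1)[OF op_closed_subspace_TT] by blast
  have 1: "toeplitz t f \<circ> toeplitz t g \<in> TT" if f: "f \<in> Mon" and g: "g \<in> R_cl t" for f g
  proof -
    have "R_cl t \<subseteq> {h \<in> BUC. toeplitz t h \<in> {X \<in> bounded_ops t. toeplitz t f \<circ> X \<in> TT}}"
      by (rule R_cl_subset_closed_subspace[OF toeplitz_pullback[OF op_closed_subspace_comp_left[OF op_closed_subspace_TT toeplitz_bounded_ops[OF Mon_BUC[OF f]]]]])
         (auto simp: Mon_BUC toeplitz_bounded_ops toeplitz_Mon_comp[OF f])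
    then show ?thesis using g by blast
  qed
  have 2: "toeplitz t f \<circ> toeplitz t g \<in> TT" if f: "f \<in> R_cl t" and g: "g \<in> R_cl t" for f g
  proof -
    have "R_cl t \<subseteq> {h \<in> BUC. toeplitz t h \<in> {X \<in> bounded_ops t. X \<circ> toeplitz t g \<in> TT}}"
      by (rule R_cl_subset_closed_subspace[OF toeplitz_pullback[OF op_closed_subspace_comp_right[OF op_closed_subspace_TT toeplitz_bounded_ops[OF R_cl_BUC[OF g]]]]])
         (auto simp: Mon_BUC toeplitz_bounded_ops 1[OF _ g])
    then show ?thesis using f by blast
  qed
  have 3: "A \<circ> toeplitz t g \<in> TT" if g: "g \<in> R_cl t" for g
  proof -
    have "TT \<subseteq> {X \<in> bounded_ops t. X \<circ> toeplitz t g \<in> TT}"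
      by (rule TT_subset[OF op_closed_subspace_comp_right[OF op_closed_subspace_TT toeplitz_bounded_ops[OF R_cl_BUC[OF g]]]])
         (auto simp: toeplitz_bounded_ops R_cl_BUC 2[OF _ g])
    then show ?thesis using A by blast
  qed
  have "TT \<subseteq> {X \<in> bounded_ops t. A \<circ> X \<in> TT}"
    by (rule TT_subset[OF op_closed_subspace_comp_left[OF op_closed_subspace_TT bd[OF A]]])
       (auto simp: toeplitz_bounded_ops R_cl_BUC 3)
  then show ?thesis using B by blast
qed

text \<open>The conjugate symbol gives the adjoint, and a bound for an operator is one for its
  adjoint. An approximation of \<open>A\<close> by \<open>toeplitz t f\<close> is thus an
  approximation of \<open>B\<close> by the Toeplitz operator of the conjugate symbol, with the same
  \<open>e\<close>.\<close>

lemma TT_adjoint: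
  assumes A: "A \<in> TT" and adj: "is_op_adjoint t A B"
  shows "B \<in> TT"
  unfolding T_lin_def
proof (rule op_closureI)
  have Ab: "A \<in> bounded_ops t" using A op_closed_subspaceD(1)[OF op_closed_subspace_TT] by blast
  show Bb: "B \<in> bounded_ops t" using adj by (simp add: is_op_adjoint_def)
  fix e :: real assume e: "e > 0"
  obtain X where X: "X \<in> toeplitz t ` R_cl t" "X \<in> bounded_ops t" "\<And>g. g \<in> fock t \<Longrightarrow> L2_norm t (\<lambda>w. A g w - X g w) \<le> e * L2_norm t g"
    using op_closure_approx[OF A[unfolded T_lin_def] TT_image_bounded e] by auto
  then obtain f where f: "f \<in> R_cl t" "X = toeplitz t f" by blast
  have fB: "f \<in> BUC" by (rule R_cl_BUC[OF f(1)])
  have cf: "(\<lambda>w. cnj (f w)) \<in> R_cl t" using R_cl_cstar f by (simp add: BUC_cstar_subalgebra_def)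
  let ?Y = "toeplitz t (\<lambda>w. cnj (f w))"
  have Yb: "?Y \<in> bounded_ops t" by (rule toeplitz_bounded_ops[OF R_cl_BUC[OF cf]])
  have Xb: "X \<in> bounded_ops t" unfolding f by (rule toeplitz_bounded_ops[OF fB])
  show "\<exists>Y\<in>toeplitz t ` R_cl t. \<forall>g\<in>fock t. L2_norm t (\<lambda>w. B g w - Y g w) \<le> e * L2_norm t g"
  proof (intro bexI ballI)
    show "?Y \<in> toeplitz t ` R_cl t" using cf by (rule imageI)
    fix g assume g: "g \<in> fock t"
    show "L2_norm t (\<lambda>w. B g w - ?Y g w) \<le> e * L2_norm t g"
    proof (rule adjoint_norm_le[where A="\<lambda>g w. A g w - X g w" and B="\<lambda>g w. B g w - ?Y g w"])
      fix h k assume h: "h \<in> fock t" and k: "k \<in> fock t"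
      have "L2_inner t (\<lambda>w. A h w - X h w) k = L2_inner t (A h) k - L2_inner t (X h) k"
        by (intro L2_inner_diff_left fock_L2 bounded_opsD(1)[OF Ab h] bounded_opsD(1)[OF Xb h] k)
      also have "L2_inner t (A h) k = L2_inner t h (B k)" using adj h k by (simp add: is_op_adjoint_def)
      also have "L2_inner t (X h) k = L2_inner t h (?Y k)" unfolding f by (rule toeplitz_adjoint[OF fB h k])
      also have "L2_inner t h (B k) - L2_inner t h (?Y k) = L2_inner t h (\<lambda>w. B k w - ?Y k w)"
      proof -
        have "L2_inner t (\<lambda>w. B k w - ?Y k w) h = L2_inner t (B k) h - L2_inner t (?Y k) h"
          by (intro L2_inner_diff_left fock_L2 bounded_opsD(1)[OF Bb k] bounded_opsD(1)[OF Yb k] h)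
        then show ?thesis unfolding L2_inner_commute[of h] by simp
      qed
      finally show "L2_inner t (\<lambda>w. A h w - X h w) k = L2_inner t h (\<lambda>w. B k w - ?Y k w)" .
    next
      show "(\<lambda>w. A h w - X h w) \<in> fock t" if "h \<in> fock t" for h
        by (intro fock_diff bounded_opsD(1)[OF Ab that] bounded_opsD(1)[OF Xb that])
      show "(\<lambda>w. B h w - ?Y h w) \<in> fock t" if "h \<in> fock t" for h
        by (intro fock_diff bounded_opsD(1)[OF Bb that] bounded_opsD(1)[OF Yb that])
    qed (use X(3) e g in auto)
  qed
qed

lemma TT_cstar: "op_cstar_subalgebra t TT"
  unfolding op_cstar_subalgebra_def
proof (intro conjI ballI allI impI)
  note D = op_closed_subspaceD[OF op_closed_subspace_TT]
  show "TT \<subseteq> bounded_ops t" "(\<lambda>g w. 0) \<in> TT" "op_closure t TT \<subseteq> TT" by (fact D)+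
  show "(\<lambda>g w. A g w + B g w) \<in> TT" if "A \<in> TT" "B \<in> TT" for A B using that by (rule D)
  show "(\<lambda>g w. c * A g w) \<in> TT" if "A \<in> TT" for A c using that by (rule D)
  show "A \<circ> B \<in> TT" if "A \<in> TT" "B \<in> TT" for A B using that by (rule TT_comp)
  show "B \<in> TT" if "A \<in> TT" "is_op_adjoint t A B" for A B using that by (rule TT_adjoint)
qed

lemma RR_eq_TT: "RR = TT"
proof
  show "RR \<subseteq> TT"
  proof (rule RR_least[OF TT_cstar])
    fix u
    show "Q u \<in> TT"
      unfolding Q_def by (rule Wint_in_TT[OF expm_finite_measure _ expm_good(1)]) (auto intro!: integrable_expm_bounded[where B=1])
  qed
qed (rule TT_subset_RR)

end

section \<open>Recovering a symbol from its Toeplitz operator\<close>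

text \<open>The sum \<open>z + w\<close> in place of a difference saves a reflection; for the radial
  kernels \<open>kap\<close> this is the usual convolution.\<close>

definition conv :: "(complex \<Rightarrow> real) \<Rightarrow> (complex \<Rightarrow> complex) \<Rightarrow> complex \<Rightarrow> complex" where
  "conv \<kappa> f z = (\<integral>w. \<kappa> w *\<^sub>R f (z + w) \<partial>lborel)"

lemma conv_integrable:
  fixes f h :: "complex \<Rightarrow> complex"
  assumes f: "f \<in> borel_measurable borel" "\<And>w. cmod (f w) \<le> B" and \<kappa>: "integrable lborel \<kappa>"
    and h: "h \<in> borel_measurable borel"
  shows "integrable lborel (\<lambda>w. \<kappa> w *\<^sub>R f (h w))"
proof (rule Bochner_Integration.integrable_bound)
  have [measurable]: "f \<in> borel_measurable borel" "h \<in> borel_measurable borel" "\<kappa> \<in> borel_measurable borel"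
    using f h borel_measurable_integrable[OF \<kappa>] by auto
  show "integrable lborel (\<lambda>w. B * \<kappa> w)" using \<kappa> by auto
  show "(\<lambda>w. \<kappa> w *\<^sub>R f (h w)) \<in> borel_measurable lborel" by measurable
  show "AE w in lborel. norm (\<kappa> w *\<^sub>R f (h w)) \<le> norm (B * \<kappa> w)"
  proof (rule AE_I2)
    fix w
    have "norm (\<kappa> w *\<^sub>R f (h w)) \<le> \<bar>\<kappa> w\<bar> * B" using f(2)[of "h w"] by (simp add: mult_left_mono)
    also have "\<dots> \<le> norm (B * \<kappa> w)" using order_trans[OF norm_ge_zero f(2)] by (simp add: abs_mult mult.commute)
    finally show "norm (\<kappa> w *\<^sub>R f (h w)) \<le> norm (B * \<kappa> w)" .
  qed
qed

lemma conv_diff_bound: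
  assumes f: "f \<in> borel_measurable borel" "\<And>w. cmod (f w) \<le> B" and \<kappa>: "integrable lborel \<kappa>" "integrable lborel \<kappa>'"
  shows "cmod (conv \<kappa> f z - conv \<kappa>' f z) \<le> B * (\<integral>w. \<bar>\<kappa> w - \<kappa>' w\<bar> \<partial>lborel)"
proof -
  have i: "integrable lborel (\<lambda>w. \<kappa> w *\<^sub>R f (z + w))" "integrable lborel (\<lambda>w. \<kappa>' w *\<^sub>R f (z + w))"
    by (rule conv_integrable[OF f \<kappa>(1)], measurable, rule conv_integrable[OF f \<kappa>(2)], measurable)
  have "conv \<kappa> f z - conv \<kappa>' f z = (\<integral>w. (\<kappa> w - \<kappa>' w) *\<^sub>R f (z + w) \<partial>lborel)"
    unfolding conv_def using i by (simp add: scaleR_left_diff_distrib)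
  also have "cmod \<dots> \<le> (\<integral>w. B * \<bar>\<kappa> w - \<kappa>' w\<bar> \<partial>lborel)"
  proof (rule Bochner_Integration.integral_norm_bound_integral)
    show "integrable lborel (\<lambda>w. (\<kappa> w - \<kappa>' w) *\<^sub>R f (z + w))" using i by (simp add: scaleR_left_diff_distrib)
    show "integrable lborel (\<lambda>w. B * \<bar>\<kappa> w - \<kappa>' w\<bar>)" using \<kappa> by auto
    show "norm ((\<kappa> w - \<kappa>' w) *\<^sub>R f (z + w)) \<le> B * \<bar>\<kappa> w - \<kappa>' w\<bar>" for w
      using mult_right_mono[OF f(2)[of "z + w"] abs_ge_zero[of "\<kappa> w - \<kappa>' w"]] by (simp add: mult.commute)
  qed
  finally show ?thesis by simp
qed

lemma conv_limit:
  assumes D: "BUC_closed_subspace D" and f: "f \<in> borel_measurable borel" "\<And>w. cmod (f w) \<le> B"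
    and i: "\<And>n. integrable lborel (\<kappa>s n)" "integrable lborel \<kappa>"
    and mem: "\<And>n. conv (\<kappa>s n) f \<in> D"
    and lim: "(\<lambda>n::nat. \<integral>w. \<bar>\<kappa>s n w - \<kappa> w\<bar> \<partial>lborel) \<longlonglongrightarrow> 0"
  shows "conv \<kappa> f \<in> D"
proof (rule BUC_closed_limit[OF D mem])
  show "uniform_limit UNIV (\<lambda>n. conv (\<kappa>s n) f) (conv \<kappa> f) sequentially"
  proof (rule uniform_limitI)
    fix e :: real assume e: "e > 0"
    have "(\<lambda>n. B * (\<integral>w. \<bar>\<kappa>s n w - \<kappa> w\<bar> \<partial>lborel)) \<longlonglongrightarrow> B * 0" by (intro tendsto_intros lim)
    then have "(\<lambda>n. B * (\<integral>w. \<bar>\<kappa>s n w - \<kappa> w\<bar> \<partial>lborel)) \<longlonglongrightarrow> 0" by simp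
    from order_tendstoD(2)[OF this e]
    show "\<forall>\<^sub>F n in sequentially. \<forall>z\<in>UNIV. dist (conv (\<kappa>s n) f z) (conv \<kappa> f z) < e"
    proof eventually_elim
      case (elim n)
      show ?case using conv_diff_bound[OF f i(1)[of n] i(2)] elim by (auto simp: dist_norm intro: order_le_less_trans)
    qed
  qed
qed

lemma closed_subspace_sum:
  assumes D: "BUC_closed_subspace D" and "finite I" "\<And>i. i \<in> I \<Longrightarrow> F i \<in> D"
  shows "(\<lambda>z. \<Sum>i\<in>I. F i z) \<in> D"
  using assms(2,3)
proof (induction I rule: finite_induct)
  case empty then show ?case using BUC_closed_subspaceD(2)[OF D] by simp
next
  case (insert i I)
  then show ?case using BUC_closed_subspaceD(3)[OF D, of "F i" "\<lambda>z. \<Sum>i\<in>I. F i z"] by simp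
qed

text \<open>Replacing the integration variable by simple functions that converge to it pointwise
  turns the convolution into finite combinations of translates.\<close>

lemma conv_mem:
  assumes D: "BUC_closed_subspace D" "alpha_invariant D" and g: "g \<in> D" and \<kappa>: "integrable lborel \<kappa>"
  shows "conv \<kappa> g \<in> D"
proof -
  have gB: "g \<in> BUC" using BUC_closed_subspaceD(1)[OF D(1)] g by blast
  obtain B where B: "B > 0" "\<And>w. cmod (g w) \<le> B" using BUC_bound[OF gB] by blast
  have gc: "continuous_on UNIV g" using gB by (simp add: BUC_def uniformly_continuous_imp_continuous)
  have gm[measurable]: "g \<in> borel_measurable borel" by (rule borel_measurable_continuous_onI[OF gc])
  have \<kappa>m[measurable]: "\<kappa> \<in> borel_measurable borel" using borel_measurable_integrable[OF \<kappa>] by simp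
  obtain F where F: "\<And>i::nat. simple_function borel (F i)" "\<And>w::complex. (\<lambda>i. F i w) \<longlonglongrightarrow> w"
    using borel_measurable_implies_sequence_metric[of "\<lambda>w::complex. w" borel 0] by auto
  have Fm[measurable]: "F i \<in> borel_measurable borel" for i using borel_measurable_simple_function[OF F(1)] .
  have finF: "finite (range (F i))" for i using simple_functionD(1)[OF F(1)[of i]] by simp
  let ?h = "\<lambda>i z. \<integral>w. \<kappa> w *\<^sub>R g (z + F i w) \<partial>lborel"
  have mem: "?h i \<in> D" for i
  proof -
    let ?c = "\<lambda>p. \<integral>w. indicator (F i -` {p}) w * \<kappa> w \<partial>lborel"
    have ci: "integrable lborel (\<lambda>w. indicator (F i -` {p}) w * \<kappa> w)" for p
    proof -
      have [measurable]: "F i -` {p} \<in> sets borel" using measurable_sets[OF Fm[of i], of "{p}"] by simp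
      show ?thesis by (rule Bochner_Integration.integrable_bound[OF \<kappa>]) (auto simp: indicator_def)
    qed
    have "?h i z = (\<Sum>p\<in>range (F i). of_real (?c p) * g (z + p))" for z
    proof -
      have "\<kappa> w *\<^sub>R g (z + F i w) = (\<Sum>p\<in>range (F i). (indicator (F i -` {p}) w * \<kappa> w) *\<^sub>R g (z + p))" for w
      proof -
        have "(\<Sum>p\<in>range (F i). (indicator (F i -` {p}) w * \<kappa> w) *\<^sub>R g (z + p))
          = (\<Sum>p\<in>range (F i). if p = F i w then \<kappa> w *\<^sub>R g (z + p) else 0)"
          by (intro sum.cong) (auto simp: indicator_def)
        then show ?thesis by (simp add: finF)
      qed
      then have "?h i z = (\<Sum>p\<in>range (F i). \<integral>w. (indicator (F i -` {p}) w * \<kappa> w) *\<^sub>R g (z + p) \<partial>lborel)"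
        using ci by (simp add: Bochner_Integration.integral_sum)
      moreover have "(\<integral>w. (indicator (F i -` {p}) w * \<kappa> w) *\<^sub>R g (z + p) \<partial>lborel) = of_real (?c p) * g (z + p)" for p
        by (subst integral_scaleR_left) (auto simp: ci scaleR_conv_of_real)
      ultimately show ?thesis by (simp only:)
    qed
    moreover have "(\<lambda>z. \<Sum>p\<in>range (F i). of_real (?c p) * g (z + p)) \<in> D"
    proof (rule closed_subspace_sum[OF D(1) finF])
      fix p
      have "alpha (- p) g \<in> D" using D(2) g by (simp add: alpha_invariant_def)
      then have "(\<lambda>z. g (z + p)) \<in> D" by (simp add: alpha_def)
      then show "(\<lambda>z. of_real (?c p) * g (z + p)) \<in> D" by (rule BUC_closed_subspaceD(4)[OF D(1)])
    qed
    ultimately show ?thesis by simp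
  qed
  show ?thesis
  proof (rule BUC_closed_limit[OF D(1) mem])
    show "uniform_limit UNIV ?h (conv \<kappa> g) sequentially"
    proof (rule uniform_limitI)
      fix e :: real assume e: "e > 0"
      define I where "I = (\<integral>w. \<bar>\<kappa> w\<bar> \<partial>lborel)"
      have I: "I \<ge> 0" by (simp add: I_def)
      have e1: "e / (2 * (I + 1)) > 0" using e I by simp
      obtain d where d: "d > 0" "\<And>w w'. cmod (w' - w) < d \<Longrightarrow> cmod (g w' - g w) < e / (2 * (I + 1))"
        using BUC_ucont[OF gB e1] by blast
      \<comment> \<open>The part of \<open>\<kappa>\<close> where \<open>F i\<close> is still at
        distance at least \<open>d\<close> from the identity. Since \<open>F\<close> converges only
        pointwise, this part is controlled by dominated convergence and the bound
        \<open>2 * B\<close> for differences of \<open>g\<close>.\<close>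
      let ?T = "\<lambda>i w. \<bar>\<kappa> w\<bar> * indicator {v. d \<le> cmod (F i v - v)} w"
      have [measurable]: "{v. d \<le> cmod (F i v - v)} \<in> sets borel" for i by measurable
      have Ti: "integrable lborel (?T i)" for i
        by (rule Bochner_Integration.integrable_bound[OF \<kappa>]) (auto simp: indicator_def)
      have "(\<lambda>i. \<integral>w. ?T i w \<partial>lborel) \<longlonglongrightarrow> (\<integral>w. 0 \<partial>(lborel :: complex measure))"
      proof (rule integral_dominated_convergence[where w="\<lambda>w. \<bar>\<kappa> w\<bar>"])
        show "AE w in lborel. (\<lambda>i. ?T i w) \<longlonglongrightarrow> 0"
        proof (rule AE_I2)
          fix w
          have "\<forall>\<^sub>F i in sequentially. dist (F i w) w < d" using tendstoD[OF F(2) d(1)] .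
          then have "\<forall>\<^sub>F i in sequentially. ?T i w = 0" by eventually_elim (auto simp: dist_norm)
          then show "(\<lambda>i. ?T i w) \<longlonglongrightarrow> 0" by (rule tendsto_eventually)
        qed
      qed (use \<kappa> in \<open>auto simp: indicator_def\<close>)
      then have "(\<lambda>i. 2 * B * (\<integral>w. ?T i w \<partial>lborel)) \<longlonglongrightarrow> 2 * B * 0" by (intro tendsto_intros) simp
      then have "(\<lambda>i. 2 * B * (\<integral>w. ?T i w \<partial>lborel)) \<longlonglongrightarrow> 0" by simp
      moreover have "e / 2 > 0" using e by simp
      ultimately have "\<forall>\<^sub>F i in sequentially. 2 * B * (\<integral>w. ?T i w \<partial>lborel) < e / 2"
        by (rule order_tendstoD(2))
      then show "\<forall>\<^sub>F i in sequentially. \<forall>z\<in>UNIV. dist (?h i z) (conv \<kappa> g z) < e"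
      proof eventually_elim
        case (elim i)
        show ?case
        proof
          fix z
          have i1: "integrable lborel (\<lambda>w. \<kappa> w *\<^sub>R g (z + F i w))" by (rule conv_integrable[OF gm B(2) \<kappa>]) measurable
          have i2: "integrable lborel (\<lambda>w. \<kappa> w *\<^sub>R g (z + w))" by (rule conv_integrable[OF gm B(2) \<kappa>]) measurable
          have "dist (?h i z) (conv \<kappa> g z) = cmod (\<integral>w. \<kappa> w *\<^sub>R (g (z + F i w) - g (z + w)) \<partial>lborel)"
            unfolding conv_def dist_norm using i1 i2 by (simp add: scaleR_diff_right)
          also have "\<dots> \<le> (\<integral>w. e / (2 * (I + 1)) * \<bar>\<kappa> w\<bar> + 2 * B * ?T i w \<partial>lborel)"
          proof (rule Bochner_Integration.integral_norm_bound_integral)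
            show "integrable lborel (\<lambda>w. \<kappa> w *\<^sub>R (g (z + F i w) - g (z + w)))" using i1 i2 by (simp add: scaleR_diff_right)
            show "integrable lborel (\<lambda>w. e / (2 * (I + 1)) * \<bar>\<kappa> w\<bar> + 2 * B * ?T i w)" using \<kappa> Ti by auto
            fix w
            show "norm (\<kappa> w *\<^sub>R (g (z + F i w) - g (z + w))) \<le> e / (2 * (I + 1)) * \<bar>\<kappa> w\<bar> + 2 * B * ?T i w"
            proof (cases "cmod (F i w - w) < d")
              case True
              then have "cmod (g (z + F i w) - g (z + w)) \<le> e / (2 * (I + 1))" using d(2)[of "z + F i w" "z + w"] by simp
              from mult_left_mono[OF this abs_ge_zero[of "\<kappa> w"]] show ?thesis using True by (simp add: mult.commute)
            next
              case False
              have "cmod (g (z + F i w) - g (z + w)) \<le> 2 * B"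
                using norm_triangle_ineq4[of "g (z + F i w)" "g (z + w)"] B(2)[of "z + F i w"] B(2)[of "z + w"] by linarith
              from mult_left_mono[OF this abs_ge_zero[of "\<kappa> w"]]
              have "norm (\<kappa> w *\<^sub>R (g (z + F i w) - g (z + w))) \<le> 2 * B * ?T i w" using False by (simp add: mult.commute)
              moreover have "0 \<le> e / (2 * (I + 1)) * \<bar>\<kappa> w\<bar>" using e1 by (intro mult_nonneg_nonneg) auto
              ultimately show ?thesis by linarith
            qed
          qed
          also have "\<dots> = e / (2 * (I + 1)) * I + 2 * B * (\<integral>w. ?T i w \<partial>lborel)"
            using \<kappa> Ti by (simp add: I_def)
          also have "\<dots> < e / 2 + e / 2"
          proof (rule add_le_less_mono)
            have "e / (2 * (I + 1)) * I \<le> e / (2 * (I + 1)) * (I + 1)" using e1 by (intro mult_left_mono) auto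
            also have "\<dots> = e / 2" using I by (simp add: field_simps)
            finally show "e / (2 * (I + 1)) * I \<le> e / 2" .
          qed (rule elim)
          finally show "dist (?h i z) (conv \<kappa> g z) < e" by simp
        qed
      qed
    qed
  qed
qed

text \<open>Up to sign, the derivative of order \<open>k\<close> of the Gaussian with respect to
  \<open>c\<close>; together with factorials these are the Taylor coefficients in the width.\<close>

definition kap :: "real \<Rightarrow> nat \<Rightarrow> complex \<Rightarrow> real" where
  "kap c k w = cmod w ^ (2 * k) * exp (- (c * (cmod w)\<^sup>2))"

lemma kap_integrable: "c > 0 \<Longrightarrow> integrable lborel (kap c k)"
  unfolding kap_def[abs_def] by (rule integrable_gauss_moment)

lemma conv_scale: "conv (\<lambda>w. a * \<kappa> w) f = (\<lambda>z. of_real a * conv \<kappa> f z)"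
  by (simp add: conv_def[abs_def] scaleR_conv_of_real mult.assoc)

text \<open>The power series of \<open>exp (- d * x)\<close> converges in \<open>L\<^sup>1\<close> against the weight \<open>exp (- c * x)\<close>
  as soon as \<open>d < c\<close>, so that moments of a Gaussian give moments of a narrower one.\<close>

lemma conv_kap_narrow:
  assumes D: "BUC_closed_subspace D" and f: "f \<in> borel_measurable borel" "\<And>w. cmod (f w) \<le> B"
    and c: "c > 0" "0 < d" "d < c" and mem: "\<And>k. conv (kap c k) f \<in> D"
  shows "conv (kap (c + d) k) f \<in> D"
proof -
  define S where "S n x = (\<Sum>j<n. (- d * x) ^ j /\<^sub>R fact j)" for n :: nat and x :: real
  define \<kappa> where "\<kappa> n w = kap c k w * S n ((cmod w)\<^sup>2)" for n w
  have \<kappa>: "\<kappa> n w = (\<Sum>j<n. ((- d) ^ j / fact j) * kap c (k + j) w)" for n w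
    unfolding \<kappa>_def S_def sum_distrib_left
  proof (rule sum.cong[OF refl])
    fix j
    have "(- d * (cmod w)\<^sup>2) ^ j = (- d) ^ j * cmod w ^ (2 * j)"
      by (simp only: power_mult_distrib power_mult)
    then show "kap c k w * ((- d * (cmod w)\<^sup>2) ^ j /\<^sub>R fact j) = ((- d) ^ j / fact j) * kap c (k + j) w"
      by (simp add: kap_def power_add divide_inverse distrib_left)
  qed
  have \<kappa>i: "integrable lborel (\<kappa> n)" for n
    unfolding \<kappa>[abs_def] by (intro Bochner_Integration.integrable_sum integrable_mult_right kap_integrable c)
  have \<kappa>mem: "conv (\<kappa> n) f \<in> D" for n
  proof -
    have "conv (\<kappa> n) f = (\<lambda>z. \<Sum>j<n. of_real ((- d) ^ j / fact j) * conv (kap c (k + j)) f z)"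
    proof
      fix z
      have i: "integrable lborel (\<lambda>w. (((- d) ^ j / fact j) * kap c (k + j) w) *\<^sub>R f (z + w))" for j
        by (rule conv_integrable[OF f]) (intro integrable_mult_right kap_integrable c, measurable)
      have "conv (\<kappa> n) f z = (\<Sum>j<n. \<integral>w. (((- d) ^ j / fact j) * kap c (k + j) w) *\<^sub>R f (z + w) \<partial>lborel)"
        unfolding conv_def \<kappa> scaleR_sum_left by (rule Bochner_Integration.integral_sum) (rule i)
      then show "conv (\<kappa> n) f z = (\<Sum>j<n. of_real ((- d) ^ j / fact j) * conv (kap c (k + j)) f z)"
        unfolding conv_scale[unfolded conv_def fun_eq_iff, rule_format] by (simp add: conv_def)
    qed
    then show ?thesis
      by (simp only:) (intro closed_subspace_sum[OF D] BUC_closed_subspaceD(4)[OF D] mem finite_lessThan)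
  qed
  have Sx: "(\<lambda>n. S n x) \<longlonglongrightarrow> exp (- d * x)" for x
    using exp_converges[of "- d * x"] unfolding sums_def S_def .
  have Sb: "\<bar>S n x\<bar> \<le> exp (d * x)" if "x \<ge> 0" for n x
  proof -
    have "\<bar>S n x\<bar> \<le> (\<Sum>j<n. \<bar>(- d * x) ^ j /\<^sub>R fact j\<bar>)" unfolding S_def by (rule sum_abs)
    also have "\<dots> = (\<Sum>j<n. (d * x) ^ j /\<^sub>R fact j)"
      using that c by (intro sum.cong) (auto simp: power_abs abs_mult)
    also have "\<dots> \<le> (\<Sum>j. (d * x) ^ j /\<^sub>R fact j)"
      using that c by (intro sum_le_suminf summable_exp_generic) auto
    finally show ?thesis by (simp add: exp_def)
  qed
  have kd: "kap (c + d) k w = kap c k w * exp (- d * (cmod w)\<^sup>2)" for w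
    by (simp add: kap_def mult.assoc distrib_right flip: exp_add)
  have k0: "kap c' k' w \<ge> 0" for c' k' w by (simp add: kap_def)
  \<comment> \<open>The partial sums are bounded by \<open>exp (d * x)\<close>, which turns the
    majorant into a Gaussian of parameter \<open>c - d\<close>; it is integrable because
    \<open>d < c\<close>.\<close>
  have kdm: "kap c k w * exp (d * (cmod w)\<^sup>2) = kap (c - d) k w" for w
    by (simp add: kap_def mult.assoc left_diff_distrib flip: exp_add)
  have "(\<lambda>n. \<integral>w. \<bar>\<kappa> n w - kap (c + d) k w\<bar> \<partial>lborel) \<longlonglongrightarrow> (\<integral>w. 0 \<partial>(lborel :: complex measure))"
  proof (rule integral_dominated_convergence[where w="\<lambda>w. 2 * kap (c - d) k w"])
    show "integrable lborel (\<lambda>w. 2 * kap (c - d) k w)" using c by (intro integrable_mult_right kap_integrable) auto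
    show "AE w in lborel. (\<lambda>n. \<bar>\<kappa> n w - kap (c + d) k w\<bar>) \<longlonglongrightarrow> 0"
    proof (rule AE_I2)
      fix w :: complex
      have "(\<lambda>n. \<kappa> n w) \<longlonglongrightarrow> kap (c + d) k w" unfolding \<kappa>_def kd by (intro tendsto_mult_left Sx)
      then show "(\<lambda>n. \<bar>\<kappa> n w - kap (c + d) k w\<bar>) \<longlonglongrightarrow> 0" by (intro tendsto_rabs_zero LIM_zero)
    qed
    show "AE w in lborel. norm \<bar>\<kappa> n w - kap (c + d) k w\<bar> \<le> 2 * kap (c - d) k w" for n
    proof (rule AE_I2)
      fix w :: complex
      have "\<bar>\<kappa> n w - kap (c + d) k w\<bar> = kap c k w * \<bar>S n ((cmod w)\<^sup>2) - exp (- d * (cmod w)\<^sup>2)\<bar>"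
        unfolding \<kappa>_def kd right_diff_distrib[symmetric] abs_mult by (simp add: k0)
      also have "\<dots> \<le> kap c k w * (2 * exp (d * (cmod w)\<^sup>2))"
      proof (rule mult_left_mono[OF _ k0])
        have "exp (- d * (cmod w)\<^sup>2) \<le> exp (d * (cmod w)\<^sup>2)" using c by simp
        moreover have "\<bar>S n ((cmod w)\<^sup>2)\<bar> \<le> exp (d * (cmod w)\<^sup>2)" by (rule Sb) simp
        ultimately show "\<bar>S n ((cmod w)\<^sup>2) - exp (- d * (cmod w)\<^sup>2)\<bar> \<le> 2 * exp (d * (cmod w)\<^sup>2)"
          using abs_triangle_ineq4[of "S n ((cmod w)\<^sup>2)" "exp (- d * (cmod w)\<^sup>2)"]
          unfolding abs_exp_cancel by linarith
      qed
      also have "\<dots> = 2 * kap (c - d) k w" unfolding kdm[symmetric] by simp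
      finally show "norm \<bar>\<kappa> n w - kap (c + d) k w\<bar> \<le> 2 * kap (c - d) k w" by simp
    qed
    show "(\<lambda>w. \<bar>\<kappa> n w - kap (c + d) k w\<bar>) \<in> borel_measurable lborel" for n
      using borel_measurable_integrable[OF \<kappa>i[of n]] borel_measurable_integrable[OF kap_integrable[of "c + d" k]] c by simp
  qed simp
  then have lim: "(\<lambda>n. \<integral>w. \<bar>\<kappa> n w - kap (c + d) k w\<bar> \<partial>lborel) \<longlonglongrightarrow> 0" by simp
  show ?thesis
    by (rule conv_limit[OF D f \<kappa>i _ \<kappa>mem lim]) (use c in \<open>simp add: kap_integrable\<close>)
qed

text \<open>The Gaussians, normalized by \<open>c n / pi\<close>, are an approximate identity, and
  uniform continuity of \<open>f\<close> makes the convergence uniform in \<open>z\<close>, which is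
  the convergence under which \<open>D\<close> is closed.\<close>

lemma conv_gauss_limit:
  assumes D: "BUC_closed_subspace D" and f: "f \<in> BUC" and c: "\<And>n. c n > 0" "filterlim c at_top sequentially"
    and mem: "\<And>n. conv (kap (c n) 0) f \<in> D"
  shows "f \<in> D"
proof -
  obtain B where B: "B > 0" "\<And>w. cmod (f w) \<le> B" using BUC_bound[OF f] by blast
  have fm: "f \<in> borel_measurable borel"
    using f by (intro borel_measurable_continuous_onI uniformly_continuous_imp_continuous) (simp add: BUC_def)
  let ?g = "\<lambda>n z. of_real (c n / pi) * conv (kap (c n) 0) f z"
  have k1: "has_bochner_integral lborel (kap a 0) (pi / a)" if "a > 0" for a
    using has_bochner_integral_gauss[OF that] by (simp add: kap_def[abs_def])
  have "uniform_limit UNIV ?g f sequentially"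
  proof (rule uniform_limitI)
    fix e :: real assume e: "e > 0"
    then have "e / 2 > 0" by simp
    then obtain d where d: "d > 0" "\<And>w w'. cmod (w' - w) < d \<Longrightarrow> cmod (f w' - f w) < e / 2" using BUC_ucont[OF f] by blast
    have "filterlim (\<lambda>n. c n * (d\<^sup>2 / 2)) at_top sequentially"
      by (rule filterlim_tendsto_pos_mult_at_top[OF tendsto_const _ c(2), of "d\<^sup>2 / 2", unfolded mult.commute[of "d\<^sup>2 / 2"]]) (use d in simp)
    then have "(\<lambda>n. exp (- (c n * (d\<^sup>2 / 2)))) \<longlonglongrightarrow> 0"
      by (intro filterlim_compose[OF exp_at_bot]) (simp add: filterlim_uminus_at_bot)
    then have "(\<lambda>n. 4 * B * exp (- (c n * (d\<^sup>2 / 2)))) \<longlonglongrightarrow> 4 * B * 0" by (intro tendsto_intros)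
    then have "(\<lambda>n. 4 * B * exp (- (c n * (d\<^sup>2 / 2)))) \<longlonglongrightarrow> 0" by simp
    from order_tendstoD(2)[OF this \<open>e / 2 > 0\<close>]
    show "\<forall>\<^sub>F n in sequentially. \<forall>z\<in>UNIV. dist (?g n z) (f z) < e"
    proof eventually_elim
      case (elim n)
      show ?case
      proof
        fix z
        define a where "a = c n"
        have a: "a > 0" using c by (simp add: a_def)
        have ki: "integrable lborel (kap a 0)" and kv: "(\<integral>w. kap a 0 w \<partial>lborel) = pi / a"
          using k1[OF a] by (auto simp: has_bochner_integral_iff)
        have hi: "integrable lborel (kap (a / 2) 0)" and hv: "(\<integral>w. kap (a / 2) 0 w \<partial>lborel) = 2 * pi / a"
          using k1[of "a / 2"] a by (auto simp: has_bochner_integral_iff)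
        have i: "integrable lborel (\<lambda>w. kap a 0 w *\<^sub>R f (z + w))" by (rule conv_integrable[OF fm B(2) ki]) measurable
        have fz: "f z = of_real (a / pi) * (\<integral>w. kap a 0 w *\<^sub>R f z \<partial>lborel)"
          using ki a by (simp add: kv scaleR_conv_of_real)
        have eq: "?g n z - f z = of_real (a / pi) * (\<integral>w. kap a 0 w *\<^sub>R (f (z + w) - f z) \<partial>lborel)"
          unfolding a_def[symmetric] conv_def using i ki
          by (subst fz) (simp add: scaleR_diff_right right_diff_distrib)
        have "dist (?g n z) (f z) = a / pi * cmod (\<integral>w. kap a 0 w *\<^sub>R (f (z + w) - f z) \<partial>lborel)"
          unfolding dist_norm eq norm_mult norm_of_real using a by simp
        \<comment> \<open>Outside the disc of radius \<open>d\<close>, half of the Gaussian exponent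
          gives the small factor \<open>exp (- (a * (d\<^sup>2 / 2)))\<close>. The other half has
          integral \<open>2 * pi / a\<close>, whence the constant \<open>4 * B\<close> in the choice
          of \<open>n\<close>.\<close>
        also have "\<dots> \<le> a / pi * (\<integral>w. e / 2 * kap a 0 w + 2 * B * exp (- (a * (d\<^sup>2 / 2))) * kap (a / 2) 0 w \<partial>lborel)"
        proof (intro mult_left_mono Bochner_Integration.integral_norm_bound_integral)
          show "integrable lborel (\<lambda>w. kap a 0 w *\<^sub>R (f (z + w) - f z))" using i ki by (simp add: scaleR_diff_right)
          show "integrable lborel (\<lambda>w. e / 2 * kap a 0 w + 2 * B * exp (- (a * (d\<^sup>2 / 2))) * kap (a / 2) 0 w)" using ki hi by auto
          fix w
          have k0: "kap a' 0 w \<ge> 0" for a' by (simp add: kap_def)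
          show "norm (kap a 0 w *\<^sub>R (f (z + w) - f z)) \<le> e / 2 * kap a 0 w + 2 * B * exp (- (a * (d\<^sup>2 / 2))) * kap (a / 2) 0 w"
          proof (cases "cmod w < d")
            case True
            then have "cmod (f (z + w) - f z) \<le> e / 2" using d(2)[of "z + w" z] by simp
            then have "norm (kap a 0 w *\<^sub>R (f (z + w) - f z)) \<le> e / 2 * kap a 0 w"
              using k0[of a] mult_left_mono[of "cmod (f (z + w) - f z)" "e / 2" "kap a 0 w"] by (simp add: mult.commute)
            moreover have "0 \<le> 2 * B * exp (- (a * (d\<^sup>2 / 2))) * kap (a / 2) 0 w" using B k0 by (intro mult_nonneg_nonneg) auto
            ultimately show ?thesis by linarith
          next
            case False
            have "cmod (f (z + w) - f z) \<le> 2 * B"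
              using norm_triangle_ineq4[of "f (z + w)" "f z"] B(2)[of "z + w"] B(2)[of z] by linarith
            then have 1: "norm (kap a 0 w *\<^sub>R (f (z + w) - f z)) \<le> 2 * B * kap a 0 w"
              using k0[of a] mult_left_mono[of "cmod (f (z + w) - f z)" "2 * B" "kap a 0 w"] by (simp add: mult.commute)
            have "d\<^sup>2 \<le> (cmod w)\<^sup>2" using False d(1) by (intro power_mono) auto
            then have "a * (d\<^sup>2 / 2) \<le> a / 2 * (cmod w)\<^sup>2" using a by simp
            then have "kap a 0 w \<le> exp (- (a * (d\<^sup>2 / 2))) * kap (a / 2) 0 w"
              by (simp add: kap_def flip: exp_add)
            then have "2 * B * kap a 0 w \<le> 2 * B * (exp (- (a * (d\<^sup>2 / 2))) * kap (a / 2) 0 w)"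
              by (rule mult_left_mono) (use B in simp)
            with 1 have "norm (kap a 0 w *\<^sub>R (f (z + w) - f z)) \<le> 2 * B * exp (- (a * (d\<^sup>2 / 2))) * kap (a / 2) 0 w"
              unfolding mult.assoc by (rule order_trans)
            moreover have "0 \<le> e / 2 * kap a 0 w" using e k0 by (intro mult_nonneg_nonneg) auto
            ultimately show ?thesis by linarith
          qed
        qed (use a in simp)
        also have "\<dots> = e / 2 + 4 * B * exp (- (a * (d\<^sup>2 / 2)))"
          using ki hi a by (simp add: kv hv field_simps)
        also have "\<dots> < e" using elim by (simp add: a_def)
        finally show "dist (?g n z) (f z) < e" .
      qed
    qed
  qed
  then show ?thesis
    by (rule BUC_closed_limit[OF D BUC_closed_subspaceD(4)[OF D mem]])
qed

section \<open>Moments of a symbol as matrix elements of its Toeplitz operator\<close>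

context bargmann
begin

lemma monomial_fock: "(\<lambda>w. w ^ k) \<in> fock t"
proof -
  have "(\<lambda>w. w ^ k) \<in> L2 t"
  proof (rule L2_cong_norm[OF L2_exp_norm[of "real k"]])
    fix w
    have "cmod w ^ k \<le> exp (cmod w) ^ k" by (intro power_mono cmod_le_exp) auto
    then show "cmod (w ^ k) \<le> cmod (complex_of_real (exp (real k * cmod w)))"
      by (simp add: norm_power exp_of_nat_mult)
  qed measurable
  then show ?thesis by (auto simp: fock_def intro!: holomorphic_intros)
qed

text \<open>With the same vector in both slots only a squared modulus enters. Its factor from
  \<open>E\<close> moves the centre of the Gaussian to \<open>z\<close>, and the remaining weight is
  the radial one in \<open>kap\<close>.\<close>

lemma toeplitz_moment:
  assumes f: "f \<in> BUC"
  shows "L2_inner t (toeplitz t f (W z (\<lambda>w. w ^ k))) (W z (\<lambda>w. w ^ k)) = of_real (1 / (pi * t)) * conv (kap (1 / t) k) f z"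
proof -
  obtain B where B: "f \<in> borel_measurable borel" "\<And>w. cmod (f w) \<le> B" using BUC_meas_bound[OF f] by blast
  have [measurable]: "f \<in> borel_measurable borel" by (fact B(1))
  let ?e = "\<lambda>w. w ^ k :: complex"
  have eq: "f w * (W z ?e w * cnj (W z ?e w)) = (cmod (E z w))\<^sup>2 *\<^sub>R (f w * of_real (cmod (w - z) ^ (2 * k)))" for w
  proof -
    have "W z ?e w * cnj (W z ?e w) = of_real ((cmod (W z ?e w))\<^sup>2)" by (rule complex_norm_square[symmetric])
    also have "(cmod (W z ?e w))\<^sup>2 = (cmod (E z w))\<^sup>2 * cmod (w - z) ^ (2 * k)"
      by (simp add: W_def norm_mult norm_power power_mult_distrib power_mult mult.commute[of 2] flip: power_mult)
    finally show ?thesis by (simp add: scaleR_conv_of_real mult_ac)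
  qed
  have "L2_inner t (toeplitz t f (W z ?e)) (W z ?e) = (\<integral>w. (cmod (E z w))\<^sup>2 *\<^sub>R (f w * of_real (cmod (w - z) ^ (2 * k))) \<partial>\<mu>)"
    unfolding toeplitz_inner[OF B W_fock[OF monomial_fock] W_fock[OF monomial_fock]] eq ..
  also have "\<dots> = (\<integral>w. f (w + z) * of_real (cmod w ^ (2 * k)) \<partial>\<mu>)"
    by (subst integral_W(1)) auto
  also have "\<dots> = (\<integral>w. gw w *\<^sub>R (f (w + z) * of_real (cmod w ^ (2 * k))) \<partial>lborel)"
    by (rule integral_gauss_measure) measurable
  also have "\<dots> = (\<integral>w. (1 / (pi * t) * kap (1 / t) k w) *\<^sub>R f (z + w) \<partial>lborel)"
    by (simp add: gw_def kap_def scaleR_conv_of_real mult_ac add.commute)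
  also have "\<dots> = of_real (1 / (pi * t)) * conv (kap (1 / t) k) f z"
    using conv_scale[of "1 / (pi * t)" "kap (1 / t) k" f] by (simp only: conv_def fun_eq_iff)
  finally show ?thesis .
qed

text \<open>The vectors \<open>W z\<close> of a monomial have a norm independent of
  \<open>z\<close>. Norm approximation by \<open>toeplitz t g\<close> with \<open>g\<close> in
  \<open>D\<close> thus gives approximation, uniform in \<open>z\<close>, of the convolutions of
  \<open>f\<close> by those of \<open>g\<close>, and the latter lie in \<open>D\<close> by
  translation invariance and closedness. So the convolutions of \<open>f\<close> with all moments of
  one Gaussian lie in \<open>D\<close>, from which \<open>f\<close> is recovered.\<close>

lemma toeplitz_T_lin_mem:
  assumes D: "BUC_closed_subspace D" "alpha_invariant D" and f: "f \<in> BUC" and T: "toeplitz t f \<in> T_lin t D"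
  shows "f \<in> D"
proof -
  have DB: "D \<subseteq> BUC" by (rule BUC_closed_subspaceD(1)[OF D(1)])
  have im: "toeplitz t ` D \<subseteq> bounded_ops t" using toeplitz_bounded_ops DB by blast
  obtain B where B: "f \<in> borel_measurable borel" "\<And>w. cmod (f w) \<le> B" using BUC_meas_bound[OF f] by blast
  have base: "conv (kap (1 / t) k) f \<in> D" for k
  proof -
    let ?e = "\<lambda>w. w ^ k :: complex"
    \<comment> \<open>Converts a bound for matrix elements into one for convolutions:
      \<open>pi * t\<close> undoes the prefactor in \<open>toeplitz_moment\<close>, the squared norm
      comes from Cauchy-Schwarz and the operator bound, and the \<open>1\<close> makes the final
      inequality strict.\<close>
    define C where "C = pi * t * (L2_norm t ?e)\<^sup>2 + 1"
    have C: "C > 0" using t_pos by (simp add: C_def add_nonneg_pos)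
    have "\<exists>g\<in>D. \<forall>z. cmod (conv (kap (1 / t) k) g z - conv (kap (1 / t) k) f z) < 1 / (real n + 1)" for n
    proof -
      have e: "1 / (real n + 1) / C > 0" using C by simp
      obtain g where g: "g \<in> D" "\<forall>h\<in>fock t. L2_norm t (\<lambda>w. toeplitz t f h w - toeplitz t g h w) \<le> 1 / (real n + 1) / C * L2_norm t h"
        using op_closure_approx[OF T[unfolded T_lin_def] im e] by auto
      have gB: "g \<in> BUC" using g DB by blast
      have "cmod (conv (kap (1 / t) k) g z - conv (kap (1 / t) k) f z) < 1 / (real n + 1)" for z
      proof -
        have Wf: "W z ?e \<in> fock t" by (rule W_fock[OF monomial_fock])
        have WN: "L2_norm t (W z ?e) = L2_norm t ?e" by (rule W_L2(2)[OF fock_L2[OF monomial_fock]])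
        have L: "toeplitz t f (W z ?e) \<in> L2 t" "toeplitz t g (W z ?e) \<in> L2 t"
          using bounded_opsD(1)[OF toeplitz_bounded_ops[OF f] Wf] bounded_opsD(1)[OF toeplitz_bounded_ops[OF gB] Wf] by (auto simp: fock_L2)
        have "of_real (1 / (pi * t)) * (conv (kap (1 / t) k) f z - conv (kap (1 / t) k) g z)
          = L2_inner t (\<lambda>w. toeplitz t f (W z ?e) w - toeplitz t g (W z ?e) w) (W z ?e)"
          unfolding L2_inner_diff_left[OF L fock_L2[OF Wf]] toeplitz_moment[OF f] toeplitz_moment[OF gB] by (simp only: right_diff_distrib)
        then have "cmod (of_real (1 / (pi * t)) * (conv (kap (1 / t) k) f z - conv (kap (1 / t) k) g z))
          \<le> L2_norm t (\<lambda>w. toeplitz t f (W z ?e) w - toeplitz t g (W z ?e) w) * L2_norm t (W z ?e)"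
          using L2_Cauchy_Schwarz[OF L2_diff[OF L] fock_L2[OF Wf]] by simp
        also have "\<dots> \<le> 1 / (real n + 1) / C * L2_norm t (W z ?e) * L2_norm t (W z ?e)"
          using g(2) Wf by (intro mult_right_mono) auto
        finally have "1 / (pi * t) * cmod (conv (kap (1 / t) k) f z - conv (kap (1 / t) k) g z) \<le> 1 / (real n + 1) / C * (L2_norm t ?e)\<^sup>2"
          using t_pos unfolding WN by (simp add: norm_mult power2_eq_square norm_divide)
        then have "cmod (conv (kap (1 / t) k) f z - conv (kap (1 / t) k) g z) \<le> pi * t * (1 / (real n + 1) / C * (L2_norm t ?e)\<^sup>2)"
          using t_pos by (simp add: divide_le_eq mult.commute)
        also have "\<dots> = 1 / (real n + 1) / C * (pi * t * (L2_norm t ?e)\<^sup>2)" by (simp only: mult_ac)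
        also have "\<dots> < 1 / (real n + 1) / C * C" using e by (intro mult_strict_left_mono) (auto simp: C_def)
        also have "\<dots> = 1 / (real n + 1)" using C by simp
        finally show ?thesis by (simp add: norm_minus_commute)
      qed
      then show ?thesis using g(1) by blast
    qed
    then have "\<exists>G. \<forall>n. G n \<in> D \<and> (\<forall>z. cmod (conv (kap (1 / t) k) (G n) z - conv (kap (1 / t) k) f z) < 1 / (real n + 1))"
      by (intro choice allI) blast
    then obtain G where G: "\<And>n. G n \<in> D" "\<And>n z. cmod (conv (kap (1 / t) k) (G n) z - conv (kap (1 / t) k) f z) < 1 / (real n + 1)" by blast
    have ki: "integrable lborel (kap (1 / t) k)" using t_pos by (simp add: kap_integrable)
    show ?thesis
    proof (rule BUC_closed_limit[OF D(1) conv_mem[OF D G(1) ki]])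
      show "uniform_limit UNIV (\<lambda>n. conv (kap (1 / t) k) (G n)) (conv (kap (1 / t) k) f) sequentially"
      proof (rule uniform_limitI)
        fix e :: real assume e: "e > 0"
        have "(\<lambda>n. 1 / (real n + 1)) \<longlonglongrightarrow> 0" by real_asymp
        from order_tendstoD(2)[OF this e]
        show "\<forall>\<^sub>F n in sequentially. \<forall>z\<in>UNIV. dist (conv (kap (1 / t) k) (G n) z) (conv (kap (1 / t) k) f z) < e"
        proof eventually_elim
          case (elim n)
          then show ?case using G(2)[of n] by (auto simp: dist_norm intro: less_trans)
        qed
      qed
    qed
  qed
  \<comment> \<open>Each step narrows with \<open>d = c / 2\<close>; any fixed factor strictly
    between \<open>1\<close> and \<open>2\<close> would do in place of \<open>3 / 2\<close>. The
    index \<open>k\<close> is generalized because one narrowed moment uses infinitely many moments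
    of the previous Gaussian.\<close>
  have step: "conv (kap ((3 / 2) ^ n * (1 / t)) k) f \<in> D" for n k
  proof (induction n arbitrary: k)
    case 0 then show ?case using base by simp
  next
    case (Suc n)
    define c where "c = (3 / 2) ^ n * (1 / t)"
    have c: "c > 0" using t_pos by (simp add: c_def)
    have "conv (kap (c + c / 2) k) f \<in> D"
      by (rule conv_kap_narrow[OF D(1) B]) (use c Suc in \<open>auto simp: c_def\<close>)
    moreover have "c + c / 2 = (3 / 2) ^ Suc n * (1 / t)" by (simp add: c_def)
    ultimately show ?case by (simp only:)
  qed
  show ?thesis
  proof (rule conv_gauss_limit[OF D(1) f _ _ step])
    show "(3 / 2) ^ n * (1 / t) > 0" for n using t_pos by simp
    have "filterlim (\<lambda>n. (3 / 2 :: real) ^ n) at_top sequentially" by real_asymp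
    then show "filterlim (\<lambda>n. (3 / 2) ^ n * (1 / t)) at_top sequentially"
      using t_pos by (intro filterlim_at_top_mult_tendsto_pos[OF tendsto_const]) auto
  qed
qed

text \<open>The right-hand side does not mention \<open>D\<close>, and this is the uniqueness. Its
  inclusion in \<open>D\<close> is the recovery of a symbol from its Toeplitz operator.\<close>

lemma correspondence_unique:
  assumes "corresponds_to_resolvent_algebra t D"
  shows "D = {f \<in> BUC. toeplitz t f \<in> RR}"
proof -
  have D: "BUC_closed_subspace D" "alpha_invariant D" "RR = T_lin t D"
    using assms by (auto simp: corresponds_to_resolvent_algebra_def)
  have DB: "D \<subseteq> BUC" by (rule BUC_closed_subspaceD(1)[OF D(1)])
  show ?thesis
    using toeplitz_in_T_lin[OF DB] toeplitz_T_lin_mem[OF D(1,2)] DB D(3) by blast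
qed

lemma corresponds_R_cl: "corresponds_to_resolvent_algebra t (R_cl t)"
  unfolding corresponds_to_resolvent_algebra_def
  using R_cl_closed R_cl_alpha_invariant RR_eq_TT by simp

end

theorem theorem4p25:
  fixes t :: real
  assumes "t > 0"
  shows "(\<exists>!D. corresponds_to_resolvent_algebra t D) \<and> D0 t = R_cl t"
proof -
  interpret bargmann t by standard fact
  have u: "D = R_cl t" if "corresponds_to_resolvent_algebra t D" for D
    using correspondence_unique[OF that] correspondence_unique[OF corresponds_R_cl] by simp
  show ?thesis
  proof
    show "\<exists>!D. corresponds_to_resolvent_algebra t D"
      using corresponds_R_cl u by (rule ex1I)
    show "D0 t = R_cl t"
      unfolding D0_def using corresponds_R_cl u by (rule the_equality)
  qed
qed

end
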